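(* Let $r\geq k\geq 3$ be fixed integers. For every $\varepsilon>0$ there exist $\delta>0$ and an integer $n_0>0$ such that the following holds for all integers $n\geq n_0$. Suppose that $X\subseteq\mathbb{R}^{2r+1}$ is a set of $n$ points spanning at least $S^k_{2r+1}(n)-\delta n^k$ regular $(k-1)$-simplices. Then there exist a partition $X=A_0\,\dot\cup\, A_1\,\dot\cup\cdots\dot\cup\, A_r$ with $|A_0|<\varepsilon n$ and $|A_i|>n/r-\varepsilon n$ for each $i\in\{1,\dots,r\}$, and pairwise orthogonal spheres $C_1,\dots,C_r\subseteq\mathbb{R}^{2r+1}$ with $A_i\subseteq C_i$ for every $i\in\{1,\dots,r\}$, satisfying the following property. If $r\geq 4$, then (1) $\dim C_1=\dots=\dim C_{r-1}=1$ and $\dim C_r=2$; and (2) $C_1,\dots,C_r$ have the same center and the same radius. If $r=3$ (and hence $k=3$), then either (1) and (2) both hold, or both of the following hold: (1') $C_1,C_2,C_3$ are circles with pairwise distinct centers; and (2') the distance between any two points on different circles is the same (i.e., there is a constant $b$ such that $\|x-y\|=b$ for all $x\in C_i$, $y\in C_j$ and all distinct $i,j\in\{1,2,3\}$).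
   Context: A regular $(k-1)$-simplex in $\mathbb{R}^d$ is a set of $k$ distinct points of $\mathbb{R}^d$ that are pairwise equidistant (the common distance is arbitrary and may differ between simplices). A set $X\subseteq\mathbb{R}^d$ spans a regular $(k-1)$-simplex $\Delta$ if $\Delta\subseteq X$. $S^k_d(n)$ denotes the maximum number of regular $(k-1)$-simplices spanned by a set of $n$ points in $\mathbb{R}^d$. For $m\in\mathbb{N}$ ($m\geq1$), an $(m-1)$-dimensional sphere in $\mathbb{R}^d$ is a set of the form $\{x\in\mathcal{A}:\|x-c\|=\gamma\}$, where $\mathcal{A}\subseteq\mathbb{R}^d$ is an $m$-dimensional affine subspace, $c\in\mathcal{A}$ (the center) and $\gamma>0$ (the radius). Thus the dimension $\dim C$ of a sphere $C$ is the dimension of its affine hull minus $1$; a circle is a $1$-dimensional sphere. Two affine subspaces are orthogonal if their associated linear (direction) subspaces are orthogonal, and two spheres are orthogonal if their affine hulls are orthogonal. The symbol $\dot\cup$ denotes disjoint union. *)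

theory Defs
  imports "HOL-Analysis.Analysis"
begin

definition regular_simplex :: "nat \<Rightarrow> 'a::euclidean_space set \<Rightarrow> bool" where
  "regular_simplex k \<Delta> \<longleftrightarrow>
     finite \<Delta> \<and> card \<Delta> = k \<and> (\<exists>s. pairwise (\<lambda>x y. dist x y = s) \<Delta>)"

definition simplex_count :: "nat \<Rightarrow> 'a::euclidean_space set \<Rightarrow> nat" where
  "simplex_count k X = card {\<Delta>. \<Delta> \<subseteq> X \<and> regular_simplex k \<Delta>}"

text \<open>
  The ambient space, and with it the dimension d in the notation S^k_d(n), is given by the
  type argument. The set under \<open>Max\<close> is finite and nonempty, see below.
\<close>

definition max_simplex_count :: "'a::euclidean_space itself \<Rightarrow> nat \<Rightarrow> nat \<Rightarrow> nat" where
  "max_simplex_count _ k n = Max {simplex_count k X | X :: 'a set. finite X \<and> card X = n}"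

lemma simplex_counts_finite_nonempty:
  "finite {simplex_count k X | X :: 'a::euclidean_space set. finite X \<and> card X = n}"
  "{simplex_count k X | X :: 'a::euclidean_space set. finite X \<and> card X = n} \<noteq> {}"
proof -
  have "simplex_count k X \<le> 2 ^ n" if "finite X" "card X = n" for X :: "'a set"
  proof -
    have "simplex_count k X \<le> card (Pow X)"
      unfolding simplex_count_def using that by (intro card_mono) auto
    then show ?thesis
      using that by (simp add: card_Pow)
  qed
  then show "finite {simplex_count k X | X :: 'a set. finite X \<and> card X = n}"
    by (intro finite_subset[OF _ finite_atMost[of "2 ^ n"]]) auto
  have "infinite (UNIV :: 'a set)"
    using finite_imp_bounded not_bounded_UNIV by blast
  then obtain X :: "'a set" where "finite X" "card X = n"
    using infinite_arbitrarily_large by blast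
  then show "{simplex_count k X | X :: 'a set. finite X \<and> card X = n} \<noteq> {}"
    by blast
qed

text \<open>
  \<open>C\<close> is a sphere with center \<open>c\<close> and radius \<open>\<gamma>\<close> inside some affine subspace of dimension
  at least 1; the center and the radius are determined by \<open>C\<close>.
\<close>

definition is_sphere :: "'a::euclidean_space set \<Rightarrow> 'a \<Rightarrow> real \<Rightarrow> bool" where
  "is_sphere C c \<gamma> \<longleftrightarrow>
     (\<exists>A. affine A \<and> aff_dim A \<ge> 1 \<and> c \<in> A \<and> \<gamma> > 0 \<and> C = {x \<in> A. norm (x - c) = \<gamma>})"

definition sphere_dim :: "'a::euclidean_space set \<Rightarrow> int" where
  "sphere_dim C = aff_dim (affine hull C) - 1"

definition direction :: "'a::euclidean_space set \<Rightarrow> 'a set" where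
  "direction A = {x - y | x y. x \<in> A \<and> y \<in> A}"

definition affine_orthogonal :: "'a::euclidean_space set \<Rightarrow> 'a set \<Rightarrow> bool" where
  "affine_orthogonal A B \<longleftrightarrow> (\<forall>u\<in>direction A. \<forall>v\<in>direction B. orthogonal u v)"

definition spheres_orthogonal :: "'a::euclidean_space set \<Rightarrow> 'a set \<Rightarrow> bool" where
  "spheres_orthogonal C D \<longleftrightarrow> affine_orthogonal (affine hull C) (affine hull D)"

lemma is_sphere_unique:
  fixes C :: "'a::euclidean_space set"
  assumes "is_sphere C c \<gamma>" "is_sphere C c' \<gamma>'"
  shows "c = c'" "\<gamma> = \<gamma>'"
proof -
  obtain A where A: "affine A" "aff_dim A \<ge> 1" "c \<in> A" "\<gamma> > 0" "C = {x \<in> A. norm (x - c) = \<gamma>}"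
    using assms(1) unfolding is_sphere_def by blast
  obtain B where B: "affine B" "aff_dim B \<ge> 1" "c' \<in> B" "\<gamma>' > 0" "C = {x \<in> B. norm (x - c') = \<gamma>'}"
    using assms(2) unfolding is_sphere_def by blast
  have antipodal: "z + (r / norm (y - z)) *\<^sub>R (y - z) \<in> {x \<in> S. norm (x - z) = r}"
      "z - (r / norm (y - z)) *\<^sub>R (y - z) \<in> {x \<in> S. norm (x - z) = r}"
    if "affine S" "z \<in> S" "y \<in> S" "y \<noteq> z" "r > 0" for S :: "'a set" and y z r
  proof -
    have "z + t *\<^sub>R (y - z) \<in> S" for t
      using mem_affine_3_minus[OF that(1,2,3,2)] by blast
    from this[of "r / norm (y - z)"] this[of "- (r / norm (y - z))"] that
    show "z + (r / norm (y - z)) *\<^sub>R (y - z) \<in> {x \<in> S. norm (x - z) = r}"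
      "z - (r / norm (y - z)) *\<^sub>R (y - z) \<in> {x \<in> S. norm (x - z) = r}"
      by auto
  qed
  have "\<exists>y\<in>B. y \<noteq> c'"
  proof (rule ccontr)
    assume "\<not> ?thesis"
    then have "B = {c'}" using B(3) by blast
    then show False using B(2) by simp
  qed
  then obtain y where y: "y \<in> B" "y \<noteq> c'" by blast
  define v where "v = (\<gamma>' / norm (y - c')) *\<^sub>R (y - c')"
  have "c' + v \<in> C" "c' - v \<in> C"
    unfolding B(5) v_def using antipodal[OF B(1,3) y B(4)] by auto
  then have "c' + v \<in> A" "c' - v \<in> A"
    using A(5) by auto
  then have "(1/2) *\<^sub>R (c' + v) + (1/2) *\<^sub>R (c' - v) \<in> A"
    using A(1) by (intro mem_affine) auto
  moreover have "(1/2) *\<^sub>R (c' + v) + (1/2) *\<^sub>R (c' - v) = c'"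
    by (simp add: algebra_simps flip: scaleR_add_left)
  ultimately have "c' \<in> A" by simp
  show "c = c'"
  proof (rule ccontr)
    assume "c \<noteq> c'"
    define t where "t = \<gamma> / norm (c' - c)"
    have "t > 0" using A(4) \<open>c \<noteq> c'\<close> by (simp add: t_def)
    have "c + t *\<^sub>R (c' - c) \<in> C" "c - t *\<^sub>R (c' - c) \<in> C"
      unfolding A(5) t_def using antipodal[OF A(1,3) \<open>c' \<in> A\<close> _ A(4)] \<open>c \<noteq> c'\<close> by auto
    then have "norm (c + t *\<^sub>R (c' - c) - c') = norm (c - t *\<^sub>R (c' - c) - c')"
      using B(5) by auto
    moreover have "c + t *\<^sub>R (c' - c) - c' = (t - 1) *\<^sub>R (c' - c)"
      "c - t *\<^sub>R (c' - c) - c' = (- t - 1) *\<^sub>R (c' - c)"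
      by (simp_all add: algebra_simps)
    ultimately have "\<bar>t - 1\<bar> = \<bar>- t - 1\<bar>"
      using \<open>c \<noteq> c'\<close> by simp
    then show False using \<open>t > 0\<close> by (simp add: abs_if split: if_splits)
  qed
  then show "\<gamma> = \<gamma>'"
    using A(5) B(5) \<open>c' + v \<in> C\<close> by auto
qed

end

theory Submission
  imports Defs
begin

text \<open>
  Only distances realised by a positive proportion of the pairs matter, and they are boundedly many.
  If two points are joined when their distance is one of them, the resulting graph has few
  \<open>(r + 1)\<close>-cliques: otherwise some \<open>r + 1\<close> triples would be pairwise equidistant, and since each
  triple is cospherical, their directions would be \<open>r + 1\<close> orthogonal spaces of dimension
  at least 2 in dimension \<open>2 * r + 1\<close>. The Moon--Moser inequalities, applied to this graph and to
  the cliques with a single distance, then bound the number of regular simplices by that of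
  \<open>r\<close> orthogonal circles, and near-equality forces most \<open>r\<close>-cliques with one distance \<open>s\<close> to have almost
  every point of \<open>X\<close> at distance \<open>s\<close> from all but one of their vertices. Exchanging single vertices of
  such a clique yields \<open>r\<close> classes which are almost completely joined by the distance \<open>s\<close>.

  If some class is far from any plane, four affinely independent points of it and triples of the
  other classes have directions filling the whole space, which puts all spheres at the
  same center. Otherwise the classes essentially lie on circles whose centers differ only along
  a line \<open>L\<close>. The equations \<open>\<gamma> i ^ 2 + (l i - l j) ^ 2 + \<gamma> j ^ 2 = s ^ 2\<close> for the radii and the positions on \<open>L\<close>
  leave only two cases: \<open>r = 3\<close> with distinct positions, or all positions but one agree; in the latter
  the exceptional circle lies on a 2-sphere with the same center and radius as the others.
\<close>

section \<open>Counting cliques\<close>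

text \<open>Summed over the distances, the single-distance clique counts still satisfy the
  Moon--Moser recursion, because the underlying identity is linear in the counts. What this sum
  lacks is a usable starting value: it counts every single point once per distance. The union graph
  supplies one, as it has exactly \<open>card X\<close> one-point cliques and agrees with the sum on
  pairs, where a clique determines its distance. The recursion bounds all differences of consecutive
  normalised counts from above. Since the count at \<open>k\<close> \<ge> 3 is almost maximal, the
  difference between sizes 2 and 3 cannot be very negative, and this lower bound travels upwards to
  \<open>r\<close>, where the defect is read off. Boundedly many distances are needed because the
  rarity of larger cliques comes from a pigeonhole over distance patterns. Discarding the other
  distances is harmless because a graph with \<open>d\<close> edges has only O(d^(3/2)) triangles,
  so a distance with few pairs carries disproportionately few simplices.\<close>

definition cliques :: "('a \<Rightarrow> 'a \<Rightarrow> bool) \<Rightarrow> 'a set \<Rightarrow> nat \<Rightarrow> 'a set set" where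
  "cliques E V t = {Q. Q \<subseteq> V \<and> finite Q \<and> card Q = t \<and> pairwise E Q}"

definition extenders :: "('a \<Rightarrow> 'a \<Rightarrow> bool) \<Rightarrow> 'a set \<Rightarrow> 'a set \<Rightarrow> 'a set" where
  "extenders E V Q = {y \<in> V. \<forall>q\<in>Q. E q y}"

definition far_vertices :: "('a \<Rightarrow> 'a \<Rightarrow> bool) \<Rightarrow> 'a set \<Rightarrow> 'a set \<Rightarrow> 'a set" where
  "far_vertices E V Q = {y \<in> V. \<exists>p\<in>Q. \<exists>q\<in>Q. p \<noteq> q \<and> \<not> E p y \<and> \<not> E q y}"

locale fin_graph =
  fixes V :: "'a set" and E :: "'a \<Rightarrow> 'a \<Rightarrow> bool"
  assumes finite_V: "finite V"
    and sym: "E x y \<Longrightarrow> E y x"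
    and irrefl: "\<not> E x x"
begin

lemma finite_cliques: "finite (cliques E V t)"
  unfolding cliques_def using finite_V by (auto intro: finite_subset[OF _ finite_Pow_iff[THEN iffD2]])

lemma finite_extenders: "finite (extenders E V Q)"
  unfolding extenders_def using finite_V by auto

lemma card_extenders_le: "card (extenders E V Q) \<le> card V"
  unfolding extenders_def using finite_V by (auto intro: card_mono)

lemma finite_far: "finite (far_vertices E V Q)"
  unfolding far_vertices_def using finite_V by auto

text \<open>Double counting of a clique together with a vertex extending it, against the larger
  clique with a marked vertex. The weight \<open>f\<close> sits on the smaller clique; choosing for
  it the number of extenders produces second moments.\<close>

lemma sum_cliques_extenders:
  fixes f :: "'a set \<Rightarrow> real"
  shows "(\<Sum>P\<in>cliques E V t. real (card (extenders E V P)) * f P)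
    = (\<Sum>Q\<in>cliques E V (Suc t). \<Sum>x\<in>Q. f (Q - {x}))"
proof -
  have "(\<Sum>P\<in>cliques E V t. real (card (extenders E V P)) * f P)
      = (\<Sum>P\<in>cliques E V t. \<Sum>x\<in>extenders E V P. f P)"
    by simp
  also have "\<dots> = (\<Sum>(P,x)\<in>(SIGMA P:cliques E V t. extenders E V P). f P)"
    by (subst sum.Sigma) (auto simp: finite_cliques finite_extenders)
  also have "\<dots> = (\<Sum>(Q,x)\<in>(SIGMA Q:cliques E V (Suc t). Q). f (Q - {x}))"
  proof (rule sum.reindex_bij_witness[where i = "\<lambda>(Q,x). (Q - {x}, x)" and j = "\<lambda>(P,x). (insert x P, x)"], goal_cases)
    case (1 a)
    then show ?case using irrefl by (auto simp: extenders_def)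
  next
    case (2 a)
    then obtain P x where a: "a = (P,x)" "P \<in> cliques E V t" "x \<in> extenders E V P" by auto
    then have "x \<notin> P" using irrefl by (auto simp: extenders_def)
    then show ?case using a sym
      by (auto simp: extenders_def cliques_def pairwise_insert)
  next
    case (3 b)
    then show ?case by auto
  next
    case (4 b)
    then obtain Q x where b: "b = (Q,x)" "Q \<in> cliques E V (Suc t)" "x \<in> Q" by auto
    then show ?case
      by (auto simp: extenders_def cliques_def pairwise_def)
  next
    case (5 a)
    then obtain P x where a: "a = (P,x)" "P \<in> cliques E V t" "x \<in> extenders E V P" by auto
    then have "x \<notin> P" using irrefl by (auto simp: extenders_def)
    then show ?case using a by simp
  qed
  also have "\<dots> = (\<Sum>Q\<in>cliques E V (Suc t). \<Sum>x\<in>Q. f (Q - {x}))"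
    by (subst sum.Sigma) (simp_all add: finite_cliques, auto simp: cliques_def)
  finally show ?thesis .
qed

lemma sum_card_extenders:
  "(\<Sum>P\<in>cliques E V t. real (card (extenders E V P))) = real (Suc t) * real (card (cliques E V (Suc t)))"
proof -
  have "(\<Sum>P\<in>cliques E V t. real (card (extenders E V P)))
    = (\<Sum>Q\<in>cliques E V (Suc t). \<Sum>x\<in>Q. 1)"
    using sum_cliques_extenders[where f = "\<lambda>_. 1"] by simp
  also have "\<dots> = (\<Sum>Q\<in>cliques E V (Suc t). real (Suc t))"
    by (rule sum.cong) (auto simp: cliques_def)
  finally show ?thesis by simp
qed

lemma card_cliques_Suc_le: "card (cliques E V (Suc t)) \<le> card V * card (cliques E V t)"
proof -
  have "real (card (cliques E V (Suc t))) \<le> real (Suc t) * real (card (cliques E V (Suc t)))"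
    by (simp add: algebra_simps)
  also have "\<dots> \<le> (\<Sum>P\<in>cliques E V t. real (card V))"
    unfolding sum_card_extenders[symmetric] by (intro sum_mono) (simp add: card_extenders_le)
  also have "\<dots> = real (card V * card (cliques E V t))" by simp
  finally show ?thesis by linarith
qed

text \<open>A vertex \<open>y\<close> is counted \<open>t\<close> times if it is adjacent to all of
  \<open>Q\<close>, once if it misses exactly one member (as each member of \<open>Q\<close> misses
  itself), and not at all if it misses two. The three cases are captured by 1, plus
  \<open>t - 1\<close> for extenders, minus 1 for far vertices.\<close>

lemma sum_extenders_delete:
  assumes Q: "Q \<in> cliques E V t"
  shows "(\<Sum>x\<in>Q. real (card (extenders E V (Q - {x}))))
    = real (card V) + (real t - 1) * real (card (extenders E V Q)) - real (card (far_vertices E V Q))"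
proof -
  have fQ: "finite Q" "card Q = t" using Q by (auto simp: cliques_def)
  define missed where "missed y = {x \<in> Q. \<not> E x y}" for y
  have fm: "finite (missed y)" for y using fQ by (auto simp: missed_def)
  have "(\<Sum>x\<in>Q. real (card (extenders E V (Q - {x})))) =
      (\<Sum>x\<in>Q. \<Sum>y\<in>V. if y \<in> extenders E V (Q - {x}) then 1 else 0)"
  proof (rule sum.cong)
    fix x assume "x \<in> Q"
    have "(\<Sum>y\<in>V. if y \<in> extenders E V (Q - {x}) then (1::real) else 0)
      = (\<Sum>y\<in>{y\<in>V. y \<in> extenders E V (Q - {x})}. 1)"
      using finite_V by (subst sum.inter_filter) auto
    moreover have "{y\<in>V. y \<in> extenders E V (Q - {x})} = extenders E V (Q - {x})"
      by (auto simp: extenders_def)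
    ultimately show "real (card (extenders E V (Q - {x}))) =
      (\<Sum>y\<in>V. if y \<in> extenders E V (Q - {x}) then 1 else 0)" by simp
  qed simp
  also have "\<dots> = (\<Sum>y\<in>V. \<Sum>x\<in>Q. if y \<in> extenders E V (Q - {x}) then 1 else 0)"
    by (rule sum.swap)
  also have "\<dots> = (\<Sum>y\<in>V. 1 + (real t - 1) * (if y \<in> extenders E V Q then 1 else 0)
      - (if y \<in> far_vertices E V Q then 1 else 0))"
  proof (rule sum.cong)
    fix y assume y: "y \<in> V"
    have "{x \<in> Q. y \<in> extenders E V (Q - {x})} = {x \<in> Q. missed y \<subseteq> {x}}"
      using y by (auto simp: extenders_def missed_def)
    then have lhs: "(\<Sum>x\<in>Q. if y \<in> extenders E V (Q - {x}) then 1 else 0) = real (card {x \<in> Q. missed y \<subseteq> {x}})"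
      using fQ by (subst sum.inter_filter[symmetric]) auto
    consider "missed y = {}" | p where "missed y = {p}" | p q where "p \<in> missed y" "q \<in> missed y" "p \<noteq> q"
      by blast
    then show "(\<Sum>x\<in>Q. if y \<in> extenders E V (Q - {x}) then 1 else 0)
      = 1 + (real t - 1) * (if y \<in> extenders E V Q then 1 else 0)
      - (if y \<in> far_vertices E V Q then 1 else 0)"
    proof cases
      case 1
      then have "y \<in> extenders E V Q" "y \<notin> far_vertices E V Q"
        using y by (auto simp: extenders_def far_vertices_def missed_def)
      then show ?thesis unfolding lhs using 1 fQ by simp
    next
      case 2
      then have "p \<in> Q" "\<not> E p y" by (auto simp: missed_def)
      then have "{x \<in> Q. missed y \<subseteq> {x}} = {p}" using 2 by auto
      moreover have "y \<notin> extenders E V Q" using \<open>p \<in> Q\<close> \<open>\<not> E p y\<close> by (auto simp: extenders_def)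
      moreover have "y \<notin> far_vertices E V Q"
      proof
        assume "y \<in> far_vertices E V Q"
        then obtain u v where "u \<in> missed y" "v \<in> missed y" "u \<noteq> v"
          by (auto simp: far_vertices_def missed_def)
        then show False using 2 by auto
      qed
      ultimately show ?thesis unfolding lhs by simp
    next
      case 3
      then have "\<not> missed y \<subseteq> {x}" for x by auto
      then have "{x \<in> Q. missed y \<subseteq> {x}} = {}" by simp
      moreover have "y \<notin> extenders E V Q" using 3 by (auto simp: extenders_def missed_def)
      moreover have "y \<in> far_vertices E V Q" using 3 y by (auto simp: far_vertices_def missed_def)
      ultimately show ?thesis unfolding lhs by (simp del: Collect_empty_eq)
    qed
  qed simp
  also have "\<dots> = real (card V) + (real t - 1) * (\<Sum>y\<in>V. if y \<in> extenders E V Q then 1 else 0)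
      - (\<Sum>y\<in>V. if y \<in> far_vertices E V Q then 1 else 0)"
    by (simp add: sum.distrib sum_subtractf sum_distrib_left)
  also have "(\<Sum>y\<in>V. if y \<in> extenders E V Q then 1 else 0) = real (card (extenders E V Q))"
  proof -
    have "{y\<in>V. y \<in> extenders E V Q} = extenders E V Q" by (auto simp: extenders_def)
    then show ?thesis using finite_V by (subst sum.inter_filter[symmetric]) auto
  qed
  also have "(\<Sum>y\<in>V. if y \<in> far_vertices E V Q then 1 else 0) = real (card (far_vertices E V Q))"
  proof -
    have "{y\<in>V. y \<in> far_vertices E V Q} = far_vertices E V Q" by (auto simp: far_vertices_def)
    then show ?thesis using finite_V by (subst sum.inter_filter[symmetric]) auto
  qed
  finally show ?thesis .
qed

text \<open>The equality behind the Moon--Moser inequality; the left-hand side measures how far the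
  graph is from a complete multipartite one in which every \<open>t\<close>-clique has \<open>a\<close> extensions.\<close>

lemma clique_defect:
  fixes a :: real
  shows "(\<Sum>P\<in>cliques E V t. (real (card (extenders E V P)) - a)\<^sup>2)
      + (\<Sum>Q\<in>cliques E V (Suc t). real (card (far_vertices E V Q)))
    = real (card V) * real (card (cliques E V (Suc t)))
      + real t * (real t + 2) * real (card (cliques E V (Suc (Suc t))))
      - 2 * a * (real t + 1) * real (card (cliques E V (Suc t)))
      + a\<^sup>2 * real (card (cliques E V t))"
proof -
  let ?N = "\<lambda>t. real (card (cliques E V t))"
  let ?e = "\<lambda>P. real (card (extenders E V P))"
  have "(\<Sum>P\<in>cliques E V t. ?e P * ?e P)
      = (\<Sum>Q\<in>cliques E V (Suc t). \<Sum>x\<in>Q. ?e (Q - {x}))"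
    by (rule sum_cliques_extenders)
  also have "\<dots> = (\<Sum>Q\<in>cliques E V (Suc t). real (card V) + real t * ?e Q - real (card (far_vertices E V Q)))"
    by (rule sum.cong) (auto dest: sum_extenders_delete)
  also have "\<dots> = real (card V) * ?N (Suc t) + real t * (\<Sum>Q\<in>cliques E V (Suc t). ?e Q)
      - (\<Sum>Q\<in>cliques E V (Suc t). real (card (far_vertices E V Q)))"
    by (simp add: sum.distrib sum_subtractf sum_distrib_left)
  finally have sq: "(\<Sum>P\<in>cliques E V t. ?e P * ?e P) = real (card V) * ?N (Suc t)
      + real t * (real (Suc (Suc t)) * ?N (Suc (Suc t)))
      - (\<Sum>Q\<in>cliques E V (Suc t). real (card (far_vertices E V Q)))"
    by (simp only: sum_card_extenders)
  have "(\<Sum>P\<in>cliques E V t. (?e P - a)\<^sup>2)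
    = (\<Sum>P\<in>cliques E V t. ?e P * ?e P - 2 * a * ?e P + a\<^sup>2)"
    by (rule sum.cong) (auto simp: power2_eq_square algebra_simps)
  also have "\<dots> = (\<Sum>P\<in>cliques E V t. ?e P * ?e P) - 2 * a * (real (Suc t) * ?N (Suc t)) + a\<^sup>2 * ?N t"
    by (simp add: sum.distrib sum_subtractf sum_distrib_left[symmetric] sum_card_extenders)
  finally show ?thesis unfolding sq by (simp add: algebra_simps)
qed


text \<open>The exponent 3/2 improves on the trivial bound \<open>card D * card V\<close> when edges
  are few, and this gain makes rare distances negligible. Cauchy--Schwarz over the edges reduces the
  claim to counting edges with a pair of common neighbours.\<close>

lemma card_triangles_sq_le:
  assumes "D = {(x,y) \<in> V \<times> V. E x y}"
  shows "real (card (cliques E V 3)) ^ 2 \<le> real (card D) ^ 3"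
proof -
  define common where "common p = {z \<in> V. E (fst p) z \<and> E (snd p) z}" for p
  have fD: "finite D" unfolding assms by (rule finite_subset[of _ "V \<times> V"]) (use finite_V in auto)
  have fc: "finite (common p)" for p using finite_V by (auto simp: common_def)
  have "card (cliques E V 3) \<le> card (SIGMA p:D. common p)"
  proof (rule surj_card_le)
    show "finite (SIGMA p:D. common p)" using fD fc by auto
    show "cliques E V 3 \<subseteq> (\<lambda>((x,y),z). {x,y,z}) ` (SIGMA p:D. common p)"
    proof
      fix Q assume Q: "Q \<in> cliques E V 3"
      then obtain x y z where xyz: "Q = {x,y,z}" "x \<noteq> y" "x \<noteq> z" "y \<noteq> z"
        by (auto simp: cliques_def card_3_iff)
      then have "((x,y),z) \<in> (SIGMA p:D. common p)"
        using Q by (auto simp: cliques_def assms common_def pairwise_def)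
      then show "Q \<in> (\<lambda>((x,y),z). {x,y,z}) ` (SIGMA p:D. common p)"
        using xyz by force
    qed
  qed
  also have "\<dots> = (\<Sum>p\<in>D. card (common p))"
    using fD fc by simp
  finally have "real (card (cliques E V 3)) \<le> (\<Sum>p\<in>D. real (card (common p)))"
    by (metis of_nat_le_iff of_nat_sum)
  then have "real (card (cliques E V 3)) ^ 2 \<le> (\<Sum>p\<in>D. real (card (common p))) ^ 2"
    by (intro power_mono) auto
  also have "\<dots> \<le> (\<Sum>p\<in>D. real (card (common p)) ^ 2) * real (card D)"
    by (rule sum_squared_le_sum_of_squares)
  also have "(\<Sum>p\<in>D. real (card (common p)) ^ 2) = real (card (SIGMA p:D. common p \<times> common p))"
    using fD fc by (simp add: card_cartesian_product power2_eq_square)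
  \<comment> \<open>If \<open>u\<close> and \<open>v\<close> are common neighbours of
    \<open>x\<close> and \<open>y\<close>, the four vertices are recovered from the two edges
    \<open>(x,u)\<close> and \<open>(y,v)\<close>.\<close>
  also have "card (SIGMA p:D. common p \<times> common p) \<le> card (D \<times> D)"
  proof (rule card_inj_on_le)
    show "inj_on (\<lambda>((x,y),(u,v)). ((x,u),(y,v))) (SIGMA p:D. common p \<times> common p)"
      by (auto simp: inj_on_def)
    show "(\<lambda>((x,y),(u,v)). ((x,u),(y,v))) ` (SIGMA p:D. common p \<times> common p) \<subseteq> D \<times> D"
      by (auto simp: assms common_def)
  qed (use fD in auto)
  finally show ?thesis
    by (simp add: card_cartesian_product power3_eq_cube mult.assoc mult_right_mono)
qed

lemma card_cliques_add_le: "card (cliques E V (t + d)) \<le> card V ^ d * card (cliques E V t)"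
proof (induction d)
  case (Suc d)
  have "card (cliques E V (t + Suc d)) \<le> card V * card (cliques E V (t + d))"
    using card_cliques_Suc_le[of "t + d"] by simp
  also have "\<dots> \<le> card V * (card V ^ d * card (cliques E V t))"
    using Suc by simp
  finally show ?case by (simp add: mult.assoc)
qed simp

end

section \<open>The Moon--Moser recursion for normalised clique counts\<close>

text \<open>Writing \<open>N t = y t * (r choose t) * (n / r) ^ t\<close> normalises the balanced complete
  \<open>r\<close>-partite graph to \<open>y = 1\<close>. The ratio is the junk value 0 for \<open>t > r\<close>.\<close>

definition turan_ratio :: "nat \<Rightarrow> real \<Rightarrow> (nat \<Rightarrow> real) \<Rightarrow> nat \<Rightarrow> real" where
  "turan_ratio r n N t = N t * real r ^ t / (real (r choose t) * n ^ t)"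

text \<open>The hypothesis is nonnegativity of the defect for \<open>a = (r - t) * n / r\<close>,
  the number of extensions of a \<open>t\<close>-clique in the balanced complete
  \<open>r\<close>-partite graph. For this \<open>a\<close> the coefficients of the normalised
  inequality sum to zero, so only differences of \<open>y\<close> remain. At
  \<open>t = r - 1\<close> the next count cannot be normalised, since \<open>r choose Suc r\<close>
  vanishes, and it stays as an error term.\<close>

lemma turan_ratio_step:
  fixes n :: real
  assumes n: "n > 0" and t: "t < r"
    and ineq: "0 \<le> n * N (Suc t) + real t * (real t + 2) * N (Suc (Suc t))
        - 2 * (real (r - t) / real r * n) * (real t + 1) * N (Suc t)
        + (real (r - t) / real r * n)\<^sup>2 * N t"
  defines "y \<equiv> turan_ratio r n N"
    and "\<beta> \<equiv> (real t + 1) * real (r - t) / real r"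
  shows "Suc t < r \<Longrightarrow> \<beta> * (y (Suc t) - y t) \<le> (\<beta> - 1) * (y (Suc (Suc t)) - y (Suc t))"
    and "Suc t = r \<Longrightarrow> y r - y t \<le> (real r ^ 2 - 1) * real r ^ r * N (Suc r) / n ^ Suc r"
proof -
  have r: "real r > 0" using t by simp
  define b where "b = real (r choose t)"
  have b: "b > 0" using t by (simp add: b_def)
  \<comment> \<open>\<open>K\<close> is the value of \<open>n * N (Suc t)\<close> for the balanced
    complete \<open>r\<close>-partite graph; every term of the inequality is a multiple of
    it.\<close>
  define K where "K = b * n ^ Suc (Suc t) * real (r - t) / (real r ^ Suc t * (real t + 1))"
  have K: "K > 0" using n b r t by (simp add: K_def)
  have absorb: "real (r choose Suc u) * (real u + 1) = real (r choose u) * real (r - u)" for u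
  proof -
    have "(r choose Suc u) * Suc u = (r choose u) * (r - u)"
      using binomial_absorb_comp[of r u] binomial_absorption[of u r] by (simp add: mult.commute)
    then have "real ((r choose Suc u) * Suc u) = real ((r choose u) * (r - u))" by simp
    then show ?thesis unfolding of_nat_mult by (simp add: add.commute)
  qed
  have b1: "real (r choose Suc t) = b * real (r - t) / (real t + 1)"
    using absorb[of t] by (simp add: b_def field_simps)
  have b2: "real (r choose Suc (Suc t)) = b * real (r - t) * real (r - Suc t) / ((real t + 1) * (real t + 2))"
  proof -
    have "real (r choose Suc (Suc t)) * (real t + 2) = real (r choose Suc t) * real (r - Suc t)"
      using absorb[of "Suc t"] by (simp add: add.commute)
    then have "real (r choose Suc (Suc t)) = real (r choose Suc t) * real (r - Suc t) / (real t + 2)"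
      by (simp add: nonzero_eq_divide_eq)
    then show ?thesis unfolding b1 by simp
  qed
  have Nt: "N t = y t * b * n ^ t / real r ^ t"
    using n b r by (simp add: y_def turan_ratio_def b_def[symmetric])
  have N1: "N (Suc t) = y (Suc t) * (b * real (r - t) / (real t + 1)) * n ^ Suc t / real r ^ Suc t"
    using n b r t by (simp add: y_def turan_ratio_def b1)
  have rt: "real (r - t) = real r - real t" using t by simp
  have e1: "n * N (Suc t) = K * y (Suc t)"
    unfolding N1 K_def by (simp add: ac_simps)
  have e2: "(real (r - t) / real r * n)\<^sup>2 * N t = K * (\<beta> * y t)"
  proof -
    define \<tau> where "\<tau> = real t + 1"
    have "\<tau> \<noteq> 0" by (simp add: \<tau>_def add.commute)
    then show ?thesis
      unfolding Nt K_def \<beta>_def \<tau>_def[symmetric] using r n by (simp add: field_simps power2_eq_square)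
  qed
  have e3: "2 * (real (r - t) / real r * n) * (real t + 1) * N (Suc t) = K * (2 * \<beta> * y (Suc t))"
  proof -
    have "2 * (real (r - t) / real r * n) * (real t + 1) * N (Suc t) = 2 * \<beta> * (n * N (Suc t))"
      unfolding \<beta>_def by simp
    then show ?thesis unfolding e1 by simp
  qed
  {
    assume t2: "Suc t < r"
    have rt2: "real (r - Suc t) = real r - real t - 1" using t2 by simp
    have N2: "N (Suc (Suc t)) = y (Suc (Suc t)) * (b * real (r - t) * real (r - Suc t) / ((real t + 1) * (real t + 2)))
        * n ^ Suc (Suc t) / real r ^ Suc (Suc t)"
      using n b r t t2 by (simp add: y_def turan_ratio_def b2)
    have bet: "\<beta> - 1 = real t * real (r - Suc t) / real r"
      unfolding \<beta>_def rt rt2 using r by (simp add: field_simps)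
    have e4: "real t * (real t + 2) * N (Suc (Suc t)) = K * ((\<beta> - 1) * y (Suc (Suc t)))"
      unfolding N2 K_def bet using r by (simp add: divide_simps)
    have "0 \<le> K * (y (Suc t) + (\<beta> - 1) * y (Suc (Suc t)) - 2 * \<beta> * y (Suc t) + \<beta> * y t)"
      using ineq unfolding e1 e2 e3 e4 by (simp add: algebra_simps)
    then have "0 \<le> y (Suc t) + (\<beta> - 1) * y (Suc (Suc t)) - 2 * \<beta> * y (Suc t) + \<beta> * y t"
      using K by (simp add: zero_le_mult_iff)
    then show "\<beta> * (y (Suc t) - y t) \<le> (\<beta> - 1) * (y (Suc (Suc t)) - y (Suc t))"
      by (simp add: algebra_simps)
  }
  {
    \<comment> \<open>Here \<beta> is 1 and the coefficient \<open>t * (t + 2)\<close> becomes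
      \<open>r ^ 2 - 1\<close>.\<close>
    assume t2: "Suc t = r"
    have bet: "\<beta> = 1" unfolding \<beta>_def using t2 by auto
    have bt: "b = real r" unfolding b_def using t2 binomial_symmetric[of t r] by auto
    have Kr: "K = n ^ Suc r / real r ^ r"
    proof -
      have "real t + 1 = real r" "real (r - t) = 1" using t2 by auto
      then show ?thesis unfolding K_def bt t2 using r by simp
    qed
    have "real t = real r - 1" using t2 by auto
    have "K * (y r - y t) \<le> real t * (real t + 2) * N (Suc r)"
      using ineq unfolding e1 e2 e3 bet using t2 by (simp add: algebra_simps)
    also have "\<dots> = (real r ^ 2 - 1) * N (Suc r)"
      unfolding \<open>real t = real r - 1\<close> by (simp add: algebra_simps power2_eq_square)
    finally show "y r - y t \<le> (real r ^ 2 - 1) * real r ^ r * N (Suc r) / n ^ Suc r"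
      unfolding Kr using n r by (simp add: field_simps)
  }
qed

text \<open>Downward induction: the factor \<beta> on the left is at least 1, because
  \<open>(t + 1) * (r - t) - r = t * (r - t - 1)\<close>, so the bound passes from
  \<open>Suc t\<close> to \<open>t\<close> with the factor \<open>(\<beta> - 1) / \<beta>\<close>
  \<le> 1.\<close>

lemma differences_bounded_above:
  fixes D :: "nat \<Rightarrow> real"
  assumes step: "\<And>t. t0 \<le> t \<Longrightarrow> Suc t < r \<Longrightarrow>
      (real t + 1) * real (r - t) / real r * D t \<le> ((real t + 1) * real (r - t) / real r - 1) * D (Suc t)"
    and last: "D (r - 1) \<le> e" and "e \<ge> 0" "1 \<le> t0"
    and t: "t0 \<le> t" "t < r"
  shows "D t \<le> e"
proof -
  have "t \<le> r - 1" using t by simp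
  then show ?thesis using t
  proof (induction rule: inc_induct)
    case base
    then show ?case using last by simp
  next
    case (step u)
    define \<beta> where "\<beta> = (real u + 1) * real (r - u) / real r"
    have u: "Suc u < r" using step by simp
    have "\<beta> \<ge> 1"
    proof -
      obtain d where d: "r = Suc u + d" using u less_imp_add_positive by blast
      then show ?thesis using step.prems assms(4) by (simp add: \<beta>_def field_simps)
    qed
    have "\<beta> * D u \<le> (\<beta> - 1) * D (Suc u)"
      unfolding \<beta>_def using assms(1)[of u] step u by simp
    also have "\<dots> \<le> (\<beta> - 1) * e"
      using step \<open>\<beta> \<ge> 1\<close> u by (intro mult_left_mono) auto
    also have "\<dots> \<le> \<beta> * e" using \<open>e \<ge> 0\<close> by (simp add: algebra_simps)
    finally show ?case using \<open>\<beta> \<ge> 1\<close> by simp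
  qed
qed

text \<open>Read upwards, the recursion amplifies a negative lower bound by
  \<open>\<beta> / (\<beta> - 1)\<close>. As \<beta> \<le> r and
  \<open>\<beta> - 1 = u * (r - u - 1) / r\<close> \<ge> 1/r for \<open>1 \<le> u\<close> and
  \<open>Suc u < r\<close>, each step costs at most a factor \<open>r ^ 2\<close>.\<close>

lemma differences_bounded_below:
  fixes D :: "nat \<Rightarrow> real"
  assumes step: "\<And>t. t0 \<le> t \<Longrightarrow> Suc t < r \<Longrightarrow>
      (real t + 1) * real (r - t) / real r * D t \<le> ((real t + 1) * real (r - t) / real r - 1) * D (Suc t)"
    and first: "D t0 \<ge> - \<delta>" and "\<delta> \<ge> 0" "1 \<le> t0"
    and t: "t0 + d < r"
  shows "D (t0 + d) \<ge> - (real r ^ (2 * d) * \<delta>)"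
  using t
proof (induction d)
  case 0
  then show ?case using first by simp
next
  case (Suc d)
  define u where "u = t0 + d"
  define \<beta> where "\<beta> = (real u + 1) * real (r - u) / real r"
  have u: "Suc u < r" "1 \<le> u" using Suc assms(4) by (auto simp: u_def)
  then obtain e where e: "r = Suc (Suc u) + e" using less_imp_add_positive[of "Suc u" r]
    by (metis add_Suc_right add_Suc_shift gr0_implies_Suc)
  have b1: "\<beta> - 1 \<ge> 1 / real r"
    proof -
    have "real u + real e * real u \<ge> 1" using u by (simp add: add_increasing2)
    then show ?thesis unfolding \<beta>_def e by (simp add: field_simps)
  qed
  have b2: "\<beta> \<le> real r"
  proof -
    have "(real u + 1) * real (r - u) \<le> real r * real r"
      using u by (intro mult_mono) auto
    then show ?thesis using u by (simp add: \<beta>_def field_simps)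
  qed
  have r: "real r > 0" using u by simp
  have IH: "D u \<ge> - (real r ^ (2 * d) * \<delta>)" using Suc by (simp add: u_def)
  define x where "x = real r ^ (2 * d) * \<delta>"
  have x: "x \<ge> 0" using \<open>\<delta> \<ge> 0\<close> by (simp add: x_def)
  have "- (real r * x) \<le> - (\<beta> * x)" using b2 x by (simp add: mult_right_mono)
  also have "\<dots> \<le> \<beta> * D u"
    using mult_left_mono[OF IH, of \<beta>] b1 r unfolding x_def
    by (smt (verit) divide_nonneg_nonneg mult_minus_right)
  also have "\<dots> \<le> (\<beta> - 1) * D (Suc u)"
    unfolding \<beta>_def using step[of u] u by (simp add: u_def)
  finally have *: "- (real r * x) \<le> (\<beta> - 1) * D (Suc u)" .
  have "- (real r * real r * x) \<le> D (Suc u)"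
  proof (rule ccontr)
    assume neg: "\<not> ?thesis"
    then have "D (Suc u) < 0" using x r by (smt (verit) mult_nonneg_nonneg)
    then have "(\<beta> - 1) * D (Suc u) \<le> 1 / real r * D (Suc u)"
      using b1 by (intro mult_right_mono_neg) auto
    with * have "- (real r * x) \<le> 1 / real r * D (Suc u)" by simp
    then have "- (real r * real r * x) \<le> D (Suc u)" using r by (simp add: field_simps)
    with neg show False by simp
  qed
  then show ?case by (simp add: u_def x_def power2_eq_square power_add algebra_simps)
qed

section \<open>Dense sets of lists contain boxes\<close>

text \<open>The cubic lies above its tangent at \<open>a\<close>: the difference has the double root
  \<open>a\<close>. Summed over fibres, this acts as the power-mean inequality for third
  powers.\<close>

lemma cube_tangent:
  fixes f a :: real
  assumes "f \<ge> 0" "a \<ge> 0"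
  shows "f ^ 3 \<ge> 3 * a\<^sup>2 * f - 2 * a ^ 3"
proof -
  have "f ^ 3 - 3 * a\<^sup>2 * f + 2 * a ^ 3 = (f - a)\<^sup>2 * (f + 2 * a)"
    by (simp add: power2_eq_square power3_eq_cube algebra_simps)
  moreover have "(f - a)\<^sup>2 * (f + 2 * a) \<ge> 0" using assms by simp
  ultimately show ?thesis by simp
qed

text \<open>The first coordinates are chosen as a triple \<open>(a, b, c)\<close> of distinct vertices that
  lies in many fibres; convexity of \<open>f ^ 3\<close> makes such a triple exist.\<close>

lemma dense_lists_contain_box:
  fixes \<eta> :: real
  assumes "\<eta> > 0"
  shows "\<exists>n0. \<forall>V :: 'a set. finite V \<longrightarrow> card V \<ge> n0 \<longrightarrow>
    (\<forall>L. L \<subseteq> {xs. set xs \<subseteq> V \<and> length xs = t} \<longrightarrow> real (card L) \<ge> \<eta> * real (card V) ^ t \<longrightarrow>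
      (\<exists>Bs. length Bs = t \<and> (\<forall>B\<in>set Bs. B \<subseteq> V \<and> card B = 3) \<and>
        (\<forall>xs. list_all2 (\<in>) xs Bs \<longrightarrow> xs \<in> L)))"
  using assms
proof (induction t arbitrary: \<eta>)
  case 0
  show ?case
  proof (intro exI[of _ 0] allI impI)
    fix V :: "'a set" and L assume "L \<subseteq> {xs. set xs \<subseteq> V \<and> length xs = 0}"
      and "\<eta> * real (card V) ^ 0 \<le> real (card L)"
    moreover from this have "L \<noteq> {}" using 0 by auto
    ultimately have "[] \<in> L" by auto
    then show "\<exists>Bs. length Bs = 0 \<and> (\<forall>B\<in>set Bs. B \<subseteq> V \<and> card B = 3) \<and>
        (\<forall>xs. list_all2 (\<in>) xs Bs \<longrightarrow> xs \<in> L)" by auto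
  qed
next
  case (Suc t)
  \<comment> \<open>The density of triples is at least the cube of the density of single entries;
    half of it is given up for triples with repeated entries, whose share is controlled by
    \<open>n2\<close>.\<close>
  define \<eta>' where "\<eta>' = \<eta> ^ 3 / 2"
  have "\<eta>' > 0" using Suc by (simp add: \<eta>'_def)
  from Suc.IH[OF this] obtain n1 where n1: "\<forall>V :: 'a set. finite V \<longrightarrow> card V \<ge> n1 \<longrightarrow>
    (\<forall>L. L \<subseteq> {xs. set xs \<subseteq> V \<and> length xs = t} \<longrightarrow> real (card L) \<ge> \<eta>' * real (card V) ^ t \<longrightarrow>
      (\<exists>Bs. length Bs = t \<and> (\<forall>B\<in>set Bs. B \<subseteq> V \<and> card B = 3) \<and>
        (\<forall>xs. list_all2 (\<in>) xs Bs \<longrightarrow> xs \<in> L)))" ..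
  obtain n2 where n2: "real n2 \<ge> 6 / \<eta> ^ 3" using real_arch_simple by blast
  show ?case
  proof (intro exI[of _ "max 1 (max n1 n2)"] allI impI)
    fix V :: "'a set" and L
    assume V: "finite V" "max 1 (max n1 n2) \<le> card V"
      and L: "L \<subseteq> {xs. set xs \<subseteq> V \<and> length xs = Suc t}"
      and cL: "\<eta> * real (card V) ^ Suc t \<le> real (card L)"
    define n where "n = real (card V)"
    have n: "n \<ge> 1" "n \<ge> 6 / \<eta> ^ 3" "card V \<ge> n1" using V(2) n2 by (auto simp: n_def)
    define W where "W = {xs. set xs \<subseteq> V \<and> length xs = t}"
    have fW: "finite W" and cW: "real (card W) = n ^ t"
      unfolding W_def n_def using V(1) by (simp_all add: finite_lists_length_eq card_lists_length_eq)
    define F where "F xs = {y. y # xs \<in> L}" for xs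
    have FV: "F xs \<subseteq> V" for xs using L by (auto simp: F_def)
    then have fF: "finite (F xs)" for xs using V(1) finite_subset by blast
    have "L = (\<lambda>(xs,y). y # xs) ` (SIGMA xs:W. F xs)"
    proof
      show "L \<subseteq> (\<lambda>(xs,y). y # xs) ` (SIGMA xs:W. F xs)"
      proof
        fix l assume l: "l \<in> L"
        with L obtain y xs where "l = y # xs" by (cases l) auto
        with l L show "l \<in> (\<lambda>(xs,y). y # xs) ` (SIGMA xs:W. F xs)"
          by (force simp: W_def F_def)
      qed
    qed (auto simp: F_def)
    moreover have "inj_on (\<lambda>(xs,y). y # xs) (SIGMA xs:W. F xs)" by (auto simp: inj_on_def)
    ultimately have "card L = card (SIGMA xs:W. F xs)" by (metis card_image)
    also have "\<dots> = (\<Sum>xs\<in>W. card (F xs))" using fW fF by simp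
    finally have sF: "(\<Sum>xs\<in>W. real (card (F xs))) \<ge> \<eta> * n ^ Suc t"
      using cL by (simp add: n_def)
    define T where "T = {(a,b,c). a \<in> V \<and> b \<in> V \<and> c \<in> V \<and> a \<noteq> b \<and> a \<noteq> c \<and> b \<noteq> c}"
    have TV: "T \<subseteq> V \<times> V \<times> V" by (auto simp: T_def)
    have fT: "finite T" using V(1) TV finite_subset by blast
    define G where "G p = {xs \<in> W. fst p \<in> F xs \<and> fst (snd p) \<in> F xs \<and> snd (snd p) \<in> F xs}" for p
    have fG: "finite (G p)" for p using fW by (auto simp: G_def)
    \<comment> \<open>Triples from the fibre either have distinct entries and lie in
      \<open>T\<close>, or fall into one of the three diagonals \<open>?D1\<close>,
      \<open>?D2\<close>, \<open>?D3\<close> of at most \<open>n ^ 2\<close> elements each.\<close>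
    have cube: "real (card (F xs)) ^ 3 \<le> real (card {p\<in>T. xs \<in> G p}) + 3 * n\<^sup>2" if xs: "xs \<in> W" for xs
    proof -
      let ?D1 = "(\<lambda>(a,b). (a,a,b)) ` (V \<times> V)"
      let ?D2 = "(\<lambda>(a,b). (a,b,a)) ` (V \<times> V)"
      let ?D3 = "(\<lambda>(a,b). (a,b,b)) ` (V \<times> V)"
      let ?P = "{p\<in>T. xs \<in> G p}"
      have "F xs \<times> F xs \<times> F xs \<subseteq> ?P \<union> (?D1 \<union> (?D2 \<union> ?D3))"
        using FV[of xs] xs by (auto simp: T_def G_def image_iff)
      then have "card (F xs \<times> F xs \<times> F xs) \<le> card (?P \<union> (?D1 \<union> (?D2 \<union> ?D3)))"
        using fT V(1) by (intro card_mono) auto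
      also have "\<dots> \<le> card ?P + (card ?D1 + (card ?D2 + card ?D3))"
        by (intro order_trans[OF card_Un_le] add_mono order_refl)
      also have "\<dots> \<le> card ?P + (card (V \<times> V) + (card (V \<times> V) + card (V \<times> V)))"
        using V(1) by (intro add_mono order_refl card_image_le) auto
      finally have "card (F xs) ^ 3 \<le> card ?P + 3 * (card V)\<^sup>2"
        by (simp add: card_cartesian_product power3_eq_cube power2_eq_square mult.assoc)
      then have "real (card (F xs) ^ 3) \<le> real (card ?P + 3 * (card V)\<^sup>2)" by (simp only: of_nat_le_iff)
      then show ?thesis by (simp add: n_def)
    qed
    \<comment> \<open>The tangent is taken at \<open>\<eta> * n\<close>, the guaranteed average
      fibre size.\<close>
    have "\<eta> ^ 3 * n ^ (t + 3) = 3 * (\<eta> * n)\<^sup>2 * (\<eta> * n ^ Suc t) - 2 * (\<eta> * n) ^ 3 * n ^ t"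
      by (simp add: power_add power2_eq_square power3_eq_cube algebra_simps)
    also have "\<dots> \<le> 3 * (\<eta> * n)\<^sup>2 * (\<Sum>xs\<in>W. real (card (F xs))) - 2 * (\<eta> * n) ^ 3 * n ^ t"
      using mult_left_mono[OF sF, of "3 * (\<eta> * n)\<^sup>2"] by simp
    also have "\<dots> = (\<Sum>xs\<in>W. 3 * (\<eta> * n)\<^sup>2 * real (card (F xs)) - 2 * (\<eta> * n) ^ 3)"
      unfolding sum_subtractf sum_distrib_left[symmetric] by (simp add: cW mult.commute)
    also have "\<dots> \<le> (\<Sum>xs\<in>W. real (card (F xs)) ^ 3)"
      using Suc.prems n by (intro sum_mono cube_tangent) auto
    also have "\<dots> \<le> (\<Sum>xs\<in>W. real (card {p\<in>T. xs \<in> G p}) + 3 * n\<^sup>2)"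
      by (intro sum_mono cube)
    also have "\<dots> = (\<Sum>xs\<in>W. real (card {p\<in>T. xs \<in> G p})) + 3 * n ^ (t + 2)"
      by (simp add: sum.distrib cW power_add power2_eq_square)
    also have "(\<Sum>xs\<in>W. real (card {p\<in>T. xs \<in> G p})) = (\<Sum>p\<in>T. real (card (G p)))"
    proof -
      have "(\<Sum>xs\<in>W. card {p\<in>T. xs \<in> G p}) = (\<Sum>p\<in>T. card {xs\<in>W. xs \<in> G p})"
        using fT fW by (intro sum_multicount_gen) auto
      moreover have "{xs\<in>W. xs \<in> G p} = G p" for p by (auto simp: G_def)
      ultimately show ?thesis by (metis (no_types, lifting) of_nat_sum sum.cong)
    qed
    finally have low: "\<eta> ^ 3 * n ^ (t + 3) - 3 * n ^ (t + 2) \<le> (\<Sum>p\<in>T. real (card (G p)))" by simp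
    have "3 * n ^ (t + 2) \<le> \<eta>' * n ^ (t + 3)"
    proof -
      have "3 \<le> \<eta>' * n" using n(2) Suc.prems by (simp add: \<eta>'_def field_simps)
      then have "3 * n ^ (t + 2) \<le> \<eta>' * n * n ^ (t + 2)" using n by (intro mult_right_mono) auto
      then show ?thesis by (simp add: power_add power2_eq_square power3_eq_cube algebra_simps)
    qed
    with low have low': "\<eta>' * n ^ (t + 3) \<le> (\<Sum>p\<in>T. real (card (G p)))"
      by (simp add: \<eta>'_def)
    have "\<exists>p\<in>T. real (card (G p)) \<ge> \<eta>' * n ^ t"
    proof (rule ccontr)
      assume "\<not> ?thesis"
      then have less: "\<And>p. p \<in> T \<Longrightarrow> real (card (G p)) < \<eta>' * n ^ t" by force
      have pos: "0 < \<eta>' * n ^ (t + 3)" using \<open>\<eta>' > 0\<close> n by simp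
      then have "T \<noteq> {}" using low' by auto
      then have "(\<Sum>p\<in>T. real (card (G p))) < (\<Sum>p\<in>T. \<eta>' * n ^ t)"
        using less fT by (intro sum_strict_mono) auto
      also have "\<dots> = real (card T) * (\<eta>' * n ^ t)" by simp
      also have "\<dots> \<le> n ^ 3 * (\<eta>' * n ^ t)"
      proof (intro mult_right_mono)
        have "card T \<le> card (V \<times> V \<times> V)" using V(1) TV by (intro card_mono) auto
        then have "real (card T) \<le> real (card (V \<times> V \<times> V))" by (simp only: of_nat_le_iff)
        then show "real (card T) \<le> n ^ 3" by (simp add: card_cartesian_product n_def power3_eq_cube)
      qed (use \<open>\<eta>' > 0\<close> n in auto)
      finally show False using low' by (simp add: power_add algebra_simps)
    qed
    then obtain a b c where abc: "(a,b,c) \<in> T" "real (card (G (a,b,c))) \<ge> \<eta>' * n ^ t" by auto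
    have "G (a,b,c) \<subseteq> {xs. set xs \<subseteq> V \<and> length xs = t}" by (auto simp: G_def W_def)
    then obtain Bs where Bs: "length Bs = t" "\<forall>B\<in>set Bs. B \<subseteq> V \<and> card B = 3"
      "\<forall>xs. list_all2 (\<in>) xs Bs \<longrightarrow> xs \<in> G (a,b,c)"
      using n1[rule_format, OF V(1) n(3), of "G (a,b,c)"] abc(2) unfolding n_def by auto
    show "\<exists>Bs. length Bs = Suc t \<and> (\<forall>B\<in>set Bs. B \<subseteq> V \<and> card B = 3) \<and>
        (\<forall>xs. list_all2 (\<in>) xs Bs \<longrightarrow> xs \<in> L)"
    proof (intro exI[of _ "{a,b,c} # Bs"] conjI allI impI)
      show "\<forall>B\<in>set ({a,b,c} # Bs). B \<subseteq> V \<and> card B = 3"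
        using Bs abc(1) by (auto simp: T_def)
      fix xs assume "list_all2 (\<in>) xs ({a,b,c} # Bs)"
      then obtain x ys where "xs = x # ys" "x \<in> {a,b,c}" "list_all2 (\<in>) ys Bs"
        by (auto simp: list_all2_Cons2)
      with Bs(3) show "xs \<in> L" by (auto simp: G_def F_def)
    qed (use Bs in auto)
  qed
qed

section \<open>Families of points at a common distance\<close>

text \<open>Both \<open>z\<close> and \<open>c\<close> lie in the hyperplane bisecting
  \<open>x\<close> and \<open>x'\<close>, so their difference is parallel to it. Every orthogonality
  relation between classes and centers comes from this.\<close>

lemma inner_bisector:
  fixes x x' z c :: "'a::euclidean_space"
  assumes "dist z x = dist z x'" "dist c x = dist c x'"
  shows "(z - c) \<bullet> (x - x') = 0"
proof -
  have "(z - x) \<bullet> (z - x) = (z - x') \<bullet> (z - x')" "(c - x) \<bullet> (c - x) = (c - x') \<bullet> (c - x')"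
    using assms by (simp_all add: dist_norm power2_norm_eq_inner[symmetric])
  then show ?thesis by (simp add: inner_diff inner_commute algebra_simps)
qed

lemma inner_directions_zero:
  fixes B B' :: "'a::euclidean_space set"
  assumes "\<And>x y. x \<in> B \<Longrightarrow> y \<in> B' \<Longrightarrow> dist x y = s"
    and "u \<in> direction B" "v \<in> direction B'"
  shows "u \<bullet> v = 0"
proof -
  obtain x x' y y' where "u = x - x'" "x \<in> B" "x' \<in> B" "v = y - y'" "y \<in> B'" "y' \<in> B'"
    using assms(2,3) unfolding direction_def by blast
  then show ?thesis using inner_bisector[of x y y' x'] assms(1) by simp
qed

lemma inner_span_zero:
  fixes v :: "'a::euclidean_space"
  assumes "\<And>u. u \<in> S \<Longrightarrow> v \<bullet> u = 0" "u \<in> span S"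
  shows "v \<bullet> u = 0"
  using orthogonal_to_span[of u S v] assms by (auto simp: orthogonal_def)

text \<open>A line meets a sphere in at most two points, so three distinct cospherical points are
  not collinear.\<close>

lemma dim_direction_cospherical_ge_2:
  fixes B :: "'a::euclidean_space set"
  assumes "card B = 3" and cosph: "\<And>x. x \<in> B \<Longrightarrow> dist x z = s"
  shows "2 \<le> dim (direction B)"
proof -
  obtain a b c where abc: "B = {a,b,c}" "a \<noteq> b" "a \<noteq> c" "b \<noteq> c"
    using assms(1) by (auto simp: card_3_iff)
  define u where "u = b - c"
  have "a - c \<notin> span {u}"
  proof
    assume "a - c \<in> span {u}"
    then obtain k where k: "a - c = k *\<^sub>R u" by (auto simp: span_singleton)
    have u: "u \<bullet> u \<noteq> 0" using abc by (simp add: u_def)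
    define w where "w = c - z"
    have "a - z = w + k *\<^sub>R u" "b - z = w + u"
      unfolding w_def k[symmetric] by (simp_all add: u_def)
    moreover have "(a - z) \<bullet> (a - z) = w \<bullet> w" "(b - z) \<bullet> (b - z) = w \<bullet> w"
      using cosph abc(1) by (simp_all add: w_def dist_norm power2_norm_eq_inner[symmetric])
    ultimately have e: "2 * k * (w \<bullet> u) + k * k * (u \<bullet> u) = 0" "2 * (w \<bullet> u) + u \<bullet> u = 0"
      by (simp_all add: inner_simps inner_commute algebra_simps)
    \<comment> \<open>On the line \<open>c + k u\<close> the sphere condition is quadratic in
      \<open>k\<close>, and the parameters 0 and 1 are already taken by \<open>c\<close> and
      \<open>b\<close>.\<close>
    have "k * (k - 1) * (u \<bullet> u) = (2 * k * (w \<bullet> u) + k * k * (u \<bullet> u)) - k * (2 * (w \<bullet> u) + u \<bullet> u)"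
      by (simp add: algebra_simps)
    then have "k * (k - 1) = 0" using u unfolding e by simp
    then have "k = 0 \<or> k = 1" by simp
    then show False using k abc by (auto simp: u_def)
  qed
  then have "dim {a - c, u} = 2"
    using abc by (simp add: dim_insert u_def)
  moreover have "{a - c, u} \<subseteq> direction B"
    unfolding direction_def u_def abc by blast
  ultimately show ?thesis using dim_subset by metis
qed

lemma dim_orthogonal_UN:
  fixes U :: "'b \<Rightarrow> 'a::euclidean_space set"
  assumes "finite I"
    and "\<And>i j u v. i \<in> I \<Longrightarrow> j \<in> I \<Longrightarrow> i \<noteq> j \<Longrightarrow> u \<in> U i \<Longrightarrow> v \<in> U j \<Longrightarrow> u \<bullet> v = 0"
  shows "dim (\<Union>i\<in>I. U i) = (\<Sum>i\<in>I. dim (U i))"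
  using assms
proof (induction I rule: finite_induct)
  case (insert i I)
  have "dim (U i \<union> (\<Union>j\<in>I. U j)) = dim (U i) + dim (\<Union>j\<in>I. U j)"
  proof (rule dim_orthogonal_sum)
    fix x y assume "x \<in> U i" "y \<in> (\<Union>j\<in>I. U j)"
    then show "x \<bullet> y = 0" using insert.hyps insert.prems by blast
  qed
  moreover have "dim (\<Union>j\<in>I. U j) = (\<Sum>j\<in>I. dim (U j))"
    using insert.IH insert.prems by blast
  ultimately show ?case using insert.hyps by simp
qed simp

lemma sum_dim_orthogonal_le:
  fixes U :: "'b \<Rightarrow> 'a::euclidean_space set"
  assumes "finite I"
    and "\<And>i j u v. i \<in> I \<Longrightarrow> j \<in> I \<Longrightarrow> i \<noteq> j \<Longrightarrow> u \<in> U i \<Longrightarrow> v \<in> U j \<Longrightarrow> u \<bullet> v = 0"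
  shows "(\<Sum>i\<in>I. dim (U i)) \<le> DIM('a)"
  using dim_orthogonal_UN[OF assms] dim_subset_UNIV[of "\<Union>i\<in>I. U i"] by simp

lemma orthogonal_to_spanning_zero:
  fixes v :: "'a::euclidean_space"
  assumes "dim S = DIM('a)" "\<And>u. u \<in> S \<Longrightarrow> v \<bullet> u = 0"
  shows "v = 0"
proof -
  have "v \<in> span S" using assms(1) dim_eq_full[of S] by simp
  then have "v \<bullet> v = 0" using inner_span_zero[of S v v] assms(2) by blast
  then show ?thesis by simp
qed

section \<open>Spheres given by center, direction space and radius\<close>

definition sphere_in :: "'a::euclidean_space \<Rightarrow> 'a set \<Rightarrow> real \<Rightarrow> 'a set" where
  "sphere_in c U \<gamma> = {x. x - c \<in> U \<and> norm (x - c) = \<gamma>}"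

lemma affine_translate_subspace:
  fixes U :: "'a::euclidean_space set"
  assumes "subspace U"
  shows "affine {x. x - c \<in> U}" "aff_dim {x. x - c \<in> U} = int (dim U)"
proof -
  have eq: "{x. x - c \<in> U} = (+) c ` U"
  proof
    show "{x. x - c \<in> U} \<subseteq> (+) c ` U"
    proof
      fix x assume "x \<in> {x. x - c \<in> U}"
      then show "x \<in> (+) c ` U" by (intro image_eqI[of _ _ "x - c"]) auto
    qed
  qed auto
  show "affine {x. x - c \<in> U}"
    unfolding eq using subspace_imp_affine[OF assms] affine_translation by blast
  show "aff_dim {x. x - c \<in> U} = int (dim U)"
    unfolding eq by (simp add: aff_dim_translation_eq aff_dim_subspace assms)
qed

lemma is_sphere_sphere_in:
  fixes U :: "'a::euclidean_space set"
  assumes "subspace U" "1 \<le> dim U" "\<gamma> > 0"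
  shows "is_sphere (sphere_in c U \<gamma>) c \<gamma>"
  unfolding is_sphere_def
proof (intro exI[of _ "{x. x - c \<in> U}"] conjI)
  show "affine {x. x - c \<in> U}" "1 \<le> aff_dim {x. x - c \<in> U}"
    using affine_translate_subspace[OF assms(1), of c] assms(2) by auto
  show "c \<in> {x. x - c \<in> U}" using assms(1) by (simp add: subspace_0)
qed (use assms in \<open>auto simp: sphere_in_def\<close>)

text \<open>The center is the midpoint of two antipodal points of the sphere, and any other point of
  the affine space lies on the line through the center and its radial projection to the
  sphere.\<close>

lemma affine_hull_sphere_in:
  fixes U :: "'a::euclidean_space set"
  assumes U: "subspace U" "1 \<le> dim U" "\<gamma> > 0"
  shows "affine hull (sphere_in c U \<gamma>) = {x. x - c \<in> U}"
proof
  show "affine hull (sphere_in c U \<gamma>) \<subseteq> {x. x - c \<in> U}"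
    using affine_translate_subspace[OF U(1), of c]
    by (intro hull_minimal) (auto simp: sphere_in_def)
  let ?H = "affine hull (sphere_in c U \<gamma>)"
  have aff: "affine ?H" by (rule affine_affine_hull)
  have on: "c + (\<gamma> / norm u) *\<^sub>R u \<in> ?H" if "u \<in> U" "u \<noteq> 0" for u
  proof (rule hull_inc)
    show "c + (\<gamma> / norm u) *\<^sub>R u \<in> sphere_in c U \<gamma>"
      using that U by (simp add: sphere_in_def subspace_scale)
  qed
  have "\<not> U \<subseteq> {0}"
    using U(2) by (metis dim_eq_0 not_one_le_zero)
  then obtain u0 where u0: "u0 \<in> U" "u0 \<noteq> 0" by blast
  have "(1/2) *\<^sub>R (c + (\<gamma> / norm u0) *\<^sub>R u0) + (1/2) *\<^sub>R (c + (\<gamma> / norm (- u0)) *\<^sub>R (- u0)) \<in> ?H"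
    using u0 U(1) by (intro mem_affine[OF aff] on) (auto simp: subspace_neg)
  moreover have "(1/2) *\<^sub>R (c + (\<gamma> / norm u0) *\<^sub>R u0) + (1/2) *\<^sub>R (c + (\<gamma> / norm (- u0)) *\<^sub>R (- u0)) = c"
    by (simp add: algebra_simps flip: scaleR_add_left)
  ultimately have c: "c \<in> ?H" by simp
  show "{x. x - c \<in> U} \<subseteq> ?H"
  proof
    fix x assume "x \<in> {x. x - c \<in> U}"
    then have x: "x - c \<in> U" by simp
    show "x \<in> ?H"
    proof (cases "x = c")
      case False
      define t where "t = norm (x - c) / \<gamma>"
      have "(1 - t) *\<^sub>R c + t *\<^sub>R (c + (\<gamma> / norm (x - c)) *\<^sub>R (x - c)) \<in> ?H"
        using x False by (intro mem_affine[OF aff] on c) auto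
      moreover have "(1 - t) *\<^sub>R c + t *\<^sub>R (c + (\<gamma> / norm (x - c)) *\<^sub>R (x - c)) = x"
        using False U(3) by (simp add: t_def algebra_simps)
      ultimately show ?thesis by simp
    qed (use c in simp)
  qed
qed

lemma sphere_dim_sphere_in:
  fixes U :: "'a::euclidean_space set"
  assumes "subspace U" "1 \<le> dim U" "\<gamma> > 0"
  shows "sphere_dim (sphere_in c U \<gamma>) = int (dim U) - 1"
  unfolding sphere_dim_def affine_hull_sphere_in[OF assms]
  using affine_translate_subspace[OF assms(1)] by simp

lemma spheres_orthogonal_sphere_in:
  fixes U U' :: "'a::euclidean_space set"
  assumes "subspace U" "1 \<le> dim U" "\<gamma> > 0" "subspace U'" "1 \<le> dim U'" "\<gamma>' > 0"
    and orth: "\<And>u v. u \<in> U \<Longrightarrow> v \<in> U' \<Longrightarrow> u \<bullet> v = 0"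
  shows "spheres_orthogonal (sphere_in c U \<gamma>) (sphere_in c' U' \<gamma>')"
proof -
  have "direction {x. x - c \<in> W} \<subseteq> W" if "subspace W" for W and c :: 'a
  proof
    fix d assume "d \<in> direction {x. x - c \<in> W}"
    then obtain x y where "d = (x - c) - (y - c)" "x - c \<in> W" "y - c \<in> W"
      by (auto simp: direction_def)
    then show "d \<in> W" using subspace_diff[OF that] by metis
  qed
  then show ?thesis
    unfolding spheres_orthogonal_def affine_orthogonal_def
      affine_hull_sphere_in[OF assms(1-3)] affine_hull_sphere_in[OF assms(4-6)]
    using orth assms(1,4) unfolding orthogonal_def by blast
qed

section \<open>Centers and radii of mutually equidistant families\<close>

locale equidistant_families =
  fixes I :: "nat set" and B :: "nat \<Rightarrow> 'a::euclidean_space set" and s :: real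
  assumes fin_I: "finite I" and card_I: "3 \<le> card I"
    and dim_ge: "i \<in> I \<Longrightarrow> 2 \<le> dim (direction (B i))"
    and equidist: "i \<in> I \<Longrightarrow> j \<in> I \<Longrightarrow> i \<noteq> j \<Longrightarrow> x \<in> B i \<Longrightarrow> y \<in> B j \<Longrightarrow> dist x y = s"
begin

definition U :: "nat \<Rightarrow> 'a set" where "U i = span (direction (B i))"

lemma subspace_U: "subspace (U i)"
  by (simp add: U_def)

lemma dim_U: "dim (U i) = dim (direction (B i))"
  by (simp add: U_def)

lemma direction_in_U: "x \<in> B i \<Longrightarrow> y \<in> B i \<Longrightarrow> x - y \<in> U i"
  unfolding U_def direction_def by (intro span_base) blast

lemma U_orth: 
  assumes "i \<in> I" "j \<in> I" "i \<noteq> j" "u \<in> U i" "v \<in> U j"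
  shows "u \<bullet> v = 0"
proof -
  have *: "d \<bullet> v = 0" if d: "d \<in> direction (B i)" for d
  proof (rule inner_span_zero)
    show "v \<in> span (direction (B j))" using assms(5) by (simp add: U_def)
    fix w assume "w \<in> direction (B j)"
    then show "d \<bullet> w = 0" using inner_directions_zero[OF equidist[OF assms(1-3)] d] by blast
  qed
  have "v \<bullet> u = 0"
  proof (rule inner_span_zero)
    show "u \<in> span (direction (B i))" using assms(4) by (simp add: U_def)
    fix d assume "d \<in> direction (B i)"
    then show "v \<bullet> d = 0" using * by (simp add: inner_commute)
  qed
  then show ?thesis by (simp add: inner_commute)
qed

lemma third_index:
  obtains l where "l \<in> I" "l \<noteq> i" "l \<noteq> j"
proof -
  have "card (I - {i,j}) \<ge> card I - card {i,j}" by (rule diff_card_le_card_Diff) simp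
  moreover have "card {i,j} \<le> 2" by (simp add: card_insert_if)
  ultimately have "card (I - {i,j}) \<noteq> 0" using card_I by linarith
  then have "I - {i,j} \<noteq> {}" by (metis card.empty)
  then show ?thesis using that by blast
qed

lemma other_index:
  obtains j where "j \<in> I" "j \<noteq> i"
proof -
  obtain j where "j \<in> I" "j \<noteq> i" using third_index[of i i] by blast
  then show ?thesis by (rule that)
qed

lemma B_nonempty: "i \<in> I \<Longrightarrow> B i \<noteq> {}"
  using dim_ge[of i] by (auto simp: direction_def)

text \<open>The center is the foot of the perpendicular from a point \<open>z\<close> of another
  family to the affine span of \<open>B i\<close>. As \<open>z\<close> is equidistant from
  \<open>B i\<close>, Pythagoras makes the foot equidistant too; the radius is positive because
  \<open>B i\<close> is not a single point.\<close>

lemma center_exists: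
  assumes i: "i \<in> I"
  shows "\<exists>c \<gamma>. \<gamma> > 0 \<and> (\<forall>b\<in>B i. b - c \<in> U i \<and> dist b c = \<gamma>)"
proof -
  obtain j where j: "j \<in> I" "j \<noteq> i" by (rule other_index)
  obtain b0 z where b0: "b0 \<in> B i" and z: "z \<in> B j" using B_nonempty i j by blast
  obtain y w where yw: "y \<in> span (U i)" "\<And>v. v \<in> span (U i) \<Longrightarrow> orthogonal w v" "z - b0 = y + w"
    using orthogonal_subspace_decomp_exists[of "U i" "z - b0"] by blast
  then have y: "y \<in> U i" and w: "\<And>v. v \<in> U i \<Longrightarrow> w \<bullet> v = 0"
    by (simp_all add: U_def orthogonal_def span_span)
  define c where "c = b0 + y"
  have mem: "b - c \<in> U i" if "b \<in> B i" for b
  proof -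
    have "(b - b0) - y \<in> U i" using subspace_diff[OF subspace_U direction_in_U[OF that b0] y] .
    then show ?thesis by (simp add: c_def algebra_simps)
  qed
  have nrm: "(norm (b - c))\<^sup>2 = s\<^sup>2 - (norm w)\<^sup>2" if "b \<in> B i" for b
  proof -
    have "dist b z = s" using equidist[OF i j(1)] j(2) that z by simp
    moreover have "b - z = (b - c) - w" using yw(3) by (simp add: c_def algebra_simps)
    ultimately have "s\<^sup>2 = (norm ((b - c) - w))\<^sup>2" by (metis dist_norm)
    also have "\<dots> = (norm (b - c))\<^sup>2 + (norm w)\<^sup>2"
      using w[OF mem[OF that]] by (simp add: power2_norm_eq_inner inner_simps inner_commute)
    finally show ?thesis by simp
  qed
  define \<gamma> where "\<gamma> = norm (b0 - c)"
  have dist: "dist b c = \<gamma>" if "b \<in> B i" for b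
    using nrm[OF that] nrm[OF b0] unfolding \<gamma>_def dist_norm
    by (metis norm_ge_zero power2_eq_iff_nonneg)
  have "\<gamma> > 0"
  proof (rule ccontr)
    assume "\<not> \<gamma> > 0"
    then have "\<gamma> = 0" by (simp add: \<gamma>_def)
    then have eq: "b = c" if "b \<in> B i" for b using dist[OF that] by simp
    have "x - y = 0" if "x \<in> B i" "y \<in> B i" for x y using eq[OF that(1)] eq[OF that(2)] by simp
    then have "direction (B i) \<subseteq> {0}" unfolding direction_def by blast
    then have "dim (direction (B i)) = 0" by (simp only: dim_eq_0)
    then show False using dim_ge[OF i] by linarith
  qed
  then show ?thesis using mem dist by blast
qed

definition c :: "nat \<Rightarrow> 'a" where
  "c i = (SOME c. \<exists>\<gamma>>0. \<forall>b\<in>B i. b - c \<in> U i \<and> dist b c = \<gamma>)"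

definition \<gamma> :: "nat \<Rightarrow> real" where
  "\<gamma> i = (SOME \<gamma>. \<gamma> > 0 \<and> (\<forall>b\<in>B i. b - c i \<in> U i \<and> dist b (c i) = \<gamma>))"

lemma center:
  assumes "i \<in> I"
  shows "\<gamma> i > 0" "b \<in> B i \<Longrightarrow> b - c i \<in> U i" "b \<in> B i \<Longrightarrow> dist b (c i) = \<gamma> i"
proof -
  have "\<exists>\<gamma>>0. \<forall>b\<in>B i. b - c i \<in> U i \<and> dist b (c i) = \<gamma>"
    unfolding c_def by (rule someI_ex) (use center_exists[OF assms] in blast)
  then have "\<gamma> i > 0 \<and> (\<forall>b\<in>B i. b - c i \<in> U i \<and> dist b (c i) = \<gamma> i)"
    unfolding \<gamma>_def by (rule someI_ex)
  then show "\<gamma> i > 0" "b \<in> B i \<Longrightarrow> b - c i \<in> U i" "b \<in> B i \<Longrightarrow> dist b (c i) = \<gamma> i" by auto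
qed

lemma equidistant_orth_center:
  assumes i: "i \<in> I" and z: "\<And>b. b \<in> B i \<Longrightarrow> dist z b = d" and u: "u \<in> U i"
  shows "(z - c i) \<bullet> u = 0"
proof (rule inner_span_zero[of "direction (B i)"])
  show "u \<in> span (direction (B i))" using u by (simp add: U_def)
  fix v assume "v \<in> direction (B i)"
  then obtain x y where "x \<in> B i" "y \<in> B i" "v = x - y" by (auto simp: direction_def)
  then show "(z - c i) \<bullet> v = 0"
    using inner_bisector[of z x y "c i"] z center(3)[OF i] by (simp add: dist_commute)
qed

text \<open>A point \<open>y\<close> of \<open>B j\<close> is equidistant from \<open>B i\<close>,
  so \<open>y - c i\<close> is orthogonal to \<open>U i\<close>; and \<open>y - c j\<close> lies in
  \<open>U j\<close>, which is orthogonal to \<open>U i\<close> as well. The claim is the difference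
  of the two.\<close>

lemma centers_orth:
  assumes "i \<in> I" "j \<in> I" "i \<noteq> j" "u \<in> U i"
  shows "(c i - c j) \<bullet> u = 0"
proof -
  obtain y where y: "y \<in> B j" using B_nonempty assms by blast
  have "(y - c i) \<bullet> u = 0"
    using equidist[OF assms(1-3)] y
    by (intro equidistant_orth_center[OF assms(1) _ assms(4), of _ s]) (simp add: dist_commute)
  moreover have "u \<bullet> (y - c j) = 0"
    using U_orth[OF assms(1-4)] center(2)[OF assms(2) y] by blast
  ultimately show ?thesis by (simp add: inner_simps inner_commute)
qed

text \<open>Pythagoras for three mutually orthogonal vectors. Since \<open>x\<close> and
  \<open>y\<close> range over the affine spaces and not just over \<open>B i\<close> and
  \<open>B j\<close>, it also governs points added later and whole spheres.\<close>

lemma norm_across: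
  assumes ij: "i \<in> I" "j \<in> I" "i \<noteq> j" and xy: "x - c i \<in> U i" "y - c j \<in> U j"
  shows "(norm (x - y))\<^sup>2 = (norm (x - c i))\<^sup>2 + (norm (c i - c j))\<^sup>2 + (norm (y - c j))\<^sup>2"
proof -
  define a b d where "a = x - c i" and "b = c i - c j" and "d = y - c j"
  have "b \<bullet> a = 0" using centers_orth[OF ij] xy by (simp add: a_def b_def)
  moreover have "b \<bullet> d = 0" using centers_orth[OF ij(2,1)] ij(3) xy
    by (metis b_def d_def inner_minus_left minus_diff_eq neg_equal_0_iff_equal)
  moreover have "a \<bullet> d = 0" using U_orth[OF ij] xy by (simp add: a_def d_def)
  moreover have "x - y = a + b - d" by (simp add: a_def b_def d_def)
  ultimately show ?thesis
    unfolding a_def[symmetric] b_def[symmetric] d_def[symmetric]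
    by (simp add: power2_norm_eq_inner inner_simps inner_commute)
qed

lemma radii:
  assumes "i \<in> I" "j \<in> I" "i \<noteq> j"
  shows "(\<gamma> i)\<^sup>2 + (norm (c i - c j))\<^sup>2 + (\<gamma> j)\<^sup>2 = s\<^sup>2"
proof -
  obtain x y where xy: "x \<in> B i" "y \<in> B j" using B_nonempty assms by blast
  then have "(norm (x - y))\<^sup>2 = (\<gamma> i)\<^sup>2 + (norm (c i - c j))\<^sup>2 + (\<gamma> j)\<^sup>2"
    using norm_across[OF assms center(2)[OF assms(1)] center(2)[OF assms(2)]]
      center(3)[OF assms(1)] center(3)[OF assms(2)] by (simp add: dist_norm)
  then show ?thesis using equidist[OF assms xy] by (simp add: dist_norm)
qed

text \<open>These are the candidates for the \<open>i\<close>-th sphere. Their position relative to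
  the affine span of \<open>B i\<close> is left open; it is either forced by the dimension or
  imposed separately.\<close>

definition common :: "nat \<Rightarrow> 'a set" where
  "common i = {x. \<forall>j\<in>I - {i}. \<forall>y\<in>B j. dist x y = s}"

lemma common_orth:
  assumes ij: "i \<in> I" "j \<in> I" "i \<noteq> j" and x: "x \<in> common i" and u: "u \<in> U j"
  shows "(x - c i) \<bullet> u = 0"
proof -
  have "(x - c j) \<bullet> u = 0"
    using x ij by (intro equidistant_orth_center[OF ij(2) _ u, of _ s]) (auto simp: common_def)
  moreover have "(c j - c i) \<bullet> u = 0" using centers_orth[OF ij(2,1)] ij(3) u by simp
  ultimately show ?thesis by (simp add: inner_simps)
qed

text \<open>Inside the affine span, the distance to one point of another family fixes the distance
  to the center, and \<open>radii\<close> identifies it as \<open>\<gamma> i\<close>.\<close>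

lemma common_in_sphere:
  assumes i: "i \<in> I" and x: "x \<in> common i" "x - c i \<in> U i"
  shows "x \<in> sphere_in (c i) (U i) (\<gamma> i)"
proof -
  obtain j where j: "j \<in> I" "j \<noteq> i" by (rule other_index)
  obtain y where y: "y \<in> B j" using B_nonempty j by blast
  have "s = norm (x - y)" using x(1) j y by (auto simp: common_def dist_norm)
  then have "s\<^sup>2 = (norm (x - c i))\<^sup>2 + (norm (c i - c j))\<^sup>2 + (\<gamma> j)\<^sup>2"
    using norm_across[OF i j(1) j(2)[symmetric] x(2) center(2)[OF j(1) y]] center(3)[OF j(1) y]
    by (simp add: dist_norm)
  then have "(norm (x - c i))\<^sup>2 = (\<gamma> i)\<^sup>2" using radii[OF i j(1) j(2)[symmetric]] by simp
  then have "norm (x - c i) = \<gamma> i" using center(1)[OF i] by (simp add: power2_eq_iff_nonneg)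
  then show ?thesis using x(2) by (simp add: sphere_in_def)
qed

lemma dim_UN_U: "dim (\<Union>i\<in>I. U i) = (\<Sum>i\<in>I. dim (U i))"
  by (rule dim_orthogonal_UN[OF fin_I]) (rule U_orth)

lemma sum_dim_le: "(\<Sum>i\<in>I. dim (U i)) \<le> DIM('a)"
  by (rule sum_dim_orthogonal_le[OF fin_I]) (rule U_orth)

lemma centers_perp_all:
  assumes ij: "i \<in> I" "j \<in> I" and u: "u \<in> (\<Union>l\<in>I. U l)"
  shows "(c i - c j) \<bullet> u = 0"
proof (cases "i = j")
  case False
  obtain l where l: "l \<in> I" "u \<in> U l" using u by (rule UN_E)
  consider "l = i" | "l = j" | "l \<noteq> i" "l \<noteq> j" by blast
  then show ?thesis
  proof cases
    case 1 then show ?thesis using centers_orth[OF ij False] l by simp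
  next
    case 2 then show ?thesis using centers_orth[OF ij(2,1)] False l
      by (metis inner_minus_left minus_diff_eq neg_equal_0_iff_equal)
  next
    case 3
    then have "(c l - c i) \<bullet> u = 0" "(c l - c j) \<bullet> u = 0"
      using centers_orth[OF l(1)] ij l by auto
    then show ?thesis by (simp add: inner_simps)
  qed
qed simp

text \<open>A vector orthogonal to all \<open>U i\<close> vanishes. Applied to differences of
  centers this makes them equal; applied to the part of \<open>x - c i\<close> orthogonal to
  \<open>U i\<close>, it puts \<open>x\<close> into the affine span. Equality of two radii is
  obtained by comparing both with a third index.\<close>

lemma full_dimension:
  assumes full: "(\<Sum>i\<in>I. dim (U i)) = DIM('a)"
  shows "i \<in> I \<Longrightarrow> j \<in> I \<Longrightarrow> c i = c j" "i \<in> I \<Longrightarrow> j \<in> I \<Longrightarrow> \<gamma> i = \<gamma> j"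
    "i \<in> I \<Longrightarrow> common i \<subseteq> sphere_in (c i) (U i) (\<gamma> i)"
proof -
  have zero: "v = 0" if "\<And>u. u \<in> (\<Union>i\<in>I. U i) \<Longrightarrow> v \<bullet> u = 0" for v
  proof (rule orthogonal_to_spanning_zero)
    show "dim (\<Union>i\<in>I. U i) = DIM('a)" by (simp add: dim_UN_U full)
  qed (rule that)
  show cc: "c i = c j" if "i \<in> I" "j \<in> I" for i j
    using zero[of "c i - c j"] centers_perp_all[OF that] by simp
  show "\<gamma> i = \<gamma> j" if ij: "i \<in> I" "j \<in> I"
  proof (cases "i = j")
    case False
    obtain l where l: "l \<in> I" "l \<noteq> i" "l \<noteq> j" by (rule third_index)
    have "(\<gamma> l)\<^sup>2 + (\<gamma> i)\<^sup>2 = s\<^sup>2" "(\<gamma> l)\<^sup>2 + (\<gamma> j)\<^sup>2 = s\<^sup>2"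
      using radii[OF l(1) ij(1) l(2)] radii[OF l(1) ij(2) l(3)] cc[OF l(1) ij(1)] cc[OF l(1) ij(2)] by simp_all
    then have "(\<gamma> i)\<^sup>2 = (\<gamma> j)\<^sup>2" by simp
    then show ?thesis using center(1) ij by (simp add: power2_eq_iff_nonneg less_imp_le)
  qed simp
  show "common i \<subseteq> sphere_in (c i) (U i) (\<gamma> i)" if i: "i \<in> I"
  proof
    fix x assume x: "x \<in> common i"
    obtain y w where yw: "y \<in> span (U i)" "\<And>v. v \<in> span (U i) \<Longrightarrow> orthogonal w v" "x - c i = y + w"
      using orthogonal_subspace_decomp_exists[of "U i" "x - c i"] by blast
    then have y: "y \<in> U i" and w: "\<And>v. v \<in> U i \<Longrightarrow> w \<bullet> v = 0"
      by (simp_all add: U_def orthogonal_def span_span)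
    have "w = 0"
    proof (rule zero)
      fix u assume "u \<in> (\<Union>i\<in>I. U i)"
      then obtain j where j: "j \<in> I" "u \<in> U j" by blast
      show "w \<bullet> u = 0"
      proof (cases "j = i")
        case False
        have "(x - c i) \<bullet> u = 0" using common_orth[OF i j(1) False[symmetric] x j(2)] .
        moreover have "y \<bullet> u = 0" using U_orth[OF i j(1) False[symmetric] y j(2)] .
        ultimately show ?thesis using yw(3) by (simp add: inner_simps)
      qed (use w j in simp)
    qed
    then show "x \<in> sphere_in (c i) (U i) (\<gamma> i)"
      using common_in_sphere[OF i x] yw(3) y by simp
  qed
qed

end

text \<open>If \<open>l i\<close> and \<open>l k\<close> differ, then \<open>l\<close> is constant
  off \<open>{i, k}\<close>. With two further indices available, the same argument, applied to one
  of them in place of \<open>i\<close> or \<open>k\<close>, shows that one of \<open>l i\<close>,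
  \<open>l k\<close> has this constant value. With three indices in all, \<open>l\<close> is
  injective or two values agree and the remaining index is exceptional.\<close>

lemma level_dichotomy:
  fixes l \<gamma> :: "nat \<Rightarrow> real"
  assumes fin: "finite I" and I3: "3 \<le> card I"
    and eq: "\<And>i j. i \<in> I \<Longrightarrow> j \<in> I \<Longrightarrow> i \<noteq> j \<Longrightarrow> (\<gamma> i)\<^sup>2 + (l i - l j)\<^sup>2 + (\<gamma> j)\<^sup>2 = d"
  shows "(card I = 3 \<and> inj_on l I) \<or> (\<exists>i0\<in>I. \<forall>i\<in>I - {i0}. \<forall>j\<in>I - {i0}. l i = l j)"
proof (cases "card I = 3")
  case True
  show ?thesis
  proof (cases "inj_on l I")
    case False
    then obtain i j where ij: "i \<in> I" "j \<in> I" "i \<noteq> j" "l i = l j" by (auto simp: inj_on_def)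
    then have "card (I - {i,j}) = 1" using True fin by (simp add: card_Diff_subset)
    then obtain i0 where i0: "I - {i,j} = {i0}" by (auto simp: card_1_singleton_iff)
    then have "I - {i0} = {i,j}" using ij by blast
    then show ?thesis using ij i0 by (intro disjI2 bexI[of _ i0]) auto
  qed (use True in blast)
next
  case False
  have key: "l j = l j'" if "i \<in> I" "k \<in> I" "j \<in> I" "j' \<in> I" "i \<noteq> k" "l i \<noteq> l k"
      "j \<noteq> i" "j \<noteq> k" "j' \<noteq> i" "j' \<noteq> k" for i k j j'
  proof -
    \<comment> \<open>In this alternating combination of four equations the radii and the squares of
      the levels cancel, leaving only the mixed products.\<close>
    have "2 * (l i - l k) * (l j - l j') =
      ((\<gamma> i)\<^sup>2 + (l i - l j')\<^sup>2 + (\<gamma> j')\<^sup>2) - ((\<gamma> k)\<^sup>2 + (l k - l j')\<^sup>2 + (\<gamma> j')\<^sup>2)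
      - (((\<gamma> i)\<^sup>2 + (l i - l j)\<^sup>2 + (\<gamma> j)\<^sup>2) - ((\<gamma> k)\<^sup>2 + (l k - l j)\<^sup>2 + (\<gamma> j)\<^sup>2))"
      by (simp add: power2_eq_square algebra_simps)
    also have "\<dots> = 0" using eq that by simp
    finally show ?thesis using that by simp
  qed
  have "I \<noteq> {}" using I3 by auto
  show ?thesis
  proof (cases "\<forall>i\<in>I. \<forall>k\<in>I. l i = l k")
    case True
    then show ?thesis using \<open>I \<noteq> {}\<close> by blast
  next
    case f: False
    then obtain i k where ik: "i \<in> I" "k \<in> I" "l i \<noteq> l k" by blast
    then have "i \<noteq> k" by auto
    then have "card (I - {i,k}) = card I - 2" using ik fin by (simp add: card_Diff_subset)
    then have "\<not> card (I - {i,k}) \<le> Suc 0" using I3 False by simp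
    then obtain j j' where j: "j \<in> I" "j \<noteq> i" "j \<noteq> k" "j' \<in> I" "j' \<noteq> i" "j' \<noteq> k" "j \<noteq> j'"
      using fin card_le_Suc0_iff_eq[of "I - {i,k}"] by (metis DiffE finite_Diff insertCI)
    have rest: "l x = l j" if "x \<in> I" "x \<noteq> i" "x \<noteq> k" for x
      using key[of i k x j] ik \<open>i \<noteq> k\<close> j that by blast
    \<comment> \<open>If \<open>a\<close> differs in level from \<open>j\<close>, then
      \<open>key\<close> for the pair \<open>a\<close>, \<open>j\<close> equates the levels of
      \<open>b\<close> and \<open>j'\<close>, and \<open>j'\<close> has the level of
      \<open>j\<close>.\<close>
    have spread: "l b = l j" if "a \<in> I" "b \<in> I" "a \<noteq> b" "{a,b} = {i,k}" "l a \<noteq> l j" for a b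
    proof -
      have "b \<noteq> j" "b \<noteq> j'" "a \<noteq> j" "a \<noteq> j'" using j that by auto
      then have "l b = l j'" using key[of a j b j'] that j by auto
      then show ?thesis using rest[of j'] j by simp
    qed
    show ?thesis
    proof (cases "l i = l j")
      case True
      then have "l x = l j" if "x \<in> I - {k}" for x using rest that by auto
      then show ?thesis using ik by (intro disjI2 bexI[of _ k]) auto
    next
      case False
      then have "l k = l j" using spread[of i k] ik \<open>i \<noteq> k\<close> by blast
      then have "l x = l j" if "x \<in> I - {i}" for x using rest that by auto
      then show ?thesis using ik by (intro disjI2 bexI[of _ i]) auto
    qed
  qed
qed

text \<open>A Lenz configuration, that is, points on mutually orthogonal spheres. Dimensions are
  those of the direction spaces, one more than those of the spheres. The exceptional index
  \<open>i0\<close> is arbitrary here and is moved to the last place only in the final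
  theorem.\<close>

definition lenz_spheres :: "nat set \<Rightarrow> real \<Rightarrow> (nat \<Rightarrow> 'a::euclidean_space set) \<Rightarrow> bool" where
  "lenz_spheres I s M \<longleftrightarrow> (\<exists>c U \<gamma>.
     (\<forall>i\<in>I. subspace (U i) \<and> \<gamma> i > 0 \<and> M i \<subseteq> sphere_in (c i) (U i) (\<gamma> i)) \<and>
     (\<forall>i\<in>I. \<forall>j\<in>I. i \<noteq> j \<longrightarrow> (\<forall>u\<in>U i. \<forall>v\<in>U j. u \<bullet> v = 0)) \<and>
     ((\<exists>i0\<in>I. dim (U i0) = 3 \<and> (\<forall>i\<in>I - {i0}. dim (U i) = 2) \<and> (\<forall>i\<in>I. \<forall>j\<in>I. c i = c j \<and> \<gamma> i = \<gamma> j)) \<or>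
      (card I = 3 \<and> (\<forall>i\<in>I. dim (U i) = 2) \<and>
        (\<forall>i\<in>I. \<forall>j\<in>I. i \<noteq> j \<longrightarrow> c i \<noteq> c j \<and>
          (\<forall>x\<in>sphere_in (c i) (U i) (\<gamma> i). \<forall>y\<in>sphere_in (c j) (U j) (\<gamma> j). norm (x - y) = s)))))"

context equidistant_families
begin

lemma lenz_spheres_full:
  assumes full: "(\<Sum>i\<in>I. dim (U i)) = DIM('a)"
    and i0: "i0 \<in> I" "dim (U i0) = 3" "\<And>i. i \<in> I \<Longrightarrow> i \<noteq> i0 \<Longrightarrow> dim (U i) = 2"
  shows "lenz_spheres I s common"
  unfolding lenz_spheres_def
proof (intro exI conjI)
  show "\<forall>i\<in>I. subspace (U i) \<and> \<gamma> i > 0 \<and> common i \<subseteq> sphere_in (c i) (U i) (\<gamma> i)"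
    using subspace_U center(1) full_dimension(3)[OF full] by blast
  show "\<forall>i\<in>I. \<forall>j\<in>I. i \<noteq> j \<longrightarrow> (\<forall>u\<in>U i. \<forall>v\<in>U j. u \<bullet> v = 0)"
    using U_orth by blast
  have "dim (U i0) = 3 \<and> (\<forall>i\<in>I - {i0}. dim (U i) = 2) \<and> (\<forall>i\<in>I. \<forall>j\<in>I. c i = c j \<and> \<gamma> i = \<gamma> j)"
    using i0 full_dimension(1,2)[OF full] by blast
  then show "(\<exists>i0\<in>I. dim (U i0) = 3 \<and> (\<forall>i\<in>I - {i0}. dim (U i) = 2) \<and> (\<forall>i\<in>I. \<forall>j\<in>I. c i = c j \<and> \<gamma> i = \<gamma> j)) \<or>
      (card I = 3 \<and> (\<forall>i\<in>I. dim (U i) = 2) \<and>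
        (\<forall>i\<in>I. \<forall>j\<in>I. i \<noteq> j \<longrightarrow> c i \<noteq> c j \<and>
          (\<forall>x\<in>sphere_in (c i) (U i) (\<gamma> i). \<forall>y\<in>sphere_in (c j) (U j) (\<gamma> j). norm (x - y) = s)))"
    using i0(1) by blast
qed

text \<open>The vectors orthogonal to all \<open>U i\<close> form a line here, spanned by
  \<open>e\<close>. By \<open>centers_perp_all\<close>, all differences of centers are multiples of
  \<open>e\<close>.\<close>

lemma normal_vector:
  assumes "(\<Sum>i\<in>I. dim (U i)) + 1 = DIM('a)"
  obtains e where "norm e = 1" "\<And>u i. i \<in> I \<Longrightarrow> u \<in> U i \<Longrightarrow> e \<bullet> u = 0"
    "\<And>v. (\<And>u. u \<in> (\<Union>i\<in>I. U i) \<Longrightarrow> v \<bullet> u = 0) \<Longrightarrow> v = (v \<bullet> e) *\<^sub>R e"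
proof -
  let ?S = "\<Union>i\<in>I. U i"
  have dimS: "dim ?S + 1 = DIM('a)" using assms by (simp add: dim_UN_U)
  then have "dim ?S < DIM('a)" by simp
  then obtain x where x: "x \<noteq> 0" "\<And>y. y \<in> span ?S \<Longrightarrow> orthogonal x y"
    using orthogonal_to_subspace_exists[of ?S] by blast
  define e where "e = x /\<^sub>R norm x"
  have e1: "norm e = 1" using x by (simp add: e_def)
  have eS: "e \<bullet> u = 0" if "u \<in> ?S" for u
    using x(2)[of u] span_base[OF that] by (simp add: e_def orthogonal_def)
  have "dim (?S \<union> {e}) = dim ?S + dim {e}"
    using eS by (intro dim_orthogonal_sum) (auto simp: inner_commute)
  moreover have "dim {e} = 1" using e1 by auto
  ultimately have full: "dim (?S \<union> {e}) = DIM('a)" using dimS by simp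
  have rep: "v = (v \<bullet> e) *\<^sub>R e" if v: "\<And>u. u \<in> ?S \<Longrightarrow> v \<bullet> u = 0" for v
  proof -
    have ee: "e \<bullet> e = 1" using e1 by (simp add: norm_eq_1)
    have "v - (v \<bullet> e) *\<^sub>R e = 0"
    proof (rule orthogonal_to_spanning_zero[OF full])
      fix u assume "u \<in> ?S \<union> {e}"
      then show "(v - (v \<bullet> e) *\<^sub>R e) \<bullet> u = 0"
        using v[of u] eS[of u] ee by (cases "u \<in> ?S") (simp_all add: inner_diff_left del: UN_iff)
    qed
    then show ?thesis by simp
  qed
  show ?thesis by (rule that[of e]) (use e1 eS rep in auto)
qed

text \<open>A point of \<open>common i\<close> may have a component along \<open>e\<close>, so lying
  in the plane of \<open>B i\<close> is imposed. If all levels but that of \<open>i0\<close> agree,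
  the other circles share center and radius, and the circle of \<open>i0\<close> is a circle of
  latitude of the 2-sphere with this center and radius in the span of \<open>U i0\<close> and
  \<open>e\<close>.\<close>

lemma lenz_spheres_codim_one:
  assumes codim: "(\<Sum>i\<in>I. dim (U i)) + 1 = DIM('a)"
    and dim2: "\<And>i. i \<in> I \<Longrightarrow> dim (U i) = 2"
  shows "lenz_spheres I s (\<lambda>i. common i \<inter> {x. x - c i \<in> U i})"
proof -
  obtain e where e: "norm e = 1" "\<And>u i. i \<in> I \<Longrightarrow> u \<in> U i \<Longrightarrow> e \<bullet> u = 0"
    "\<And>v. (\<And>u. u \<in> (\<Union>i\<in>I. U i) \<Longrightarrow> v \<bullet> u = 0) \<Longrightarrow> v = (v \<bullet> e) *\<^sub>R e"
    using normal_vector[OF codim] by blast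
  define l where "l i = c i \<bullet> e" for i
  have cl: "c i - c j = (l i - l j) *\<^sub>R e" if "i \<in> I" "j \<in> I" for i j
    using e(3)[of "c i - c j"] centers_perp_all[OF that] by (simp add: l_def inner_simps)
  have nl: "(norm (c i - c j))\<^sup>2 = (l i - l j)\<^sup>2" if "i \<in> I" "j \<in> I" for i j
    using cl[OF that] e(1) by simp
  have rad: "(\<gamma> i)\<^sup>2 + (l i - l j)\<^sup>2 + (\<gamma> j)\<^sup>2 = s\<^sup>2" if "i \<in> I" "j \<in> I" "i \<noteq> j" for i j
    using radii[OF that] nl[OF that(1,2)] by simp
  have sub: "common i \<inter> {x. x - c i \<in> U i} \<subseteq> sphere_in (c i) (U i) (\<gamma> i)" if "i \<in> I" for i
    using common_in_sphere[OF that] by blast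
  have orth: "\<forall>i\<in>I. \<forall>j\<in>I. i \<noteq> j \<longrightarrow> (\<forall>u\<in>U i. \<forall>v\<in>U j. u \<bullet> v = 0)"
    using U_orth by blast
  obtain a b where ab: "a \<in> I" "b \<in> I" "a \<noteq> b" using other_index by metis
  then have s0: "s \<ge> 0" using equidist[OF ab] B_nonempty
    by (metis all_not_in_conv zero_le_dist)
  have "(card I = 3 \<and> inj_on l I) \<or> (\<exists>i0\<in>I. \<forall>i\<in>I - {i0}. \<forall>j\<in>I - {i0}. l i = l j)"
    by (rule level_dichotomy[OF fin_I card_I]) (rule rad)
  then consider "card I = 3" "inj_on l I" | i0 where "i0 \<in> I" "\<forall>i\<in>I - {i0}. \<forall>j\<in>I - {i0}. l i = l j"
    by (elim disjE conjE bexE)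
  then show ?thesis
  proof cases
    case 1
    have "c i \<noteq> c j \<and> (\<forall>x\<in>sphere_in (c i) (U i) (\<gamma> i). \<forall>y\<in>sphere_in (c j) (U j) (\<gamma> j). norm (x - y) = s)"
      if ij: "i \<in> I" "j \<in> I" "i \<noteq> j" for i j
    proof (intro conjI ballI)
      show "c i \<noteq> c j" using 1(2) ij by (auto simp: l_def inj_on_def)
      fix x y assume "x \<in> sphere_in (c i) (U i) (\<gamma> i)" "y \<in> sphere_in (c j) (U j) (\<gamma> j)"
      then have "(norm (x - y))\<^sup>2 = s\<^sup>2"
        using norm_across[OF ij, of x y] radii[OF ij] by (simp add: sphere_in_def)
      then show "norm (x - y) = s" using s0 by (simp add: power2_eq_iff_nonneg)
    qed
    then show ?thesis unfolding lenz_spheres_def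
      using 1 dim2 orth subspace_U center(1) sub
      by (intro exI[of _ c] exI[of _ U] exI[of _ \<gamma>]) (intro conjI disjI2; blast)
  next
    case 2
    obtain k where k: "k \<in> I" "k \<noteq> i0" by (rule other_index)
    obtain k' where k': "k' \<in> I" "k' \<noteq> i0" "k' \<noteq> k" by (rule third_index)
    have leq: "l i = l k" if "i \<in> I" "i \<noteq> i0" for i using 2(2) that k by blast
    have ck: "c i = c k" if "i \<in> I" "i \<noteq> i0" for i
      using cl[OF that(1) k(1)] leq[OF that] by simp
    have gk: "\<gamma> i = \<gamma> k" if "i \<in> I" "i \<noteq> i0" for i
    proof -
      have "(\<gamma> i)\<^sup>2 = (\<gamma> k)\<^sup>2"
        using rad[OF that(1) 2(1) that(2)] rad[OF k(1) 2(1) k(2)] leq[OF that] by simp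
      then show ?thesis using center(1)[OF that(1)] center(1)[OF k(1)]
        by (simp add: power2_eq_iff_nonneg)
    qed
    \<comment> \<open>The equation for \<open>i0\<close> and \<open>k\<close> is compared with the
      one for \<open>k'\<close> and \<open>k\<close>, where the levels agree; hence two indices
      besides \<open>i0\<close>. The result says that the circle of \<open>i0\<close>, at height
      \<open>l i0 - l k\<close>, has distance \<open>\<gamma> k\<close> from the common
      center.\<close>
    have g0: "(\<gamma> i0)\<^sup>2 + (l i0 - l k)\<^sup>2 = (\<gamma> k)\<^sup>2"
      using rad[OF 2(1) k(1)] k(2) rad[OF k'(1) k(1) k'(3)] gk[OF k'(1,2)] leq[OF k'(1,2)] by simp
    define W where "W i = (if i = i0 then span (insert e (U i0)) else U i)" for i
    have "e \<notin> span (U i0)"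
    proof
      assume "e \<in> span (U i0)"
      then have "e \<bullet> e = 0" using inner_span_zero[of "U i0" e e] e(2)[OF 2(1)] by blast
      then show False using e(1) by simp
    qed
    then have dimW: "dim (W i0) = 3" using dim2[OF 2(1)] by (simp add: W_def dim_insert)
    have perp: "v \<bullet> u = 0" if "i \<in> I" "i \<noteq> i0" "v \<in> U i" "u \<in> W i0" for i u v
    proof (rule inner_span_zero)
      show "u \<in> span (insert e (U i0))" using that by (simp add: W_def)
      fix w assume "w \<in> insert e (U i0)"
      then show "v \<bullet> w = 0"
        using U_orth[OF that(1) 2(1) that(2) that(3)] e(2)[OF that(1,3)] inner_commute[of v e] by auto
    qed
    have subk: "common i \<inter> {x. x - c i \<in> U i} \<subseteq> sphere_in (c k) (W i) (\<gamma> k)" if i: "i \<in> I" for i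
    proof (cases "i = i0")
      case True
      show ?thesis
      proof
        fix x assume "x \<in> common i \<inter> {x. x - c i \<in> U i}"
        then have x: "x - c i0 \<in> U i0" "norm (x - c i0) = \<gamma> i0"
          using sub[OF i] True by (auto simp: sphere_in_def)
        have xk: "x - c k = (x - c i0) + (l i0 - l k) *\<^sub>R e"
          using cl[OF 2(1) k(1)] by (simp add: algebra_simps)
        have "x - c k \<in> W i0" unfolding xk W_def
          using x by (simp add: span_add span_base span_scale)
        moreover have "(norm (x - c k))\<^sup>2 = (\<gamma> k)\<^sup>2"
        proof -
          have "e \<bullet> (x - c i0) = 0" using e(2)[OF 2(1) x(1)] .
          then have "(norm (x - c k))\<^sup>2 = (norm (x - c i0))\<^sup>2 + (l i0 - l k)\<^sup>2 * (norm e)\<^sup>2"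
            unfolding xk power2_norm_eq_inner
            by (simp add: inner_simps inner_commute power2_eq_square)
          then show ?thesis using x e(1) g0 by simp
        qed
        then have "norm (x - c k) = \<gamma> k"
          using center(1)[OF k(1)] by (simp add: power2_eq_iff_nonneg)
        ultimately show "x \<in> sphere_in (c k) (W i) (\<gamma> k)" using True by (simp add: sphere_in_def)
      qed
    next
      case False
      then show ?thesis using sub[OF i] ck[OF i False] gk[OF i False] by (simp add: W_def)
    qed
    show ?thesis unfolding lenz_spheres_def
    proof (intro exI[of _ "\<lambda>_. c k"] exI[of _ W] exI[of _ "\<lambda>_. \<gamma> k"] conjI disjI1)
      show "\<forall>i\<in>I. subspace (W i) \<and> \<gamma> k > 0 \<and>
          common i \<inter> {x. x - c i \<in> U i} \<subseteq> sphere_in (c k) (W i) (\<gamma> k)"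
        using subk center(1)[OF k(1)] subspace_U by (auto simp: W_def)
      show "\<forall>i\<in>I. \<forall>j\<in>I. i \<noteq> j \<longrightarrow> (\<forall>u\<in>W i. \<forall>v\<in>W j. u \<bullet> v = 0)"
      proof (intro ballI impI)
        fix i j u v assume ij: "i \<in> I" "j \<in> I" "i \<noteq> j" and uv: "u \<in> W i" "v \<in> W j"
        consider "i = i0" | "j = i0" | "i \<noteq> i0" "j \<noteq> i0" by blast
        then show "u \<bullet> v = 0"
        proof cases
          case 1
          then show ?thesis using perp[of j v u] ij uv by (simp add: W_def inner_commute)
        next
          case 2
          then show ?thesis using perp[of i u v] ij uv by (simp add: W_def)
        next
          case 3
          then show ?thesis using U_orth ij uv by (simp add: W_def)
        qed
      qed
      show "\<exists>i0\<in>I. dim (W i0) = 3 \<and> (\<forall>i\<in>I - {i0}. dim (W i) = 2) \<and>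
          (\<forall>i\<in>I. \<forall>j\<in>I. c k = c k \<and> \<gamma> k = \<gamma> k)"
        using 2(1) dimW dim2 by (intro bexI[of _ i0]) (auto simp: W_def)
    qed
  qed
qed

end

section \<open>Spheres from an almost complete multipartite distance graph\<close>

lemma lenz_spheres_mono:
  assumes "lenz_spheres I s N" "\<And>i. i \<in> I \<Longrightarrow> M i \<subseteq> N i"
  shows "lenz_spheres I s M"
proof -
  have weaken: "(\<forall>i\<in>I. P i \<and> Q i \<and> M i \<subseteq> S i) \<and> R" if "(\<forall>i\<in>I. P i \<and> Q i \<and> N i \<subseteq> S i) \<and> R" for P Q S R
    using that assms(2) by (meson order_trans)
  show ?thesis
    using assms(1) unfolding lenz_spheres_def by (elim ex_forward) (rule weaken)
qed

locale near_turan =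
  fixes I :: "nat set" and A :: "nat \<Rightarrow> 'a::euclidean_space set" and s w :: real
  assumes fin_I: "finite I" and card_I: "3 \<le> card I"
    and fin_A: "i \<in> I \<Longrightarrow> finite (A i)"
    and w: "0 \<le> w"
    and miss: "i \<in> I \<Longrightarrow> j \<in> I \<Longrightarrow> i \<noteq> j \<Longrightarrow> x \<in> A i \<Longrightarrow> real (card {y \<in> A j. dist x y \<noteq> s}) \<le> w"
begin

lemma card_missing:
  assumes i: "i \<in> I" and F: "finite F" "F \<subseteq> (\<Union>j\<in>I - {i}. A j)"
  shows "real (card (A i - {x. \<forall>y\<in>F. dist x y = s})) \<le> real (card F) * w"
proof -
  have "A i - {x. \<forall>y\<in>F. dist x y = s} = (\<Union>y\<in>F. {x \<in> A i. dist y x \<noteq> s})"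
    by (auto simp: dist_commute)
  then have "card (A i - {x. \<forall>y\<in>F. dist x y = s}) \<le> (\<Sum>y\<in>F. card {x \<in> A i. dist y x \<noteq> s})"
    using card_UN_le[OF F(1), of "\<lambda>y. {x \<in> A i. dist y x \<noteq> s}"] by simp
  then have "real (card (A i - {x. \<forall>y\<in>F. dist x y = s})) \<le> (\<Sum>y\<in>F. real (card {x \<in> A i. dist y x \<noteq> s}))"
    unfolding of_nat_sum[symmetric] of_nat_le_iff .
  also have "\<dots> \<le> (\<Sum>y\<in>F. w)"
  proof (rule sum_mono)
    fix y assume "y \<in> F"
    then obtain j where "j \<in> I" "j \<noteq> i" "y \<in> A j" using F(2) by auto
    then show "real (card {x \<in> A i. dist y x \<noteq> s}) \<le> w" using miss[of j i y] i by simp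
  qed
  finally show ?thesis by simp
qed

text \<open>Greedy choice, one class after the other: the at most \<open>3 * card I\<close> points
  chosen so far exclude at most \<open>w\<close> points each, and three must survive.\<close>

lemma ex_triples:
  assumes J: "J \<subseteq> I" and P: "\<And>i. i \<in> J \<Longrightarrow> P i \<subseteq> A i"
    "\<And>i. i \<in> J \<Longrightarrow> 3 + 3 * real (card I) * w \<le> real (card (P i))"
  shows "\<exists>B. (\<forall>i\<in>J. B i \<subseteq> P i \<and> card (B i) = 3) \<and>
    (\<forall>i\<in>J. \<forall>j\<in>J. i \<noteq> j \<longrightarrow> (\<forall>x\<in>B i. \<forall>y\<in>B j. dist x y = s))"
proof -
  have "finite J" using J fin_I finite_subset by blast
  then show ?thesis using assms
  proof (induction J rule: finite_induct)
    case (insert i J)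
    have "\<exists>B. (\<forall>i\<in>J. B i \<subseteq> P i \<and> card (B i) = 3) \<and>
      (\<forall>i\<in>J. \<forall>j\<in>J. i \<noteq> j \<longrightarrow> (\<forall>x\<in>B i. \<forall>y\<in>B j. dist x y = s))"
      by (rule insert.IH) (use insert.prems in auto)
    then obtain B where B: "\<And>j. j \<in> J \<Longrightarrow> B j \<subseteq> P j \<and> card (B j) = 3"
      "\<And>j j' x y. j \<in> J \<Longrightarrow> j' \<in> J \<Longrightarrow> j \<noteq> j' \<Longrightarrow> x \<in> B j \<Longrightarrow> y \<in> B j' \<Longrightarrow> dist x y = s"
      by (elim exE conjE) blast
    define F where "F = (\<Union>j\<in>J. B j)"
    have finB: "finite (B j)" if "j \<in> J" for j using B(1)[OF that] by (metis card.infinite zero_neq_numeral)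
    have F: "finite F" "F \<subseteq> (\<Union>j\<in>I - {i}. A j)"
      using finB insert B(1) unfolding F_def by (fastforce)+
    have "card F \<le> (\<Sum>j\<in>J. card (B j))" unfolding F_def by (rule card_UN_le[OF insert(1)])
    also have "\<dots> = 3 * card J" using B(1) by simp
    also have "\<dots> \<le> 3 * card I" using insert fin_I by (simp add: card_mono)
    finally have cF: "real (card F) \<le> 3 * real (card I)" by simp
    define G where "G = P i \<inter> {x. \<forall>y\<in>F. dist x y = s}"
    have iI: "i \<in> I" using insert.prems by simp
    have finP: "finite (P i)" using insert.prems fin_A[OF iI] finite_subset by blast
    have "card (P i) \<le> card (G \<union> (A i - {x. \<forall>y\<in>F. dist x y = s}))"
      using insert.prems fin_A[OF iI] finP by (intro card_mono) (auto simp: G_def)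
    also have "\<dots> \<le> card G + card (A i - {x. \<forall>y\<in>F. dist x y = s})" by (rule card_Un_le)
    finally have "real (card (P i)) \<le> real (card G) + real (card (A i - {x. \<forall>y\<in>F. dist x y = s}))" by linarith
    also have "\<dots> \<le> real (card G) + real (card F) * w" using card_missing[OF iI F] by simp
    also have "\<dots> \<le> real (card G) + 3 * real (card I) * w" using cF w by (simp add: mult_right_mono)
    finally have "3 \<le> card G" using insert.prems(3)[of i] by simp
    then obtain T where T: "T \<subseteq> G" "card T = 3" using obtain_subset_with_card_n by metis
    show ?case
    proof (intro exI[of _ "B(i := T)"] conjI ballI impI)
      fix j assume "j \<in> insert i J"
      then show "(B(i := T)) j \<subseteq> P j" "card ((B(i := T)) j) = 3"
        using B(1) T by (auto simp: G_def)
    next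
      fix j j' x y assume *: "j \<in> insert i J" "j' \<in> insert i J" "j \<noteq> j'"
        "x \<in> (B(i := T)) j" "y \<in> (B(i := T)) j'"
      have TF: "dist a b = s" if "a \<in> T" "b \<in> B l" "l \<in> J" for a b l
        using T(1) that by (auto simp: G_def F_def)
      consider "j = i" "j' \<in> J" "j' \<noteq> i" | "j' = i" "j \<in> J" "j \<noteq> i" | "j \<in> J" "j' \<in> J" "j \<noteq> i" "j' \<noteq> i"
        using * by blast
      then show "dist x y = s"
      proof cases
        case 1 then show ?thesis using TF[of x y j'] * by simp
      next
        case 2 then show ?thesis using TF[of y x j] * by (simp add: dist_commute)
      next
        case 3 then show ?thesis using B(2)[of j j' x y] * by simp
      qed
    qed
  qed simp
qed

lemma select_triples:
  assumes "J \<subseteq> I" "\<And>i. i \<in> J \<Longrightarrow> P i \<subseteq> A i"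
    "\<And>i. i \<in> J \<Longrightarrow> 3 + 3 * real (card I) * w \<le> real (card (P i))"
  obtains B where "\<And>i. i \<in> J \<Longrightarrow> B i \<subseteq> P i" "\<And>i. i \<in> J \<Longrightarrow> card (B i) = 3"
    "\<And>i j x y. i \<in> J \<Longrightarrow> j \<in> J \<Longrightarrow> i \<noteq> j \<Longrightarrow> x \<in> B i \<Longrightarrow> y \<in> B j \<Longrightarrow> dist x y = s"
proof -
  obtain B where B: "(\<forall>i\<in>J. B i \<subseteq> P i \<and> card (B i) = 3) \<and>
    (\<forall>i\<in>J. \<forall>j\<in>J. i \<noteq> j \<longrightarrow> (\<forall>x\<in>B i. \<forall>y\<in>B j. dist x y = s))"
    using ex_triples[OF assms] ..
  show ?thesis by (rule that[of B]) (use B in simp_all)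
qed

text \<open>The second alternative admits an affine basis of a class in place of a triple. A triple
  qualifies because it is cospherical about any point of another family.\<close>

lemma equidistant_familiesI:
  assumes d: "\<And>i j x y. i \<in> I \<Longrightarrow> j \<in> I \<Longrightarrow> i \<noteq> j \<Longrightarrow> x \<in> B i \<Longrightarrow> y \<in> B j \<Longrightarrow> dist x y = s"
    and c: "\<And>i. i \<in> I \<Longrightarrow> card (B i) = 3 \<or> 2 \<le> dim (direction (B i))"
  shows "equidistant_families I B s"
proof
  fix i assume i: "i \<in> I"
  have "I \<noteq> {i}" using card_I by auto
  then obtain j where j: "j \<in> I" "j \<noteq> i" using i by blast
  have "B j \<noteq> {}" using c[OF j(1)] by (auto simp: direction_def)
  then obtain z where "z \<in> B j" by blast
  then show "2 \<le> dim (direction (B i))"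
    using c[OF i] dim_direction_cospherical_ge_2[of "B i" z s] d[OF i j(1)] j(2) by blast
qed (use fin_I card_I d in auto)

lemma card_outside_common:
  assumes B: "equidistant_families I B s" "\<And>i. i \<in> I \<Longrightarrow> B i \<subseteq> A i"
    and i: "i \<in> I" and c: "real (\<Sum>i\<in>I. card (B i)) \<le> C"
  shows "real (card (A i - equidistant_families.common I B s i)) \<le> C * w"
proof -
  interpret equidistant_families I B s by (rule B(1))
  define F where "F = (\<Union>j\<in>I - {i}. B j)"
  have finB: "finite (B j)" if "j \<in> I" for j using B(2)[OF that] fin_A[OF that] finite_subset by blast
  have F: "finite F" "F \<subseteq> (\<Union>j\<in>I - {i}. A j)"
    using finB fin_I B(2) unfolding F_def by fastforce+
  have "card F \<le> (\<Sum>j\<in>I - {i}. card (B j))" unfolding F_def using fin_I by (intro card_UN_le) auto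
  also have "\<dots> \<le> (\<Sum>j\<in>I. card (B j))" using fin_I by (intro sum_mono2) auto
  finally have "real (card F) \<le> C" using c by linarith
  then have "real (card F) * w \<le> C * w" using w by (rule mult_right_mono)
  moreover have "common i = {x. \<forall>y\<in>F. dist x y = s}" by (auto simp: common_def F_def)
  ultimately show ?thesis using card_missing[OF i F] by simp
qed

text \<open>Let \<open>r = card I\<close>. If some class keeps more than \<open>3 * r * w\<close>
  points off every plane, three dimensions from it and two from each other class fill the space
  exactly. Otherwise every class becomes planar after discarding at most \<open>3 * r * w\<close>
  points, and one dimension is left over. The constant 8 covers both cases: fewer than
  \<open>5 * r\<close> base points excluding \<open>w\<close> points each in the first, and a loss
  of \<open>3 * r * w\<close> twice in the second.\<close>

lemma lenz_spheres_exist: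
  assumes DIM: "DIM('a) = 2 * card I + 1"
    and size: "\<And>i. i \<in> I \<Longrightarrow> 3 + 8 * real (card I) * w \<le> real (card (A i))"
  shows "\<exists>M. (\<forall>i\<in>I. M i \<subseteq> A i \<and> real (card (A i - M i)) \<le> 8 * real (card I) * w) \<and> lenz_spheres I s M"
proof -
  define r where "r = card I"
  have r: "3 \<le> r" using card_I by (simp add: r_def)
  have rw: "0 \<le> real r * w" "3 * w \<le> real r * w" using w r by (simp_all add: mult_right_mono)
  have size3: "3 + 3 * real (card I) * w \<le> real (card (A i))" if "i \<in> I" for i
    using size[OF that] rw by (simp add: r_def[symmetric])
  show ?thesis
  proof (cases "\<exists>i0\<in>I. \<forall>H. affine H \<and> aff_dim H \<le> 2 \<longrightarrow> real (card (A i0 - H)) > 3 * real r * w")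
    case True
    then obtain i0 where i0: "i0 \<in> I"
      and nonflat: "\<And>H. affine H \<Longrightarrow> aff_dim H \<le> 2 \<Longrightarrow> real (card (A i0 - H)) > 3 * real r * w" by blast
    define J where "J = I - {i0}"
    have J: "J \<subseteq> I" "finite J" using fin_I by (auto simp: J_def)
    obtain B where B: "\<And>j. j \<in> J \<Longrightarrow> B j \<subseteq> A j" "\<And>j. j \<in> J \<Longrightarrow> card (B j) = 3"
      "\<And>j j' x y. j \<in> J \<Longrightarrow> j' \<in> J \<Longrightarrow> j \<noteq> j' \<Longrightarrow> x \<in> B j \<Longrightarrow> y \<in> B j' \<Longrightarrow> dist x y = s"
    proof (rule select_triples[of J A])
      show "3 + 3 * real (card I) * w \<le> real (card (A i))" if "i \<in> J" for i
        using size3 that J(1) by blast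
    qed (use J in auto)
    define F where "F = (\<Union>j\<in>J. B j)"
    define D where "D = A i0 \<inter> {x. \<forall>y\<in>F. dist x y = s}"
    have finB: "finite (B j)" if "j \<in> J" for j using B(2)[OF that] by (metis card.infinite zero_neq_numeral)
    have F: "finite F" "F \<subseteq> (\<Union>j\<in>I - {i0}. A j)"
      using finB J B(1) unfolding F_def J_def by fastforce+
    have cJ: "card J + 1 = r" using i0 fin_I r by (simp add: J_def r_def)
    have "card F \<le> (\<Sum>j\<in>J. card (B j))" unfolding F_def by (rule card_UN_le[OF J(2)])
    also have "\<dots> = 3 * card J" using B(2) by simp
    also have "\<dots> \<le> 3 * r" using cJ by simp
    finally have "real (card F) \<le> 3 * real r" by simp
    then have "real (card F) * w \<le> 3 * real r * w" using w by (rule mult_right_mono)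
    moreover have "A i0 - D = A i0 - {x. \<forall>y\<in>F. dist x y = s}" by (auto simp: D_def)
    ultimately have "real (card (A i0 - D)) \<le> 3 * real r * w" using card_missing[OF i0 F] by simp
    moreover have "card (A i0 - affine hull D) \<le> card (A i0 - D)"
      using fin_A[OF i0] by (intro card_mono) (auto intro: hull_inc)
    \<comment> \<open>Passing from \<open>A i0\<close> to \<open>D\<close> loses at most
      \<open>3 * r * w\<close> points, the very threshold of the case distinction, so
      \<open>D\<close> cannot lie in a plane.\<close>
    ultimately have "\<not> aff_dim (affine hull D) \<le> 2"
      using nonflat[of "affine hull D"] affine_affine_hull[of D] by force
    then have aD: "aff_dim D \<ge> 3" by simp
    \<comment> \<open>An affine basis has the directions of \<open>D\<close> but at most
      \<open>2 * r + 2\<close> points, so requiring distance \<open>s\<close> to all of them stays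
      affordable.\<close>
    obtain B0 where B0: "B0 \<subseteq> D" "\<not> affine_dependent B0" "affine hull D = affine hull B0"
      using affine_basis_exists[of D] by auto
    have aB0: "aff_dim B0 \<ge> 3" using aD B0(3) by (metis aff_dim_affine_hull)
    have cB0: "card B0 \<le> 2 * r + 2"
    proof -
      have "int (card B0) - 1 = aff_dim B0" using aff_dim_affine_independent[OF B0(2)] by simp
      also have "\<dots> \<le> int (2 * r + 1)" using aff_dim_le_DIM[of B0] DIM by (simp add: r_def)
      finally show ?thesis by simp
    qed
    have dB0: "3 \<le> dim (direction B0)"
    proof -
      have "B0 \<noteq> {}" using aB0 by auto
      then obtain a where a: "a \<in> B0" by blast
      have "aff_dim B0 = int (dim ((+) (- a) ` B0))" using a by (intro aff_dim_eq_dim) (simp add: hull_inc)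
      also have "dim ((+) (- a) ` B0) \<le> dim (direction B0)"
        using a by (intro dim_subset) (auto simp: direction_def)
      finally show ?thesis using aB0 by simp
    qed
    define B' where "B' = B(i0 := B0)"
    have DB: "dist x y = s" if "x \<in> B0" "y \<in> B j" "j \<in> J" for x y j
      using that B0(1) by (auto simp: D_def F_def)
    have eqd: "equidistant_families I B' s"
    proof (rule equidistant_familiesI)
      fix i j x y assume ij: "i \<in> I" "j \<in> I" "i \<noteq> j" "x \<in> B' i" "y \<in> B' j"
      consider "i = i0" "j \<in> J" "j \<noteq> i0" | "j = i0" "i \<in> J" "i \<noteq> i0" | "i \<in> J" "j \<in> J" "i \<noteq> i0" "j \<noteq> i0"
        using ij by (auto simp: J_def)
      then show "dist x y = s"
      proof cases
        case 1 then show ?thesis using DB[of x y j] ij by (simp add: B'_def)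
      next
        case 2 then show ?thesis using DB[of y x i] ij by (simp add: B'_def dist_commute)
      next
        case 3 then show ?thesis using B(3)[of i j x y] ij by (simp add: B'_def)
      qed
    next
      fix i assume "i \<in> I"
      then show "card (B' i) = 3 \<or> 2 \<le> dim (direction (B' i))"
        using B(2) dB0 by (cases "i = i0") (auto simp: B'_def J_def)
    qed
    then interpret E: equidistant_families I B' s .
    have B'A: "B' i \<subseteq> A i" if "i \<in> I" for i
      using that B(1) B0(1) by (cases "i = i0") (auto simp: B'_def J_def D_def)
    have IJ: "I = insert i0 J" "i0 \<notin> J" using i0 by (auto simp: J_def)
    \<comment> \<open>The lower bounds \<open>g\<close> for the dimensions already add up to
      \<open>DIM('a)\<close>, which is also an upper bound for the sum; hence all of them are
      attained.\<close>
    define g where "g i = (if i = i0 then 3 else 2 :: nat)" for i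
    have gle: "g i \<le> dim (E.U i)" if "i \<in> I" for i
    proof -
      have "B' i0 = B0" by (simp add: B'_def)
      then show ?thesis using E.dim_ge[OF that] dB0 unfolding g_def E.dim_U by auto
    qed
    have "(\<Sum>j\<in>J. g j) = (\<Sum>j\<in>J. 2)" using IJ(2) by (intro sum.cong) (auto simp: g_def)
    then have "(\<Sum>i\<in>I. g i) = 3 + 2 * card J"
      unfolding IJ(1) using IJ(2) J(2) by (simp add: g_def)
    then have "(\<Sum>i\<in>I. g i) = DIM('a)" using cJ DIM by (simp add: r_def)
    then have full: "(\<Sum>i\<in>I. dim (E.U i)) = DIM('a)" and geq: "(\<Sum>i\<in>I. g i) = (\<Sum>i\<in>I. dim (E.U i))"
      using E.sum_dim_le sum_mono[of I g "\<lambda>i. dim (E.U i)"] gle by simp_all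
    have gi: "g i = dim (E.U i)" if "i \<in> I" for i
      using sum_mono_inv[OF geq gle that fin_I] .
    have g0: "dim (E.U i0) = 3" using gi[OF i0] by (simp add: g_def)
    have g2: "dim (E.U i) = 2" if "i \<in> I" "i \<noteq> i0" for i using gi[OF that(1)] that(2) by (simp add: g_def)
    have ls: "lenz_spheres I s E.common"
      by (rule E.lenz_spheres_full[OF full i0 g0 g2])
    have "(\<Sum>i\<in>I. card (B' i)) = card B0 + 3 * card J"
    proof -
      have "(\<Sum>i\<in>J. card (B' i)) = (\<Sum>i\<in>J. 3)"
        using IJ(2) B(2) by (intro sum.cong) (auto simp: B'_def)
      then show ?thesis unfolding IJ(1) using IJ(2) J(2) by (simp add: B'_def)
    qed
    also have "\<dots> \<le> 8 * r" using cB0 cJ r by simp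
    finally have "real (\<Sum>i\<in>I. card (B' i)) \<le> 8 * real r" by linarith
    note out = card_outside_common[OF eqd B'A _ this]
    show ?thesis
    proof (intro exI[of _ "\<lambda>i. A i \<inter> E.common i"] conjI ballI)
      fix i assume "i \<in> I"
      then show "A i \<inter> E.common i \<subseteq> A i"
        "real (card (A i - A i \<inter> E.common i)) \<le> 8 * real (card I) * w"
        using out by (auto simp: r_def Diff_Int)
    next
      show "lenz_spheres I s (\<lambda>i. A i \<inter> E.common i)"
        by (rule lenz_spheres_mono[OF ls]) blast
    qed
  next
    case False
    then have "\<forall>i\<in>I. \<exists>H. affine H \<and> aff_dim H \<le> 2 \<and> real (card (A i - H)) \<le> 3 * real r * w"
      by (metis not_less)
    then obtain H where H: "\<And>i. i \<in> I \<Longrightarrow> affine (H i)" "\<And>i. i \<in> I \<Longrightarrow> aff_dim (H i) \<le> 2"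
      "\<And>i. i \<in> I \<Longrightarrow> real (card (A i - H i)) \<le> 3 * real r * w" by metis
    have sizeH: "3 + 3 * real (card I) * w \<le> real (card (A i \<inter> H i))" if i: "i \<in> I" for i
    proof -
      have "card (A i) = card (A i \<inter> H i) + card (A i - H i)"
        using fin_A[OF i] card_Int_Diff by blast
      then show ?thesis using size[OF i] H(3)[OF i] rw by (simp add: r_def)
    qed
    obtain B where B: "\<And>j. j \<in> I \<Longrightarrow> B j \<subseteq> A j \<inter> H j" "\<And>j. j \<in> I \<Longrightarrow> card (B j) = 3"
      "\<And>j j' x y. j \<in> I \<Longrightarrow> j' \<in> I \<Longrightarrow> j \<noteq> j' \<Longrightarrow> x \<in> B j \<Longrightarrow> y \<in> B j' \<Longrightarrow> dist x y = s"
    proof (rule select_triples[of I "\<lambda>i. A i \<inter> H i"])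
      show "3 + 3 * real (card I) * w \<le> real (card (A i \<inter> H i))" if "i \<in> I" for i
        by (rule sizeH[OF that])
    qed auto
    have eqd: "equidistant_families I B s"
      by (rule equidistant_familiesI) (use B in blast)+
    then interpret E: equidistant_families I B s .
    \<comment> \<open>The triple in \<open>H i\<close> spans two dimensions, so \<open>U i\<close>
      is the full direction space of \<open>H i\<close>. Thus all points of \<open>H i\<close>, not
      only the triple, meet the planarity condition of
      \<open>lenz_spheres_codim_one\<close>.\<close>
    have UH: "E.U i = {x - b | x. x \<in> H i}" "dim (E.U i) = 2" if i: "i \<in> I" and b: "b \<in> B i" for i b
    proof -
      have bH: "b \<in> H i" using B(1)[OF i] b by blast
      let ?T = "{x - b | x. x \<in> H i}"
      have T: "subspace ?T" using affine_diffs_subspace_subtract[OF H(1)[OF i] bH] by (simp add: Setcompr_eq_image)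
      have dT: "dim ?T \<le> 2"
        using aff_dim_dim_affine_diffs[OF H(1)[OF i] bH] H(2)[OF i] by (simp add: Setcompr_eq_image)
      have "direction (B i) \<subseteq> ?T"
      proof
        fix d assume "d \<in> direction (B i)"
        then obtain x y where xy: "x \<in> B i" "y \<in> B i" "d = (x - b) - (y - b)" by (auto simp: direction_def)
        then have "x - b \<in> ?T" "y - b \<in> ?T" using B(1)[OF i] by blast+
        then show "d \<in> ?T" unfolding xy(3) by (rule subspace_diff[OF T])
      qed
      then have UT: "E.U i \<subseteq> ?T" unfolding E.U_def using T by (rule span_minimal)
      have "dim (E.U i) \<ge> 2" using E.dim_ge[OF i] by (simp add: E.dim_U)
      then show "E.U i = ?T" using subspace_dim_equal[OF E.subspace_U T UT] dT by simp
      then show "dim (E.U i) = 2" using dT \<open>dim (E.U i) \<ge> 2\<close> by simp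
    qed
    have dim2: "dim (E.U i) = 2" if "i \<in> I" for i
      using UH(2)[OF that] E.B_nonempty[OF that] by blast
    then have "(\<Sum>i\<in>I. dim (E.U i)) + 1 = DIM('a)" using DIM by simp
    from E.lenz_spheres_codim_one[OF this dim2]
    have ls: "lenz_spheres I s (\<lambda>i. E.common i \<inter> {x. x - E.c i \<in> E.U i})" .
    have "(\<Sum>i\<in>I. card (B i)) = 3 * card I" using B(2) by simp
    then have "real (\<Sum>i\<in>I. card (B i)) \<le> 3 * real r" by (simp add: r_def)
    then have out: "real (card (A i - E.common i)) \<le> 3 * real r * w" if "i \<in> I" for i
      using card_outside_common[OF eqd _ that] B(1) by blast
    show ?thesis
    proof (intro exI[of _ "\<lambda>i. A i \<inter> H i \<inter> E.common i"] conjI ballI)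
      fix i assume i: "i \<in> I"
      show "A i \<inter> H i \<inter> E.common i \<subseteq> A i" by blast
      have "card (A i - A i \<inter> H i \<inter> E.common i) \<le> card ((A i - H i) \<union> (A i - E.common i))"
        using fin_A[OF i] by (intro card_mono) auto
      also have "\<dots> \<le> card (A i - H i) + card (A i - E.common i)" by (rule card_Un_le)
      finally show "real (card (A i - A i \<inter> H i \<inter> E.common i)) \<le> 8 * real (card I) * w"
        using out[OF i] H(3)[OF i] rw by (simp add: r_def)
    next
      have "A i \<inter> H i \<inter> E.common i \<subseteq> E.common i \<inter> {x. x - E.c i \<in> E.U i}" if i: "i \<in> I" for i
      proof -
        obtain b where b: "b \<in> B i" using E.B_nonempty[OF i] by blast
        have "x - E.c i \<in> E.U i" if "x \<in> H i" for x
        proof -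
          have "x - b \<in> E.U i" using UH(1)[OF i b] that by blast
          moreover have "b - E.c i \<in> E.U i" using E.center(2)[OF i b] .
          ultimately have "(x - b) + (b - E.c i) \<in> E.U i" by (rule subspace_add[OF E.subspace_U])
          then show ?thesis by simp
        qed
        then show ?thesis by blast
      qed
      then show "lenz_spheres I s (\<lambda>i. A i \<inter> H i \<inter> E.common i)"
        by (rule lenz_spheres_mono[OF ls])
    qed
  qed
qed

end

text \<open>The triples span mutually orthogonal spaces of dimension at least 2, too many for the
  ambient dimension. The distance may vary with the pair of classes, as it will for cliques of the
  union graph.\<close>

lemma no_equidistant_triples:
  fixes B :: "nat \<Rightarrow> 'a::euclidean_space set"
  assumes "DIM('a) < 2 * m" "2 \<le> m"
    and c: "\<And>i. i < m \<Longrightarrow> card (B i) = 3"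
    and d: "\<And>i j x x' y y'. i < m \<Longrightarrow> j < m \<Longrightarrow> i \<noteq> j \<Longrightarrow> x \<in> B i \<Longrightarrow> x' \<in> B i \<Longrightarrow> y \<in> B j \<Longrightarrow> y' \<in> B j
      \<Longrightarrow> dist x y = dist x' y'"
  shows False
proof -
  have ne: "B i \<noteq> {}" if "i < m" for i using c[OF that] by auto
  have "2 \<le> dim (direction (B i))" if i: "i < m" for i
  proof -
    obtain j where j: "j < m" "j \<noteq> i"
      using that[of "if i = 0 then 1 else 0"] assms(2) by (cases "i = 0") auto
    obtain x0 z where "x0 \<in> B i" "z \<in> B j" using ne i j by blast
    then show ?thesis
      using dim_direction_cospherical_ge_2[of "B i" z "dist x0 z"] c[OF i] d[of i j] i j by metis
  qed
  then have "(\<Sum>i\<in>{..<m}. 2) \<le> (\<Sum>i\<in>{..<m}. dim (direction (B i)))" by (intro sum_mono) auto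
  also have "\<dots> \<le> DIM('a)"
  proof (rule sum_dim_orthogonal_le)
    fix i j u v assume ij: "i \<in> {..<m}" "j \<in> {..<m}" "i \<noteq> j" "u \<in> direction (B i)" "v \<in> direction (B j)"
    obtain x0 y0 where "x0 \<in> B i" "y0 \<in> B j" using ne ij by (metis all_not_in_conv lessThan_iff)
    then show "u \<bullet> v = 0"
      using inner_directions_zero[of "B i" "B j" "dist x0 y0" u v] d[of i j] ij by (metis lessThan_iff)
  qed simp
  finally show False using assms(1) by simp
qed

section \<open>A lower bound from orthogonal circles\<close>

text \<open>Unit circles about the origin in orthogonal coordinate planes: orthogonal unit vectors
  have distance \<open>sqrt 2\<close>. The angles \<open>1 / (m + 1)\<close> stay in the range where
  the cosine is injective.\<close>

lemma ex_lenz_points: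
  assumes "2 * r \<le> DIM('a::euclidean_space)"
  shows "\<exists>p :: nat \<Rightarrow> nat \<Rightarrow> 'a. (\<forall>i<r. inj (p i)) \<and>
    (\<forall>i<r. \<forall>j<r. i \<noteq> j \<longrightarrow> (\<forall>m m'. dist (p i m) (p j m') = sqrt 2))"
proof -
  obtain b :: "nat \<Rightarrow> 'a" where b: "bij_betw b {..<DIM('a)} Basis"
    using ex_bij_betw_nat_finite[of "Basis :: 'a set"] finite_Basis by (metis atLeast0LessThan)
  have bB: "b u \<in> Basis" if "u < 2 * r" for u
    using bij_betwE[OF b] that assms by auto
  have inner_b: "b u \<bullet> b v = (if u = v then 1 else 0)" if "u < 2 * r" "v < 2 * r" for u v
    using inner_Basis[OF bB[OF that(1)] bB[OF that(2)]] bij_betw_imp_inj_on[OF b] that assms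
    by (auto simp: inj_on_def)
  define t where "t m = 1 / (real m + 1)" for m
  define p where "p i m = cos (t m) *\<^sub>R b (2 * i) + sin (t m) *\<^sub>R b (2 * i + 1)" for i m
  have t: "0 \<le> t m" "t m \<le> pi" for m
  proof -
    have "t m \<le> 1" by (simp add: t_def)
    then show "t m \<le> pi" using pi_ge_two by linarith
  qed (simp add: t_def)
  have "inj (p i)" if i: "i < r" for i
  proof (rule injI)
    fix m m' assume "p i m = p i m'"
    then have "p i m \<bullet> b (2 * i) = p i m' \<bullet> b (2 * i)" by simp
    then have "cos (t m) = cos (t m')" using i by (simp add: p_def inner_simps inner_b)
    then have "t m = t m'" using cos_inj_pi[of "t m" "t m'"] t by blast
    then show "m = m'" by (simp add: t_def)
  qed
  moreover have "dist (p i m) (p j m') = sqrt 2" if ij: "i < r" "j < r" "i \<noteq> j" for i j m m'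
  proof -
    have ne: "2 * i \<noteq> Suc (2 * j)" "Suc (2 * i) \<noteq> 2 * j" by presburger+
    have self: "p i m \<bullet> p i m = 1" if "i < r" for i m
      using that by (simp add: p_def inner_simps inner_b flip: power2_eq_square)
    have "p i m \<bullet> p j m' = 0"
      using ij ne by (simp add: p_def inner_simps inner_b)
    then have "(p i m - p j m') \<bullet> (p i m - p j m') = 2"
      using self ij by (simp add: inner_diff inner_commute)
    then show ?thesis by (simp add: dist_norm norm_eq_sqrt_inner)
  qed
  ultimately show ?thesis by blast
qed

lemma simplex_count_mono:
  assumes "finite Y" "X \<subseteq> Y"
  shows "simplex_count k X \<le> simplex_count k Y"
  unfolding simplex_count_def
  using assms by (intro card_mono) (auto intro: finite_subset[OF _ finite_Pow_iff[THEN iffD2, OF assms(1)]])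

text \<open>Each choice of \<open>k\<close> circles and of one of \<open>q\<close> points on each
  gives a simplex. A choice is a set \<open>K\<close> with an extensional function on it, and is
  recovered from the graph of the function.\<close>

lemma lenz_simplex_count:
  assumes "2 * r \<le> DIM('a::euclidean_space)"
  shows "\<exists>X :: 'a set. finite X \<and> card X \<le> r * q \<and> (r choose k) * q ^ k \<le> simplex_count k X"
proof -
  obtain p :: "nat \<Rightarrow> nat \<Rightarrow> 'a" where p: "\<forall>i<r. inj (p i)"
    "\<forall>i<r. \<forall>j<r. i \<noteq> j \<longrightarrow> (\<forall>m m'. dist (p i m) (p j m') = sqrt 2)"
    using ex_lenz_points[OF assms] by blast
  define P where "P = (\<lambda>(i,m). p i m)"
  define S where "S = {..<r} \<times> {..<q}"
  have injP: "inj_on P S"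
  proof (rule inj_onI, clarify)
    fix i m j m' assume *: "(i,m) \<in> S" "(j,m') \<in> S" "P (i,m) = P (j,m')"
    then have "i = j" using p(2) by (auto simp: P_def S_def) (metis dist_self less_irrefl real_sqrt_gt_zero zero_less_numeral)
    then show "i = j \<and> m = m'" using * p(1) by (auto simp: P_def S_def inj_eq)
  qed
  define T where "T = (SIGMA K:{K. K \<subseteq> {..<r} \<and> card K = k}. K \<rightarrow>\<^sub>E {..<q})"
  define graph where "graph = (\<lambda>(K,f). (\<lambda>i. (i, f i)) ` K :: (nat \<times> nat) set)"
  have fin: "finite {K. K \<subseteq> {..<r} \<and> card K = k}" by (rule finite_subset[of _ "Pow {..<r}"]) auto
  have cardT: "card T = (r choose k) * q ^ k"
  proof -
    have "card T = (\<Sum>K\<in>{K. K \<subseteq> {..<r} \<and> card K = k}. card (K \<rightarrow>\<^sub>E {..<q}))"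
      unfolding T_def using fin by (intro card_SigmaI) (auto intro!: finite_PiE intro: finite_subset)
    also have "\<dots> = (\<Sum>K\<in>{K. K \<subseteq> {..<r} \<and> card K = k}. q ^ k)"
      by (rule sum.cong) (auto simp: card_PiE finite_subset[of _ "{..<r}"])
    also have "\<dots> = (r choose k) * q ^ k" by (simp add: n_subsets)
    finally show ?thesis .
  qed
  have graphS: "graph x \<subseteq> S" if "x \<in> T" for x
    using that by (auto simp: T_def graph_def S_def PiE_def Pi_def)
  have inj: "inj_on (\<lambda>x. P ` graph x) T"
  proof (rule inj_onI)
    fix x y assume xy: "x \<in> T" "y \<in> T" "P ` graph x = P ` graph y"
    then have g: "graph x = graph y" using inj_on_image_eq_iff[OF injP graphS graphS] by blast
    obtain K f L h where Kf: "x = (K,f)" "y = (L,h)" by (metis surj_pair)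
    have KL: "K = L"
    proof -
      have "fst ` graph x = fst ` graph y" using g by simp
      then show ?thesis by (simp add: graph_def Kf image_image)
    qed
    have "f i = h i" if "i \<in> K" for i
    proof -
      have "(i, f i) \<in> graph y" using that g by (auto simp: graph_def Kf)
      then show ?thesis by (auto simp: graph_def Kf)
    qed
    then have "f = h" using xy KL Kf by (intro PiE_ext[of f K _ h]) (auto simp: T_def)
    then show "x = y" using KL Kf by simp
  qed
  define X where "X = P ` S"
  have "finite X" by (simp add: X_def S_def)
  have "card X \<le> r * q"
    using card_image_le[of S P] by (simp add: X_def S_def card_cartesian_product)
  have "(\<lambda>x. P ` graph x) ` T \<subseteq> {\<Delta>. \<Delta> \<subseteq> X \<and> regular_simplex k \<Delta>}"
  proof (clarify, intro conjI)
    fix x assume x: "x \<in> T"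
    then obtain K f where Kf: "x = (K,f)" "K \<subseteq> {..<r}" "card K = k" "f \<in> K \<rightarrow>\<^sub>E {..<q}" by (auto simp: T_def)
    have finK: "finite K" using Kf(2) finite_subset by blast
    show "P ` graph x \<subseteq> X" using graphS[OF x] by (auto simp: X_def)
    show "regular_simplex k (P ` graph x)" unfolding regular_simplex_def
    proof (intro conjI exI[of _ "sqrt 2"])
      show "finite (P ` graph x)" using finK by (simp add: graph_def Kf)
      have "card (P ` graph x) = card (graph x)"
        using inj_on_subset[OF injP graphS[OF x]] by (rule card_image)
      also have "\<dots> = card K" unfolding graph_def Kf(1) by (simp add: card_image inj_on_def)
      finally show "card (P ` graph x) = k" using Kf by simp
      show "pairwise (\<lambda>x y. dist x y = sqrt 2) (P ` graph x)"
        using p(2) Kf(2) by (auto simp: pairwise_def graph_def Kf(1) P_def)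
    qed
  qed
  moreover have "finite {\<Delta>. \<Delta> \<subseteq> X \<and> regular_simplex k \<Delta>}"
    by (rule finite_subset[of _ "Pow X"]) (use \<open>finite X\<close> in auto)
  ultimately have "card T \<le> simplex_count k X"
    unfolding simplex_count_def using card_mono card_image[OF inj] by metis
  then show ?thesis using \<open>finite X\<close> \<open>card X \<le> r * q\<close> cardT by auto
qed

lemma max_simplex_count_ge:
  fixes X :: "'a::euclidean_space set"
  assumes "finite X" "card X \<le> n"
  shows "simplex_count k X \<le> max_simplex_count TYPE('a) k n"
proof -
  have "infinite (UNIV :: 'a set)"
    using finite_imp_bounded not_bounded_UNIV by blast
  then have "infinite (UNIV - X)" using assms(1) by (simp add: Diff_infinite_finite)
  then obtain Z where Z: "finite Z" "card Z = n - card X" "Z \<subseteq> UNIV - X"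
    using infinite_arbitrarily_large by blast
  have "card (X \<union> Z) = n" using Z assms by (subst card_Un_disjoint) auto
  then have "simplex_count k (X \<union> Z) \<le> max_simplex_count TYPE('a) k n"
    unfolding max_simplex_count_def
    using Z assms by (intro Max_ge simplex_counts_finite_nonempty) (auto intro!: exI[of _ "X \<union> Z"])
  moreover have "simplex_count k X \<le> simplex_count k (X \<union> Z)"
    using Z assms by (intro simplex_count_mono) auto
  ultimately show ?thesis by simp
qed

text \<open>Take \<open>n div r\<close> points on each circle and pad the set to \<open>n\<close>
  points. Rounding costs a factor \<open>(1 - r / n) ^ k\<close>, made linear by Bernoulli's
  inequality.\<close>

lemma max_simplex_count_lower:
  assumes "2 * r \<le> DIM('a::euclidean_space)" "1 \<le> r" "r \<le> n"
  shows "real (max_simplex_count TYPE('a) k n)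
    \<ge> real (r choose k) * (real n / real r) ^ k * (1 - real k * real r / real n)"
proof -
  define q where "q = n div r"
  obtain X :: "'a set" where X: "finite X" "card X \<le> r * q" "(r choose k) * q ^ k \<le> simplex_count k X"
    using lenz_simplex_count[OF assms(1)] by blast
  have "r * q \<le> n" by (simp add: q_def)
  then have "(r choose k) * q ^ k \<le> max_simplex_count TYPE('a) k n"
    using max_simplex_count_ge[of X n k] X by simp
  then have le: "real (r choose k) * real q ^ k \<le> real (max_simplex_count TYPE('a) k n)"
    by (metis of_nat_le_iff of_nat_mult of_nat_power)
  have x: "-1 \<le> - (real r / real n)" using assms by simp
  have "real n = real r * real q + real (n mod r)"
    unfolding q_def by (metis of_nat_add of_nat_mult mult_div_mod_eq)
  moreover have "real (n mod r) \<le> real r" using assms by (simp add: less_imp_le)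
  ultimately have "real n \<le> real r * real q + real r" by linarith
  then have "(real n - real r) / real r \<le> real q"
    using assms by (simp add: field_simps)
  moreover have "real n / real r * (1 + - (real r / real n)) = (real n - real r) / real r"
    using assms by (simp add: field_simps)
  ultimately have "real n / real r * (1 + - (real r / real n)) \<le> real q" by (simp only:)
  moreover have "0 \<le> real n / real r * (1 + - (real r / real n))" using x by simp
  ultimately have "(real n / real r * (1 + - (real r / real n))) ^ k \<le> real q ^ k" by (rule power_mono)
  moreover have "(real n / real r) ^ k * (1 - real k * real r / real n)
      \<le> (real n / real r * (1 + - (real r / real n))) ^ k"
    unfolding power_mult_distrib using Bernoulli_inequality[OF x, of k]
    by (intro mult_left_mono) auto
  ultimately have "(real n / real r) ^ k * (1 - real k * real r / real n) \<le> real q ^ k" by linarith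
  then have "real (r choose k) * ((real n / real r) ^ k * (1 - real k * real r / real n)) \<le> real (r choose k) * real q ^ k"
    by (rule mult_left_mono) simp
  then show ?thesis using le by (simp add: mult.assoc)
qed

section \<open>Regular cliques\<close>

definition atypical :: "('a \<Rightarrow> 'a \<Rightarrow> bool) \<Rightarrow> 'a set \<Rightarrow> nat \<Rightarrow> real \<Rightarrow> 'a set set" where
  "atypical E V r w = {Q \<in> cliques E V r. w < real (card (far_vertices E V Q))}"

text \<open>Three obstructions to reading classes off \<open>Q\<close>: vertices extending
  \<open>Q\<close> and so belonging to no class, exchanges of one vertex that lead to an atypical
  clique, and class sizes away from \<open>card V / r\<close>. Dividing the squared deviations by
  \<open>card V\<close> puts all three on the scale of \<open>card V\<close>.\<close>

definition irregularity :: "('a \<Rightarrow> 'a \<Rightarrow> bool) \<Rightarrow> 'a set \<Rightarrow> nat \<Rightarrow> real \<Rightarrow> 'a set \<Rightarrow> real" where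
  "irregularity E V r w Q = real (card (extenders E V Q))
    + (\<Sum>q\<in>Q. real (card {x \<in> V. insert x (Q - {q}) \<in> atypical E V r w}))
    + (\<Sum>q\<in>Q. (real (card (extenders E V (Q - {q}))) - real (card V) / real r)\<^sup>2) / real (card V)"

context fin_graph
begin

lemma insert_in_cliques:
  assumes "P \<in> cliques E V t" "x \<in> extenders E V P"
  shows "insert x P \<in> cliques E V (Suc t)" "x \<notin> P"
proof -
  show x: "x \<notin> P" using assms(2) irrefl by (auto simp: extenders_def)
  show "insert x P \<in> cliques E V (Suc t)"
    using assms x sym by (auto simp: extenders_def cliques_def pairwise_insert)
qed

lemma delete_in_cliques:
  assumes "Q \<in> cliques E V (Suc t)" "q \<in> Q"
  shows "Q - {q} \<in> cliques E V t"
  using assms by (auto simp: cliques_def pairwise_def)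

text \<open>An exchange is recovered from its result, the vertex \<open>x\<close> put in and the
  vertex \<open>q\<close> taken out. For an atypical result there are \<open>r\<close> possibilities
  for \<open>x\<close> and at most \<open>card V\<close> for \<open>q\<close>.\<close>

lemma sum_swaps:
  "(\<Sum>Q\<in>cliques E V r. \<Sum>q\<in>Q. real (card {x \<in> V. insert x (Q - {q}) \<in> atypical E V r w}))
    \<le> real r * real (card V) * real (card (atypical E V r w))"
proof -
  let ?At = "atypical E V r w"
  let ?A = "SIGMA Q:cliques E V r. SIGMA q:Q. {x \<in> V. insert x (Q - {q}) \<in> ?At}"
  let ?B = "SIGMA Q:?At. Q \<times> V"
  have At: "?At \<subseteq> cliques E V r" by (auto simp: atypical_def)
  have finQ: "finite Q" if "Q \<in> cliques E V r" for Q using that by (simp add: cliques_def)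
  have finAt: "finite ?At" using finite_subset[OF At finite_cliques] .
  have cardQ: "card Q = r" if "Q \<in> cliques E V r" for Q using that by (simp add: cliques_def)
  have "(\<Sum>Q\<in>cliques E V r. \<Sum>q\<in>Q. card {x \<in> V. insert x (Q - {q}) \<in> ?At}) = card ?A"
    using finite_cliques finQ finite_V by (simp add: card_SigmaI finite_SigmaI)
  also have "\<dots> \<le> card ?B"
  proof (rule card_inj_on_le)
    let ?f = "\<lambda>(Q,q,x). (insert x (Q - {q}), x, q)"
    \<comment> \<open>Otherwise the exchange would only delete \<open>q\<close>, leaving too few
      vertices for an \<open>r\<close>-clique.\<close>
    have notin: "x \<notin> Q - {q}" if "Q \<in> cliques E V r" "q \<in> Q" "insert x (Q - {q}) \<in> ?At" for Q q x
    proof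
      assume "x \<in> Q - {q}"
      then have "insert x (Q - {q}) = Q - {q}" by blast
      then have "card (Q - {q}) = r" using that(3) At cardQ by fastforce
      then show False using cardQ[OF that(1)] that(2) finQ[OF that(1)] card_Diff1_less by (metis less_irrefl)
    qed
    show "inj_on ?f ?A"
    proof (rule inj_onI)
      fix u v assume u: "u \<in> ?A" and v: "v \<in> ?A" and e: "?f u = ?f v"
      obtain Q q x where uq: "u = (Q,q,x)" by (metis surj_pair)
      obtain Q' q' x' where vq: "v = (Q',q',x')" by (metis surj_pair)
      have *: "q = q'" "x = x'" "insert x (Q - {q}) = insert x (Q' - {q})" using e by (auto simp: uq vq)
      have "x \<notin> Q - {q}" "x \<notin> Q' - {q}" using notin u v * by (auto simp: uq vq)
      then have "Q - {q} = Q' - {q}" using *(3) insert_ident by metis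
      moreover have "q \<in> Q" "q \<in> Q'" using u v * by (auto simp: uq vq)
      ultimately have "Q = Q'" by blast
      then show "u = v" using * by (simp add: uq vq)
    qed
    show "?f ` ?A \<subseteq> ?B" by (auto simp: cliques_def)
    show "finite ?B" using finAt At finQ finite_V by (intro finite_SigmaI) auto
  qed
  also have "card ?B = (\<Sum>Q\<in>?At. card (Q \<times> V))"
    using finAt At finQ finite_V by (intro card_SigmaI) auto
  also have "\<dots> = (\<Sum>Q\<in>?At. r * card V)"
    by (rule sum.cong) (use At cardQ in \<open>auto simp: card_cartesian_product\<close>)
  finally have "(\<Sum>Q\<in>cliques E V r. \<Sum>q\<in>Q. card {x \<in> V. insert x (Q - {q}) \<in> ?At}) \<le> r * card V * card ?At"
    by (simp add: mult.commute)
  then have "real (\<Sum>Q\<in>cliques E V r. \<Sum>q\<in>Q. card {x \<in> V. insert x (Q - {q}) \<in> ?At}) \<le> real (r * card V * card ?At)"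
    unfolding of_nat_le_iff .
  then show ?thesis by simp
qed

text \<open>The three terms are averaged separately: extenders count larger cliques, atypical
  cliques are bounded by Markov's inequality for far vertices, and each deviation recurs once per
  extender, at most \<open>card V\<close> times, cancelling the division in
  \<open>irregularity\<close>. The last two sums are those controlled by
  \<open>clique_defect\<close>.\<close>

lemma sum_irregularity:
  assumes "w > 0" and V: "card V > 0"
  shows "(\<Sum>Q\<in>cliques E V (Suc t). irregularity E V (Suc t) w Q)
    \<le> (real t + 2) * real (card (cliques E V (Suc (Suc t))))
      + real (Suc t) * real (card V) / w * (\<Sum>Q\<in>cliques E V (Suc t). real (card (far_vertices E V Q)))
      + (\<Sum>P\<in>cliques E V t. (real (card (extenders E V P)) - real (card V) / real (Suc t))\<^sup>2)"
proof -
  let ?n = "real (card V)" and ?r = "real (Suc t)"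
  let ?At = "atypical E V (Suc t) w"
  let ?far = "\<lambda>Q. real (card (far_vertices E V Q))"
  let ?dev = "\<lambda>P. (real (card (extenders E V P)) - ?n / ?r)\<^sup>2"
  have 1: "(\<Sum>Q\<in>cliques E V (Suc t). real (card (extenders E V Q))) = (real t + 2) * real (card (cliques E V (Suc (Suc t))))"
    unfolding sum_card_extenders by simp
  have At: "?At \<subseteq> cliques E V (Suc t)" by (auto simp: atypical_def)
  have "real (card ?At) * w = (\<Sum>Q\<in>?At. w)" by simp
  also have "\<dots> \<le> (\<Sum>Q\<in>?At. ?far Q)" by (rule sum_mono) (simp add: atypical_def)
  also have "\<dots> \<le> (\<Sum>Q\<in>cliques E V (Suc t). ?far Q)"
    by (rule sum_mono2[OF finite_cliques At]) simp
  finally have "real (card ?At) \<le> (\<Sum>Q\<in>cliques E V (Suc t). ?far Q) / w"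
    using assms by (simp add: pos_le_divide_eq)
  then have "?r * ?n * real (card ?At) \<le> ?r * ?n * ((\<Sum>Q\<in>cliques E V (Suc t). ?far Q) / w)"
    by (rule mult_left_mono) simp
  then have 2: "(\<Sum>Q\<in>cliques E V (Suc t). \<Sum>q\<in>Q. real (card {x \<in> V. insert x (Q - {q}) \<in> ?At}))
      \<le> ?r * ?n / w * (\<Sum>Q\<in>cliques E V (Suc t). ?far Q)"
    using sum_swaps[of "Suc t" w] by simp
  have "(\<Sum>Q\<in>cliques E V (Suc t). \<Sum>q\<in>Q. ?dev (Q - {q})) = (\<Sum>P\<in>cliques E V t. real (card (extenders E V P)) * ?dev P)"
    by (rule sum_cliques_extenders[symmetric])
  also have "\<dots> \<le> (\<Sum>P\<in>cliques E V t. ?n * ?dev P)"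
    by (intro sum_mono mult_right_mono) (simp_all add: card_extenders_le)
  also have "\<dots> = ?n * (\<Sum>P\<in>cliques E V t. ?dev P)" by (simp add: sum_distrib_left)
  finally have "(\<Sum>Q\<in>cliques E V (Suc t). \<Sum>q\<in>Q. ?dev (Q - {q})) / ?n \<le> (\<Sum>P\<in>cliques E V t. ?dev P)"
    using V by (simp add: pos_divide_le_eq mult.commute)
  then have 3: "(\<Sum>Q\<in>cliques E V (Suc t). (\<Sum>q\<in>Q. ?dev (Q - {q})) / ?n) \<le> (\<Sum>P\<in>cliques E V t. ?dev P)"
    by (simp add: sum_divide_distrib)
  show ?thesis
    unfolding irregularity_def sum.distrib 1 using 2 3 by linarith
qed

text \<open>A clique of small irregularity exhibits the near-extremal structure: the classes are the
  sets of vertices by which one of its vertices can be exchanged.\<close>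

lemma multipartite_structure:
  assumes Q: "Q \<in> cliques E V (Suc t)" and t: "1 \<le> t" and V: "card V > 0"
    and small: "irregularity E V (Suc t) w Q \<le> \<omega> * real (card V)"
  shows "\<exists>A. (\<forall>q\<in>Q. A q \<subseteq> V \<and> real (card V) / real (Suc t) - (sqrt \<omega> + \<omega>) * real (card V) \<le> real (card (A q))) \<and>
    (\<forall>q\<in>Q. \<forall>q'\<in>Q. q \<noteq> q' \<longrightarrow> A q \<inter> A q' = {}) \<and>
    (\<forall>q\<in>Q. \<forall>q'\<in>Q. q \<noteq> q' \<longrightarrow> (\<forall>x\<in>A q. real (card {y \<in> A q'. \<not> E x y}) \<le> w))"
proof -
  let ?n = "real (card V)"
  let ?At = "atypical E V (Suc t) w"
  \<comment> \<open>Being adjacent to all of \<open>Q\<close> except \<open>q\<close> makes the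
    classes disjoint; avoiding atypical exchanges turns each member into a replacement for
    \<open>q\<close> in a clique with few far vertices.\<close>
  define A where "A q = {x \<in> extenders E V (Q - {q}). \<not> E q x \<and> insert x (Q - {q}) \<notin> ?At}" for q
  define a where "a = real (card (extenders E V Q))"
  define b where "b q = real (card {x \<in> V. insert x (Q - {q}) \<in> ?At})" for q
  define d where "d q = (real (card (extenders E V (Q - {q}))) - ?n / real (Suc t))\<^sup>2" for q
  have finQ: "finite Q" using Q by (simp add: cliques_def)
  have irr: "irregularity E V (Suc t) w Q = a + sum b Q + sum d Q / ?n"
    by (simp add: irregularity_def a_def b_def d_def)
  have nonneg: "0 \<le> a" "0 \<le> sum b Q" "0 \<le> sum d Q / ?n" "\<And>q. 0 \<le> b q" "\<And>q. 0 \<le> d q"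
    by (simp_all add: a_def b_def d_def sum_nonneg)
  have \<omega>: "0 \<le> \<omega>" using small nonneg V unfolding irr
    by (smt (verit, best) mult_neg_pos of_nat_0_less_iff)
  \<comment> \<open>The term \<open>sqrt \<omega>\<close> comes from the squared deviation, the term
    \<omega> from the extenders of \<open>Q\<close> and the atypical exchanges, which are removed to
    obtain \<open>A q\<close>.\<close>
  have size: "?n / real (Suc t) - (sqrt \<omega> + \<omega>) * ?n \<le> real (card (A q))" if q: "q \<in> Q" for q
  proof -
    have "b q \<le> sum b Q" using finQ q nonneg by (intro member_le_sum) auto
    then have ab: "a + b q \<le> \<omega> * ?n" using small nonneg unfolding irr by linarith
    have "d q \<le> sum d Q" using finQ q nonneg by (intro member_le_sum) auto
    moreover have "sum d Q / ?n \<le> \<omega> * ?n" using small nonneg unfolding irr by linarith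
    then have "sum d Q \<le> \<omega> * ?n * ?n" using V by (simp add: pos_divide_le_eq)
    moreover have "(sqrt \<omega> * ?n)\<^sup>2 = \<omega> * ?n * ?n"
      unfolding power_mult_distrib real_sqrt_pow2[OF \<omega>] by (simp add: power2_eq_square)
    ultimately have "d q \<le> (sqrt \<omega> * ?n)\<^sup>2" by linarith
    then have "\<bar>real (card (extenders E V (Q - {q}))) - ?n / real (Suc t)\<bar> \<le> sqrt \<omega> * ?n"
      unfolding d_def using \<omega> by (simp add: power2_le_iff_abs_le)
    then have ext: "?n / real (Suc t) - sqrt \<omega> * ?n \<le> real (card (extenders E V (Q - {q})))" by linarith
    have "extenders E V (Q - {q}) \<subseteq> A q \<union> (extenders E V Q \<union> {x \<in> V. insert x (Q - {q}) \<in> ?At})"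
      by (auto simp: A_def extenders_def)
    then have "card (extenders E V (Q - {q})) \<le> card (A q \<union> (extenders E V Q \<union> {x \<in> V. insert x (Q - {q}) \<in> ?At}))"
      using finite_V finite_extenders by (intro card_mono) (auto simp: A_def)
    also have "\<dots> \<le> card (A q) + (card (extenders E V Q) + card {x \<in> V. insert x (Q - {q}) \<in> ?At})"
      by (intro order_trans[OF card_Un_le] add_mono order_refl card_Un_le)
    finally have "real (card (extenders E V (Q - {q}))) \<le> real (card (A q)) + (a + b q)"
      unfolding a_def b_def by linarith
    then show ?thesis using ext ab by (simp add: algebra_simps)
  qed
  have miss: "real (card {y \<in> A q'. \<not> E x y}) \<le> w"
    if qq: "q \<in> Q" "q' \<in> Q" "q \<noteq> q'" and x: "x \<in> A q" for q q' x
  proof -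
    let ?Q' = "insert x (Q - {q})"
    have P: "Q - {q} \<in> cliques E V t" using delete_in_cliques[OF Q qq(1)] .
    have xe: "x \<in> extenders E V (Q - {q})" using x by (simp add: A_def)
    have Q': "?Q' \<in> cliques E V (Suc t)" and xn: "x \<notin> Q - {q}" using insert_in_cliques[OF P xe] by auto
    have "?Q' \<notin> ?At" using x by (simp add: A_def)
    then have far: "real (card (far_vertices E V ?Q')) \<le> w" using Q' by (simp add: atypical_def)
    have "x \<noteq> q'" using xn qq by blast
    \<comment> \<open>A vertex of \<open>A q'\<close> misses \<open>q'\<close>. If it also misses
      \<open>x\<close>, it misses two members of the clique \<open>?Q'\<close>, which is not
      atypical.\<close>
    then have "{y \<in> A q'. \<not> E x y} \<subseteq> far_vertices E V ?Q'"
      using qq by (auto simp: A_def far_vertices_def extenders_def)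
    then have "card {y \<in> A q'. \<not> E x y} \<le> card (far_vertices E V ?Q')"
      by (rule card_mono[OF finite_far])
    then show ?thesis using far by linarith
  qed
  have disj: "A q \<inter> A q' = {}" if "q \<in> Q" "q' \<in> Q" "q \<noteq> q'" for q q'
    using that by (auto simp: A_def extenders_def)
  have "A q \<subseteq> V" for q by (auto simp: A_def extenders_def)
  then show ?thesis using size miss disj by (intro exI[of _ A]) auto
qed

end

text \<open>All differences are at most \<open>e\<close>, so \<open>y k\<close> can be close to 1
  only if \<open>y 3\<close> is not far below 1; with \<open>y 2 \<le> 1 + e\<close> this bounds the
  first difference from below. The recursion carries the bound up to \<open>r\<close> with total
  amplification at most \<open>r ^ (2 * r)\<close>, and summing from \<open>k\<close> to
  \<open>r\<close> bounds \<open>y r\<close>.\<close>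

lemma stable_differences:
  fixes y :: "nat \<Rightarrow> real"
  assumes step: "\<And>t. 2 \<le> t \<Longrightarrow> Suc t < r \<Longrightarrow>
      (real t + 1) * real (r - t) / real r * (y (Suc t) - y t)
        \<le> ((real t + 1) * real (r - t) / real r - 1) * (y (Suc (Suc t)) - y (Suc t))"
    and last: "y r - y (r - 1) \<le> e" and e: "e \<ge> 0"
    and y2: "y 2 \<le> 1 + e" and yk: "y k \<ge> 1 - \<delta>" and k: "3 \<le> k" "k \<le> r" and \<delta>: "\<delta> \<ge> 0"
  defines "\<tau> \<equiv> real r ^ (2 * r) * (\<delta> + (real r + 1) * e)"
  shows "y r - y (r - 1) \<ge> - \<tau>" "y r \<ge> 1 - \<delta> - real r * \<tau>"
proof -
  define D where "D t = y (Suc t) - y t" for t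
  have up: "D t \<le> e" if "2 \<le> t" "t < r" for t
  proof (rule differences_bounded_above[where r = r and ?t0.0 = 2])
    show "D (r - 1) \<le> e" using last k by (simp add: D_def)
  qed (use step e that in \<open>auto simp: D_def\<close>)
  have "y k - y 3 = (\<Sum>t=3..<k. D t)"
    using sum_Suc_diff'[of 3 k y] k by (simp add: D_def)
  also have "\<dots> \<le> (\<Sum>t=3..<k. e)" using up k by (intro sum_mono) auto
  also have "\<dots> \<le> real r * e" using k e by (simp add: mult_right_mono)
  finally have "y k - y 3 \<le> real r * e" .
  then have D2: "D 2 \<ge> - (\<delta> + (real r + 1) * e)"
    using y2 yk by (simp add: D_def algebra_simps numeral_3_eq_3 numeral_2_eq_2)
  have nn: "0 \<le> \<delta> + (real r + 1) * e" using e \<delta> by simp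
  have low: "D (2 + d) \<ge> - \<tau>" if d: "2 + d < r" for d
  proof -
    have "D (2 + d) \<ge> - (real r ^ (2 * d) * (\<delta> + (real r + 1) * e))"
    proof (rule differences_bounded_below[where r = r])
      show "- (\<delta> + (real r + 1) * e) \<le> D 2" by (rule D2)
    qed (use step nn d in \<open>auto simp: D_def\<close>)
    moreover have "real r ^ (2 * d) \<le> real r ^ (2 * r)"
      using d by (intro power_increasing) auto
    then have "real r ^ (2 * d) * (\<delta> + (real r + 1) * e) \<le> \<tau>"
      unfolding \<tau>_def using nn by (rule mult_right_mono)
    ultimately show ?thesis by linarith
  qed
  have low': "D t \<ge> - \<tau>" if "2 \<le> t" "t < r" for t
  proof -
    obtain d where "t = 2 + d" using \<open>2 \<le> t\<close> le_Suc_ex by blast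
    then show ?thesis using low that(2) by blast
  qed
  show "y r - y (r - 1) \<ge> - \<tau>" using low'[of "r - 1"] k by (simp add: D_def)
  have \<tau>: "0 \<le> \<tau>" using nn by (simp add: \<tau>_def)
  have "- (real r * \<tau>) \<le> - (real (r - k) * \<tau>)" using \<tau> by (simp add: mult_right_mono)
  also have "\<dots> = (\<Sum>t=k..<r. - \<tau>)" using k by simp
  also have "\<dots> \<le> (\<Sum>t=k..<r. D t)" using low' k by (intro sum_mono) auto
  also have "\<dots> = y r - y k" using sum_Suc_diff'[of k r y] k by (simp add: D_def)
  finally show "y r \<ge> 1 - \<delta> - real r * \<tau>" using yk by linarith
qed

section \<open>Rarity of cliques too large for the dimension\<close>

lemma pigeonhole_fibre:
  fixes M :: real
  assumes "finite L" "L \<noteq> {}" "real (card (f ` L)) \<le> M"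
  shows "\<exists>p. real (card L) \<le> M * real (card {x \<in> L. f x = p})"
proof (rule ccontr)
  assume "\<not> ?thesis"
  then have less: "M * real (card {x \<in> L. f x = p}) < real (card L)" for p by (simp add: not_le)
  have M: "0 < M" using assms
    by (metis card_gt_0_iff empty_is_image finite_imageI less_le_trans of_nat_0_less_iff)
  have "card L = (\<Sum>p\<in>f ` L. card {x \<in> L. f x = p})"
    using sum.image_gen[OF assms(1), of "\<lambda>_. 1 :: nat" f] by (simp only: card_eq_sum)
  then have "real (card L) = (\<Sum>p\<in>f ` L. real (card {x \<in> L. f x = p}))" by simp
  also have "\<dots> < (\<Sum>p\<in>f ` L. real (card L) / M)"
    using assms less M by (intro sum_strict_mono) (auto simp: pos_less_divide_eq mult.commute)
  also have "\<dots> = real (card (f ` L)) * (real (card L) / M)" by simp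
  also have "\<dots> \<le> M * (real (card L) / M)" using assms(3) M by (intro mult_right_mono) auto
  finally show False using M by simp
qed

text \<open>Vertex lists of cliques are classified by their matrix of distances. If there were many
  cliques, one matrix would occur with positive density, and a box of triples inside its fibre would
  consist of \<open>m\<close> mutually equidistant triples.\<close>

lemma few_large_cliques:
  fixes \<eta> :: real
  assumes DIM: "DIM('a::euclidean_space) < 2 * m" and m: "2 \<le> m" and "\<eta> > 0"
  shows "\<exists>n0. \<forall>X :: 'a set. \<forall>S :: real set. finite X \<longrightarrow> card X \<ge> n0 \<longrightarrow> finite S \<longrightarrow> card S \<le> K \<longrightarrow>
    real (card (cliques (\<lambda>x y. dist x y \<in> S) X m)) \<le> \<eta> * real (card X) ^ m"
proof -
  \<comment> \<open>A bound for the number of distance matrices: each of the \<open>m * m\<close>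
    entries is one of at most \<open>K\<close> distances or 0, the latter on the diagonal.\<close>
  define M where "M = real ((K + 1) ^ (m * m))"
  have M: "M > 0" by (simp add: M_def)
  have "\<eta> / M > 0" using assms M by simp
  from dense_lists_contain_box[OF this, where t = m]
  obtain n0 where n0: "\<forall>V :: 'a set. finite V \<longrightarrow> card V \<ge> n0 \<longrightarrow>
    (\<forall>L. L \<subseteq> {xs. set xs \<subseteq> V \<and> length xs = m} \<longrightarrow> real (card L) \<ge> \<eta> / M * real (card V) ^ m \<longrightarrow>
      (\<exists>Bs. length Bs = m \<and> (\<forall>B\<in>set Bs. B \<subseteq> V \<and> card B = 3) \<and>
        (\<forall>xs. list_all2 (\<in>) xs Bs \<longrightarrow> xs \<in> L)))" ..
  show ?thesis
  proof (intro exI[of _ n0] allI impI)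
    fix X :: "'a set" and S :: "real set"
    assume X: "finite X" "n0 \<le> card X" and S: "finite S" "card S \<le> K"
    let ?C = "cliques (\<lambda>x y. dist x y \<in> S) X m"
    show "real (card ?C) \<le> \<eta> * real (card X) ^ m"
    proof (rule ccontr)
      assume "\<not> ?thesis"
      then have big: "\<eta> * real (card X) ^ m < real (card ?C)" by simp
      define L where "L = {xs. distinct xs \<and> set xs \<in> ?C}"
      have Ll: "L \<subseteq> {xs. set xs \<subseteq> X \<and> length xs = m}"
        by (auto simp: L_def cliques_def distinct_card)
      have finL: "finite L" using finite_subset[OF Ll finite_lists_length_eq[OF X(1)]] .
      have "?C \<subseteq> set ` L"
      proof
        fix Q assume "Q \<in> ?C"
        moreover from this obtain xs where "set xs = Q" "distinct xs"
          using finite_distinct_list[of Q] by (auto simp: cliques_def)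
        ultimately show "Q \<in> set ` L" by (auto simp: L_def)
      qed
      then have CL: "card ?C \<le> card L" by (rule surj_card_le[OF finL])
      have "0 \<le> \<eta> * real (card X) ^ m" using assms(3) by simp
      then have Lne: "L \<noteq> {}" using CL big by auto
      let ?I = "{..<m} \<times> {..<m}"
      define pat where "pat xs = restrict (\<lambda>(i,j). dist (xs ! i) (xs ! j)) ?I" for xs :: "'a list"
      have "pat ` L \<subseteq> (?I \<rightarrow>\<^sub>E insert 0 S)"
      proof
        fix p assume "p \<in> pat ` L"
        then obtain xs where xs: "xs \<in> L" "p = pat xs" by blast
        then have len: "length xs = m" using Ll by blast
        have "dist (xs ! i) (xs ! j) \<in> insert 0 S" if "i < m" "j < m" for i j
        proof (cases "xs ! i = xs ! j")
          case False
          then show ?thesis using xs that len by (auto simp: L_def cliques_def pairwise_def)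
        qed simp
        then show "p \<in> (?I \<rightarrow>\<^sub>E insert 0 S)" unfolding xs(2) pat_def restrict_PiE_iff by (auto simp del: insert_iff)
      qed
      then have "card (pat ` L) \<le> card (?I \<rightarrow>\<^sub>E insert 0 S)"
        using S by (intro card_mono finite_PiE) auto
      also have "\<dots> = card (insert 0 S) ^ (m * m)" by (simp add: card_PiE)
      also have "\<dots> \<le> (K + 1) ^ (m * m)"
        using S by (intro power_mono) (auto simp: card_insert_if)
      finally have "real (card (pat ` L)) \<le> M" unfolding M_def of_nat_le_iff .
      from pigeonhole_fibre[OF finL Lne this]
      obtain p where p: "real (card L) \<le> M * real (card {xs \<in> L. pat xs = p})" ..
      define Lp where "Lp = {xs \<in> L. pat xs = p}"
      have "\<eta> * real (card X) ^ m \<le> M * real (card Lp)" using big CL p by (simp add: Lp_def)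
      then have "\<eta> / M * real (card X) ^ m \<le> real (card Lp)" using M by (simp add: field_simps)
      moreover have "Lp \<subseteq> {xs. set xs \<subseteq> X \<and> length xs = m}" using Ll by (auto simp: Lp_def)
      ultimately obtain Bs where Bs: "length Bs = m" "\<forall>B\<in>set Bs. B \<subseteq> X \<and> card B = 3"
        "\<forall>xs. list_all2 (\<in>) xs Bs \<longrightarrow> xs \<in> Lp"
        using n0 X by meson
      have c3: "card (Bs ! i) = 3" if "i < m" for i using Bs(1,2) that by simp
      have pd: "dist x y = p (i,j)" if ij: "i < m" "j < m" "i \<noteq> j" "x \<in> Bs ! i" "y \<in> Bs ! j" for i j x y
      proof -
        \<comment> \<open>A list through the box with \<open>x\<close> and \<open>y\<close> at
          positions \<open>i\<close> and \<open>j\<close> and arbitrary members elsewhere; its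
          matrix is \<open>p\<close>, which fixes \<open>dist x y\<close>.\<close>
        define xs where "xs = (map (\<lambda>u. SOME z. z \<in> Bs ! u) [0..<m])[i := x, j := y]"
        have len: "length xs = m" by (simp add: xs_def)
        have "xs ! u \<in> Bs ! u" if "u < m" for u
        proof -
          have "Bs ! u \<noteq> {}" using c3[OF that] by auto
          then have "(SOME z. z \<in> Bs ! u) \<in> Bs ! u" by (simp add: some_in_eq)
          then show ?thesis using that ij by (auto simp: xs_def nth_list_update)
        qed
        then have "list_all2 (\<in>) xs Bs" using Bs(1) len by (simp add: list_all2_conv_all_nth)
        then have "pat xs = p" using Bs(3) by (simp add: Lp_def)
        then have "dist (xs ! i) (xs ! j) = p (i,j)" using ij by (auto simp: pat_def)
        moreover have "xs ! i = x" "xs ! j = y" using ij by (simp_all add: xs_def nth_list_update)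
        ultimately show ?thesis by simp
      qed
      show False
        by (rule no_equidistant_triples[OF DIM m, of "\<lambda>i. Bs ! i"]) (use c3 pd in simp_all)
    qed
  qed
qed

section \<open>Frequent distances\<close>

abbreviation same_dist :: "real \<Rightarrow> 'a::euclidean_space \<Rightarrow> 'a \<Rightarrow> bool" where
  "same_dist s \<equiv> \<lambda>x y. dist x y = s"

abbreviation dist_in :: "real set \<Rightarrow> 'a::euclidean_space \<Rightarrow> 'a \<Rightarrow> bool" where
  "dist_in S \<equiv> \<lambda>x y. dist x y \<in> S"

lemma fin_graph_dist_in:
  assumes "finite X" "0 \<notin> S"
  shows "fin_graph X (dist_in S)"
  by unfold_locales (use assms in \<open>auto simp: dist_commute\<close>)

lemma fin_graph_same_dist:
  assumes "finite X" "s \<noteq> 0"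
  shows "fin_graph X (same_dist s)"
  by unfold_locales (use assms in \<open>auto simp: dist_commute\<close>)

lemma same_dist_cliques_disjoint:
  fixes X :: "'a::euclidean_space set"
  assumes "2 \<le> m" "s \<noteq> s'"
  shows "cliques (same_dist s) X m \<inter> cliques (same_dist s') X m = {}"
proof (rule ccontr)
  assume "\<not> ?thesis"
  then obtain Q :: "'a set" where Q: "card Q = m" "pairwise (same_dist s) Q" "pairwise (same_dist s') Q"
    by (auto simp: cliques_def)
  then obtain x y where "x \<in> Q" "y \<in> Q" "x \<noteq> y" using assms(1) card_le_Suc0_iff_eq[of Q]
    by (metis One_nat_def Suc_1 card.infinite not_less_eq_eq not_numeral_le_zero)
  then show False using Q assms(2) by (auto simp: pairwise_def)
qed

text \<open>For pairs there is equality, because two points determine their distance. This is the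
  link by which the union graph controls the sum over distances.\<close>

lemma sum_card_same_dist_cliques:
  fixes X :: "'a::euclidean_space set"
  assumes X: "finite X" and S: "finite S" "0 \<notin> S" and m: "2 \<le> m"
  shows "(\<Sum>s\<in>S. card (cliques (same_dist s) X m)) \<le> card (cliques (dist_in S) X m)"
    and "m = 2 \<Longrightarrow> (\<Sum>s\<in>S. card (cliques (same_dist s) X m)) = card (cliques (dist_in S) X m)"
proof -
  have fin: "finite (cliques (dist_in S) X m)"
    using fin_graph.finite_cliques[OF fin_graph_dist_in[OF X S(2)]] .
  have fin1: "finite (cliques (same_dist s) X m)" if "s \<in> S" for s
    using fin_graph.finite_cliques[OF fin_graph_same_dist[OF X]] that S(2) by metis
  have eq: "(\<Sum>s\<in>S. card (cliques (same_dist s) X m)) = card (\<Union>s\<in>S. cliques (same_dist s) X m)"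
    by (rule card_UN_disjoint[symmetric]) (use S fin1 same_dist_cliques_disjoint[OF m] in blast)+
  have sub: "(\<Union>s\<in>S. cliques (same_dist s) X m) \<subseteq> cliques (dist_in S) X m"
    by (auto simp: cliques_def pairwise_def)
  show "(\<Sum>s\<in>S. card (cliques (same_dist s) X m)) \<le> card (cliques (dist_in S) X m)"
    unfolding eq by (rule card_mono[OF fin sub])
  assume m2: "m = 2"
  have "cliques (dist_in S) X m \<subseteq> (\<Union>s\<in>S. cliques (same_dist s) X m)"
  proof
    fix Q assume Q: "Q \<in> cliques (dist_in S) X m"
    then have "card Q = 2" by (simp add: cliques_def m2)
    then obtain x y where "Q = {x,y}" "x \<noteq> y" by (auto simp: card_2_iff)
    then have "dist x y \<in> S" "Q \<in> cliques (same_dist (dist x y)) X m"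
      using Q by (auto simp: cliques_def pairwise_def dist_commute)
    then show "Q \<in> (\<Union>s\<in>S. cliques (same_dist s) X m)" by blast
  qed
  then show "(\<Sum>s\<in>S. card (cliques (same_dist s) X m)) = card (cliques (dist_in S) X m)"
    unfolding eq using sub by (simp add: subset_antisym)
qed

text \<open>A distance is frequent if at least \<open>\<eta> * n ^ 2\<close> ordered pairs realise
  it, so there are at most \<open>1 / \<eta>\<close> of them. A rare one with \<open>d\<close> pairs
  has at most \<open>d ^ (3/2)\<close> \<le> \<open>sqrt \<eta> * n * d\<close> triangles; extending
  these to \<open>k\<close>-cliques and summing \<open>d\<close> over all distances gives the error
  term.\<close>

lemma frequent_distances:
  fixes X :: "'a::euclidean_space set" and \<eta> :: real
  assumes X: "finite X" "X \<noteq> {}" and \<eta>: "\<eta> > 0" and k: "3 \<le> k"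
  shows "\<exists>S. finite S \<and> 0 \<notin> S \<and> \<eta> * real (card S) \<le> 1 \<and>
    real (simplex_count k X) \<le> (\<Sum>s\<in>S. real (card (cliques (same_dist s) X k))) + sqrt \<eta> * real (card X) ^ k"
proof -
  define n where "n = real (card X)"
  have n: "n > 0" using X by (simp add: n_def card_gt_0_iff)
  define D where "D s = {(x,y) \<in> X \<times> X. dist x y = s}" for s
  have finD: "finite (D s)" for s by (rule finite_subset[of _ "X \<times> X"]) (use X in \<open>auto simp: D_def\<close>)
  define C where "C = (\<lambda>(x,y). dist x y) ` (X \<times> X) - {0}"
  have finC: "finite C" using X by (simp add: C_def)
  define S where "S = {s \<in> C. \<eta> * n\<^sup>2 \<le> real (card (D s))}"
  have SC: "S \<subseteq> C" "finite S" "0 \<notin> S" using finC by (auto simp: S_def C_def)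
  have "(\<Sum>s\<in>C. card (D s)) = card (\<Union>s\<in>C. D s)"
    by (rule card_UN_disjoint[symmetric]) (use finC finD in \<open>auto simp: D_def\<close>)
  also have "\<dots> \<le> card (X \<times> X)" using X by (intro card_mono) (auto simp: D_def)
  finally have "real (\<Sum>s\<in>C. card (D s)) \<le> real (card (X \<times> X))" unfolding of_nat_le_iff .
  then have sumC: "(\<Sum>s\<in>C. real (card (D s))) \<le> n\<^sup>2"
    by (simp add: card_cartesian_product n_def power2_eq_square)
  have "real (card S) * (\<eta> * n\<^sup>2) = (\<Sum>s\<in>S. \<eta> * n\<^sup>2)" by simp
  also have "\<dots> \<le> (\<Sum>s\<in>S. real (card (D s)))" by (rule sum_mono) (simp add: S_def)
  also have "\<dots> \<le> (\<Sum>s\<in>C. real (card (D s)))" by (rule sum_mono2[OF finC SC(1)]) simp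
  also have "\<dots> \<le> n\<^sup>2" by (rule sumC)
  finally have "(\<eta> * real (card S)) * n\<^sup>2 \<le> 1 * n\<^sup>2" by (simp add: mult_ac)
  then have cS: "\<eta> * real (card S) \<le> 1" using n by simp
  have rare: "real (card (cliques (same_dist s) X k)) \<le> sqrt \<eta> * n ^ (k - 2) * real (card (D s))"
    if s: "s \<in> C - S" for s
  proof -
    interpret fin_graph X "same_dist s" using s X by (intro fin_graph_same_dist) (auto simp: C_def)
    let ?d = "real (card (D s))"
    have d: "?d < \<eta> * n\<^sup>2" using s by (auto simp: S_def)
    have "real (card (cliques (same_dist s) X 3)) ^ 2 \<le> ?d ^ 3"
      by (rule card_triangles_sq_le) (auto simp: D_def)
    also have "\<dots> = ?d\<^sup>2 * ?d" by (simp add: power3_eq_cube power2_eq_square)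
    also have "\<dots> \<le> ?d\<^sup>2 * (\<eta> * n\<^sup>2)" using d by (intro mult_left_mono) auto
    also have "\<dots> = (sqrt \<eta> * n * ?d)\<^sup>2" using \<eta> by (simp add: power_mult_distrib)
    finally have tri: "real (card (cliques (same_dist s) X 3)) \<le> sqrt \<eta> * n * ?d"
      by (rule power2_le_imp_le) (use \<eta> n in simp)
    have "card (cliques (same_dist s) X (3 + (k - 3))) \<le> card X ^ (k - 3) * card (cliques (same_dist s) X 3)"
      by (rule card_cliques_add_le)
    then have "real (card (cliques (same_dist s) X k)) \<le> real (card X ^ (k - 3) * card (cliques (same_dist s) X 3))"
      unfolding of_nat_le_iff using k by simp
    also have "\<dots> = n ^ (k - 3) * real (card (cliques (same_dist s) X 3))" by (simp add: n_def)
    also have "\<dots> \<le> n ^ (k - 3) * (sqrt \<eta> * n * ?d)" using tri n by (intro mult_left_mono) auto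
    also have "\<dots> = sqrt \<eta> * n ^ Suc (k - 3) * ?d" by simp
    also have "Suc (k - 3) = k - 2" using k by simp
    finally show ?thesis .
  qed
  have finK: "finite (cliques (same_dist s) X k)" if "s \<in> C" for s
    using fin_graph.finite_cliques[OF fin_graph_same_dist[OF X(1)]] that unfolding C_def by blast
  have "{\<Delta>. \<Delta> \<subseteq> X \<and> regular_simplex k \<Delta>} \<subseteq> (\<Union>s\<in>C. cliques (same_dist s) X k)"
  proof
    fix \<Delta> assume "\<Delta> \<in> {\<Delta>. \<Delta> \<subseteq> X \<and> regular_simplex k \<Delta>}"
    then obtain s where s: "\<Delta> \<subseteq> X" "finite \<Delta>" "card \<Delta> = k" "pairwise (same_dist s) \<Delta>"
      by (auto simp: regular_simplex_def)
    then obtain x y where xy: "x \<in> \<Delta>" "y \<in> \<Delta>" "x \<noteq> y"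
      using k card_le_Suc0_iff_eq[of \<Delta>] by fastforce
    then have "s = dist x y" using s(4) by (simp add: pairwise_def)
    then have "s \<in> C" using xy s(1) by (auto simp: C_def image_iff)
    then show "\<Delta> \<in> (\<Union>s\<in>C. cliques (same_dist s) X k)" using s by (auto simp: cliques_def)
  qed
  then have "simplex_count k X \<le> card (\<Union>s\<in>C. cliques (same_dist s) X k)"
    unfolding simplex_count_def using finC finK by (intro card_mono) auto
  also have "\<dots> \<le> (\<Sum>s\<in>C. card (cliques (same_dist s) X k))" by (rule card_UN_le[OF finC])
  finally have "real (simplex_count k X) \<le> real (\<Sum>s\<in>C. card (cliques (same_dist s) X k))" unfolding of_nat_le_iff .
  also have "\<dots> = (\<Sum>s\<in>C. real (card (cliques (same_dist s) X k)))" by simp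
  also have "\<dots> = (\<Sum>s\<in>C - S. real (card (cliques (same_dist s) X k)))
      + (\<Sum>s\<in>S. real (card (cliques (same_dist s) X k)))"
    by (rule sum.subset_diff[OF SC(1) finC])
  also have "(\<Sum>s\<in>C - S. real (card (cliques (same_dist s) X k)))
      \<le> (\<Sum>s\<in>C - S. sqrt \<eta> * n ^ (k - 2) * real (card (D s)))" by (rule sum_mono[OF rare])
  also have "\<dots> \<le> (\<Sum>s\<in>C. sqrt \<eta> * n ^ (k - 2) * real (card (D s)))"
    using finC \<eta> n by (intro sum_mono2) auto
  also have "\<dots> = sqrt \<eta> * n ^ (k - 2) * (\<Sum>s\<in>C. real (card (D s)))" by (simp add: sum_distrib_left)
  also have "\<dots> \<le> sqrt \<eta> * n ^ (k - 2) * n\<^sup>2" using sumC \<eta> n by (intro mult_left_mono) auto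
  also have "\<dots> = sqrt \<eta> * n ^ k"
  proof -
    have "n ^ (k - 2) * n\<^sup>2 = n ^ (k - 2 + 2)" by (rule power_add[symmetric])
    also have "k - 2 + 2 = k" using k by simp
    finally show ?thesis by (simp only: mult.assoc)
  qed
  finally have "real (simplex_count k X) \<le> (\<Sum>s\<in>S. real (card (cliques (same_dist s) X k))) + sqrt \<eta> * real (card X) ^ k"
    by (simp add: n_def)
  then show ?thesis using SC cS by blast
qed

text \<open>An averaging argument over all \<open>r\<close>-cliques with a single distance from
  \<open>S\<close>. Near-maximality at \<open>k\<close> is transported to \<open>r\<close>, where it
  shows both that there are many such cliques and that the defect, hence the total irregularity, is
  small.\<close>

lemma regular_clique_exists:
  fixes X :: "'a::euclidean_space set" and \<delta> \<eta> \<theta> :: real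
  assumes X: "finite X" "X \<noteq> {}" and S: "finite S" "0 \<notin> S" and k: "3 \<le> k" "k \<le> r"
    and few: "real (card (cliques (dist_in S) X (Suc r))) \<le> \<eta> * real (card X) ^ Suc r"
    and many: "(1 - \<delta>) * (real (r choose k) * (real (card X) / real r) ^ k)
      \<le> (\<Sum>s\<in>S. real (card (cliques (same_dist s) X k)))"
    and pos: "\<delta> \<ge> 0" "\<eta> > 0" "\<theta> > 0"
  defines "\<tau> \<equiv> real r ^ (2 * r) * (\<delta> + (real r + 1) * (real r ^ 2 * real r ^ r * \<eta>))"
  assumes half: "\<delta> + real r * \<tau> \<le> 1 / 2"
  shows "\<exists>s\<in>S. \<exists>Q\<in>cliques (same_dist s) X r. irregularity (same_dist s) X r (\<theta> * real (card X)) Q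
    \<le> (2 + real r / \<theta>) * (\<tau> + 3 * real r ^ 2 * \<eta>) * (4 * real r ^ r) * real (card X)"
proof -
  define n where "n = real (card X)"
  have cX: "card X > 0" using X by (simp add: card_gt_0_iff)
  have n: "n > 0" using cX by (simp add: n_def)
  have r: "3 \<le> r" using k by simp
  define N where "N t = (\<Sum>s\<in>S. real (card (cliques (same_dist s) X t)))" for t
  define Nh where "Nh t = real (card (cliques (dist_in S) X t))" for t
  define y where "y = turan_ratio r n N"
  define yh where "yh = turan_ratio r n Nh"
  interpret H: fin_graph X "dist_in S" by (rule fin_graph_dist_in[OF X(1) S(2)])
  have g: "fin_graph X (same_dist s)" if "s \<in> S" for s
    using fin_graph_same_dist[OF X(1)] that S(2) by metis
  let ?dev = "\<lambda>a t. \<Sum>s\<in>S. \<Sum>P\<in>cliques (same_dist s) X t. (real (card (extenders (same_dist s) X P)) - a)\<^sup>2"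
  let ?far = "\<lambda>t. \<Sum>s\<in>S. \<Sum>Q\<in>cliques (same_dist s) X t. real (card (far_vertices (same_dist s) X Q))"
  have defect: "?dev a t + ?far (Suc t) = n * N (Suc t) + real t * (real t + 2) * N (Suc (Suc t))
      - 2 * a * (real t + 1) * N (Suc t) + a\<^sup>2 * N t" for a t
  proof -
    have "?dev a t + ?far (Suc t) = (\<Sum>s\<in>S. n * real (card (cliques (same_dist s) X (Suc t)))
      + real t * (real t + 2) * real (card (cliques (same_dist s) X (Suc (Suc t))))
      - 2 * a * (real t + 1) * real (card (cliques (same_dist s) X (Suc t)))
      + a\<^sup>2 * real (card (cliques (same_dist s) X t)))"
      unfolding sum.distrib[symmetric] n_def by (rule sum.cong) (auto simp: fin_graph.clique_defect[OF g])
    then show ?thesis by (simp add: N_def sum.distrib sum_subtractf sum_distrib_left)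
  qed
  have nonneg: "0 \<le> ?dev a t" "0 \<le> ?far t" for a t by (auto intro!: sum_nonneg)
  have ineq: "0 \<le> n * N (Suc t) + real t * (real t + 2) * N (Suc (Suc t))
      - 2 * a * (real t + 1) * N (Suc t) + a\<^sup>2 * N t" for a t
    unfolding defect[symmetric] using nonneg by (rule add_nonneg_nonneg)
  have ineqh: "0 \<le> n * Nh (Suc t) + real t * (real t + 2) * Nh (Suc (Suc t))
      - 2 * a * (real t + 1) * Nh (Suc t) + a\<^sup>2 * Nh t" for a t
    unfolding Nh_def n_def H.clique_defect[symmetric] by (intro add_nonneg_nonneg sum_nonneg) auto
  have NNh: "N m \<le> Nh m" if "2 \<le> m" for m
  proof -
    have "real (\<Sum>s\<in>S. card (cliques (same_dist s) X m)) \<le> Nh m"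
      unfolding Nh_def of_nat_le_iff by (rule sum_card_same_dist_cliques(1)[OF X(1) S that])
    then show ?thesis by (simp add: N_def)
  qed
  have N2: "N 2 = Nh 2"
  proof -
    have "real (\<Sum>s\<in>S. card (cliques (same_dist s) X 2)) = Nh 2"
      unfolding Nh_def of_nat_eq_iff by (rule sum_card_same_dist_cliques(2)[OF X(1) S]) auto
    then show ?thesis by (simp add: N_def)
  qed
  have N0: "0 \<le> N t" for t by (auto simp: N_def intro!: sum_nonneg)
  have Nh0: "0 \<le> Nh t" for t by (simp add: Nh_def)
  define e where "e = real r ^ 2 * real r ^ r * \<eta>"
  have e0: "0 \<le> e" using pos by (simp add: e_def)
  have top: "(real r ^ 2 - 1) * real r ^ r * z / n ^ Suc r \<le> e" if "0 \<le> z" "z \<le> \<eta> * n ^ Suc r" for z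
  proof -
    have "(real r ^ 2 - 1) * real r ^ r * z \<le> real r ^ 2 * real r ^ r * (\<eta> * n ^ Suc r)"
      using that r by (intro mult_mono) (auto simp: power2_eq_square)
    then show ?thesis using n by (simp add: e_def pos_divide_le_eq mult.assoc)
  qed
  have Nhr: "Nh (Suc r) \<le> \<eta> * n ^ Suc r" using few by (simp add: Nh_def n_def)
  then have Nr: "N (Suc r) \<le> \<eta> * n ^ Suc r" using NNh[of "Suc r"] r by simp
  note steph = turan_ratio_step[where r = r, OF n _ ineqh, folded yh_def]
  note step = turan_ratio_step[where r = r, OF n _ ineq, folded y_def]
  have lasth: "yh r - yh (r - 1) \<le> e"
    using steph(2)[of "r - 1"] r top[OF _ Nhr] Nh0[of "Suc r"] by simp
  have last: "y r - y (r - 1) \<le> e"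
    using step(2)[of "r - 1"] r top[OF N0 Nr] by simp
  \<comment> \<open>Single points are counted once in the union graph, which anchors
    \<open>yh\<close> at 1; the bound on \<open>yh 2\<close> is then handed over to
    \<open>y 2\<close>.\<close>
  have "cliques (dist_in S) X 1 = (\<lambda>x. {x}) ` X"
    by (auto simp: cliques_def card_1_singleton_iff)
  then have "Nh 1 = n" by (simp add: Nh_def n_def card_image)
  then have yh1: "yh 1 = 1" using n r by (simp add: yh_def turan_ratio_def)
  have "yh (Suc 1) - yh 1 \<le> e"
  proof (rule differences_bounded_above[where r = r and ?t0.0 = 1 and D = "\<lambda>t. yh (Suc t) - yh t"])
    show "yh (Suc (r - 1)) - yh (r - 1) \<le> e" using lasth r by simp
  qed (use steph(1) e0 r in auto)
  then have "yh 2 \<le> 1 + e" using yh1 by (simp add: numeral_2_eq_2)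
  then have y2: "y 2 \<le> 1 + e" by (simp add: y_def yh_def turan_ratio_def N2)
  have yk: "1 - \<delta> \<le> y k"
  proof -
    have c: "0 < real (r choose k) * (n / real r) ^ k" using k r n by simp
    have "y k = N k / (real (r choose k) * (n / real r) ^ k)"
      by (simp add: y_def turan_ratio_def power_divide)
    then show ?thesis using many c by (simp add: pos_le_divide_eq N_def n_def)
  qed
  have \<tau>: "\<tau> = real r ^ (2 * r) * (\<delta> + (real r + 1) * e)" by (simp add: \<tau>_def e_def)
  have sd: "- \<tau> \<le> y r - y (r - 1)" "1 - \<delta> - real r * \<tau> \<le> y r"
    unfolding \<tau> by (rule stable_differences[OF _ last e0 y2 yk k pos(1)], use step(1) in simp)+
  have yr: "y r = N r * real r ^ r / n ^ r" by (simp add: y_def turan_ratio_def)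
  have "1 / 2 \<le> y r" using sd(2) half by simp
  then have Nrlow: "n ^ r \<le> 2 * real r ^ r * N r" using n unfolding yr by (simp add: field_simps)
  obtain t where t: "r = Suc t" using r by (cases r) auto
  have t1: "y t = N t * real r ^ t / (real r * n ^ t)"
    using binomial_symmetric[of t r] by (simp add: y_def turan_ratio_def t)
  let ?a = "n / real r"
  define K where "K = n ^ Suc r / real r ^ r"
  have p: "n ^ Suc r = n * n * n ^ t" "real r ^ r = real r * real r ^ t"
    using power_Suc[of "real r" t] by (simp_all only: t power_Suc mult.assoc)
  have aN: "?a\<^sup>2 * N t = K * y t"
    unfolding t1 K_def p using n r by (simp add: power2_eq_square)
  have nN: "n * N r = K * y r"
    unfolding yr K_def using n r by simp
  \<comment> \<open>For \<open>t = r - 1\<close> and \<open>a = n / r\<close> the terms in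
    \<open>N r\<close> combine to \<open>- n * N r\<close>, so the defect is a multiple of
    \<open>y t - y r\<close>, small by stability, plus a term in the rare cliques of size
    \<open>Suc r\<close>.\<close>
  have "?dev ?a t + ?far r = n * N r + real t * (real t + 2) * N (Suc r) - 2 * (n * N r) + ?a\<^sup>2 * N t"
    unfolding t defect using r t by (simp add: add.commute)
  then have "?dev ?a t + ?far r = K * (y t - y r) + real t * (real t + 2) * N (Suc r)"
    unfolding aN nN right_diff_distrib by linarith
  also have "\<dots> \<le> n ^ Suc r * \<tau> + real r ^ 2 * (\<eta> * n ^ Suc r)"
  proof (rule add_mono)
    have rr: "1 \<le> real r ^ r" using r by simp
    have \<tau>0: "0 \<le> \<tau>" using pos by (simp add: \<tau>_def)
    have "K * (y t - y r) \<le> n ^ Suc r / real r ^ r * \<tau>"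
      unfolding K_def using sd(1) n by (intro mult_left_mono) (auto simp: t)
    also have "\<dots> \<le> n ^ Suc r * \<tau>"
    proof (rule mult_right_mono[OF _ \<tau>0])
      have "n ^ Suc r / real r ^ r \<le> n ^ Suc r / 1" using n rr by (intro divide_left_mono) auto
      then show "n ^ Suc r / real r ^ r \<le> n ^ Suc r" by simp
    qed
    finally show "K * (y t - y r) \<le> n ^ Suc r * \<tau>" .
    have "real t * (real t + 2) \<le> real r ^ 2" by (simp add: t power2_eq_square algebra_simps)
    then show "real t * (real t + 2) * N (Suc r) \<le> real r ^ 2 * (\<eta> * n ^ Suc r)"
      using Nr N0 by (intro mult_mono) auto
  qed
  finally have DEF: "?dev ?a t + ?far r \<le> (\<tau> + real r ^ 2 * \<eta>) * n ^ Suc r" by (simp add: algebra_simps)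
  define b where "b = \<tau> + 3 * real r ^ 2 * \<eta>"
  have b: "0 < b" "\<tau> + real r ^ 2 * \<eta> \<le> b"
    using pos r by (auto simp: b_def \<tau>_def intro!: add_nonneg_pos mult_nonneg_nonneg add_nonneg_nonneg)
  let ?irr = "\<lambda>s. irregularity (same_dist s) X r (\<theta> * n)"
  have "(\<Sum>s\<in>S. \<Sum>Q\<in>cliques (same_dist s) X r. ?irr s Q) \<le>
      (\<Sum>s\<in>S. (real t + 2) * real (card (cliques (same_dist s) X (Suc r)))
      + real r * n / (\<theta> * n) * (\<Sum>Q\<in>cliques (same_dist s) X r. real (card (far_vertices (same_dist s) X Q)))
      + (\<Sum>P\<in>cliques (same_dist s) X t. (real (card (extenders (same_dist s) X P)) - n / real r)\<^sup>2))"
  proof (rule sum_mono)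
    fix s assume "s \<in> S"
    have "0 < \<theta> * n" using pos n by simp
    from fin_graph.sum_irregularity[OF g[OF \<open>s \<in> S\<close>] this cX, of t]
    show "(\<Sum>Q\<in>cliques (same_dist s) X r. ?irr s Q) \<le>
      (real t + 2) * real (card (cliques (same_dist s) X (Suc r)))
      + real r * n / (\<theta> * n) * (\<Sum>Q\<in>cliques (same_dist s) X r. real (card (far_vertices (same_dist s) X Q)))
      + (\<Sum>P\<in>cliques (same_dist s) X t. (real (card (extenders (same_dist s) X P)) - n / real r)\<^sup>2)"
      by (simp only: t n_def)
  qed
  also have "\<dots> = (real t + 2) * N (Suc r) + real r / \<theta> * ?far r + ?dev ?a t"
    using n by (simp add: sum.distrib sum_distrib_left N_def)
  also have "\<dots> \<le> b * n ^ Suc r + real r / \<theta> * (b * n ^ Suc r) + b * n ^ Suc r"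
  proof (intro add_mono mult_left_mono)
    have le: "(\<tau> + real r ^ 2 * \<eta>) * n ^ Suc r \<le> b * n ^ Suc r" using b n by (intro mult_right_mono) auto
    show "?far r \<le> b * n ^ Suc r" "?dev ?a t \<le> b * n ^ Suc r"
      using le DEF nonneg(1)[of ?a t] nonneg(2)[of r] by linarith+
    have "(real t + 2) * N (Suc r) \<le> (real t + 2) * (\<eta> * n ^ Suc r)" using Nr by (intro mult_left_mono) auto
    also have "\<dots> = (real t + 2) * \<eta> * n ^ Suc r" by simp
    also have "\<dots> \<le> b * n ^ Suc r"
    proof (intro mult_right_mono)
      have "real t + 2 \<le> 3 * real r ^ 2" by (simp add: t power2_eq_square algebra_simps)
      then have "(real t + 2) * \<eta> \<le> 3 * real r ^ 2 * \<eta>" using pos by (intro mult_right_mono) auto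
      moreover have "0 \<le> \<tau>" using pos by (simp add: \<tau>_def)
      ultimately show "(real t + 2) * \<eta> \<le> b" by (simp add: b_def)
    qed (use n in simp)
    finally show "(real t + 2) * N (Suc r) \<le> b * n ^ Suc r" .
  qed (use pos in simp)
  also have "\<dots> = (2 + real r / \<theta>) * b * n ^ Suc r" by (simp add: algebra_simps)
  finally have total: "(\<Sum>s\<in>S. \<Sum>Q\<in>cliques (same_dist s) X r. ?irr s Q) \<le> (2 + real r / \<theta>) * b * n ^ Suc r" .
  \<comment> \<open>There are at least \<open>n ^ r / (2 * r ^ r)\<close> cliques. The factor 4
    instead of 2 makes the bound twice the average, so that not all cliques can exceed it.\<close>
  define \<Omega> where "\<Omega> = (2 + real r / \<theta>) * b * (4 * real r ^ r)"
  have \<Omega>b: "0 < (2 + real r / \<theta>) * b" using b pos by (intro mult_pos_pos add_pos_nonneg) auto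
  have "\<exists>s\<in>S. \<exists>Q\<in>cliques (same_dist s) X r. ?irr s Q \<le> \<Omega> * n"
  proof (rule ccontr)
    assume "\<not> ?thesis"
    then have "\<Omega> * n \<le> ?irr s Q" if "s \<in> S" "Q \<in> cliques (same_dist s) X r" for s Q
      using that by (meson linear)
    then have "(\<Sum>s\<in>S. \<Sum>Q\<in>cliques (same_dist s) X r. \<Omega> * n) \<le> (\<Sum>s\<in>S. \<Sum>Q\<in>cliques (same_dist s) X r. ?irr s Q)"
      by (intro sum_mono)
    then have "N r * (\<Omega> * n) \<le> (2 + real r / \<theta>) * b * n ^ Suc r"
      using total by (simp add: N_def sum_distrib_right)
    moreover have "2 * ((2 + real r / \<theta>) * b * n ^ Suc r) \<le> N r * (\<Omega> * n)"
    proof -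
      have "(2 + real r / \<theta>) * b * n * n ^ r \<le> (2 + real r / \<theta>) * b * n * (2 * real r ^ r * N r)"
        using Nrlow \<Omega>b n by (intro mult_left_mono) auto
      then show ?thesis by (simp add: \<Omega>_def mult_ac)
    qed
    moreover have "0 < (2 + real r / \<theta>) * b * n ^ Suc r" using \<Omega>b n by simp
    moreover have False if "x \<le> z" "2 * z \<le> x" "0 < z" for x z :: real using that by linarith
    ultimately show False by blast
  qed
  then show ?thesis by (simp add: \<Omega>_def b_def n_def)
qed

section \<open>Stability\<close>

lemma near_extremal_clique:
  fixes \<theta> \<omega> :: real
  assumes k: "3 \<le> k" "k \<le> r" and DIM: "DIM('a::euclidean_space) = 2 * r + 1"
    and pos: "\<theta> > 0" "\<omega> > 0"
  shows "\<exists>\<delta>>0. \<exists>n0>0. \<forall>X :: 'a set. finite X \<longrightarrow> card X \<ge> n0 \<longrightarrow>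
    real (simplex_count k X) \<ge> real (max_simplex_count TYPE('a) k (card X)) - \<delta> * real (card X) ^ k \<longrightarrow>
    (\<exists>s Q. s \<noteq> 0 \<and> Q \<in> cliques (same_dist s) X r \<and>
      irregularity (same_dist s) X r (\<theta> * real (card X)) Q \<le> \<omega> * real (card X))"
proof -
  have r: "3 \<le> r" using k by simp
  define R where "R = real r ^ (2 * r)"
  define b where "b = (2 + real r / \<theta>) * (4 * real r ^ r)"
  \<comment> \<open>\<open>\<mu>\<close> is the budget for \<open>\<tau>\<close>: its first bound
    pays half of \<omega>, its second keeps \<open>d + r * \<tau>\<close> below 1/2. The choices of
    \<open>d\<close> and \<open>\<eta>2\<close> let each contribute at most \<open>\<mu> / 2\<close>
    to \<open>\<tau>\<close>; the other bound in \<open>\<eta>2\<close> pays the second half of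
    \<omega>.\<close>
  define \<mu> where "\<mu> = min (\<omega> / (2 * b)) (1 / (4 * real r))"
  define d where "d = \<mu> / (2 * R)"
  define q where "q = (real r + 1) * (real r ^ 2 * real r ^ r)"
  define \<eta>2 where "\<eta>2 = min (\<omega> / (6 * real r ^ 2 * b)) (\<mu> / (2 * R * q))"
  define T where "T = real (r choose k) / real r ^ k"
  \<comment> \<open>The relative loss \<open>d\<close> at size \<open>k\<close> is split into
    thirds: the deficit allowed by the hypothesis, the rare distances
    (\<open>sqrt \<eta> = \<delta>\<close>), and the error of the lower bound for the maximum,
    controlled by \<open>n2\<close>.\<close>
  define \<delta> where "\<delta> = d * T / 3"
  define \<eta> where "\<eta> = \<delta>\<^sup>2"
  have R: "1 \<le> R" using r by (simp add: R_def)
  have bp: "0 < b" using pos r by (auto simp: b_def intro!: mult_pos_pos add_pos_nonneg)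
  have \<mu>: "0 < \<mu>" using pos bp r by (simp add: \<mu>_def)
  have d: "0 < d" using \<mu> R by (simp add: d_def)
  have qp: "0 < q" using r by (simp add: q_def)
  have \<eta>2: "0 < \<eta>2" using pos bp \<mu> R qp r by (simp add: \<eta>2_def)
  have T: "0 < T" using k r by (simp add: T_def)
  have \<delta>: "0 < \<delta>" using d T by (simp add: \<delta>_def)
  have \<eta>: "0 < \<eta>" "sqrt \<eta> = \<delta>" using \<delta> by (simp_all add: \<eta>_def)
  have \<mu>r: "real r * \<mu> \<le> 1 / 4"
  proof -
    have "real r * \<mu> \<le> real r * (1 / (4 * real r))" by (intro mult_left_mono) (auto simp: \<mu>_def)
    then show ?thesis using r by simp
  qed
  have Rd: "R * d = \<mu> / 2" using R by (simp add: d_def)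
  have "d \<le> R * d" using R d by (simp add: mult_le_cancel_right1)
  moreover have "1 * \<mu> \<le> real r * \<mu>" using r \<mu> by (intro mult_right_mono) auto
  ultimately have dle: "d \<le> 1 / 4" using Rd \<mu>r \<mu> by linarith
  define \<tau> where "\<tau> = R * (d + q * \<eta>2)"
  have "R * q * \<eta>2 \<le> R * q * (\<mu> / (2 * R * q))"
    using R qp by (intro mult_left_mono) (auto simp: \<eta>2_def)
  also have "\<dots> = \<mu> / 2" using R qp by simp
  finally have \<tau>: "\<tau> \<le> \<mu>" using Rd by (simp add: \<tau>_def algebra_simps)
  have half: "d + real r * \<tau> \<le> 1 / 2"
    using dle \<mu>r mult_left_mono[OF \<tau>, of "real r"] by simp
  have small: "b * (\<tau> + 3 * real r ^ 2 * \<eta>2) \<le> \<omega>"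
  proof -
    have "b * \<tau> \<le> b * (\<omega> / (2 * b))" using \<tau> bp by (intro mult_left_mono) (auto simp: \<mu>_def)
    also have "\<dots> = \<omega> / 2" using bp by simp
    finally have 1: "b * \<tau> \<le> \<omega> / 2" .
    have "3 * real r ^ 2 * b * \<eta>2 \<le> 3 * real r ^ 2 * b * (\<omega> / (6 * real r ^ 2 * b))"
      using bp by (intro mult_left_mono) (auto simp: \<eta>2_def)
    also have "\<dots> = \<omega> / 2" using bp r by simp
    finally show ?thesis using 1 by (simp add: algebra_simps)
  qed
  have "DIM('a) < 2 * Suc r" "2 \<le> Suc r" using DIM r by simp_all
  from few_large_cliques[OF this \<eta>2, where K = "nat \<lfloor>1 / \<eta>\<rfloor>"]
  obtain n1 where n1: "\<forall>X :: 'a set. \<forall>S :: real set. finite X \<longrightarrow> card X \<ge> n1 \<longrightarrow> finite S \<longrightarrow>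
    card S \<le> nat \<lfloor>1 / \<eta>\<rfloor> \<longrightarrow>
    real (card (cliques (dist_in S) X (Suc r))) \<le> \<eta>2 * real (card X) ^ Suc r" ..
  obtain n2 where n2: "real n2 \<ge> 3 * real k * real r / d" using real_arch_simple by blast
  define n0 where "n0 = Suc (max n1 (max n2 r))"
  show ?thesis
  proof (rule exI[of _ \<delta>], rule conjI[OF \<delta>], rule exI[of _ n0], intro conjI allI impI)
    show "0 < n0" by (simp add: n0_def)
    fix X :: "'a set"
    assume X: "finite X" "n0 \<le> card X"
      and count: "real (max_simplex_count TYPE('a) k (card X)) - \<delta> * real (card X) ^ k \<le> real (simplex_count k X)"
    define n where "n = real (card X)"
    have n: "n > 0" "card X \<ge> n1" "n \<ge> 3 * real k * real r / d" "r \<le> card X" "X \<noteq> {}"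
      using X(2) n2 by (auto simp: n_def n0_def)
    obtain S where S: "finite S" "0 \<notin> S" "\<eta> * real (card S) \<le> 1"
      "real (simplex_count k X) \<le> (\<Sum>s\<in>S. real (card (cliques (same_dist s) X k))) + sqrt \<eta> * real (card X) ^ k"
      using frequent_distances[OF X(1) n(5) \<eta>(1) k(1)] by blast
    have "real (card S) \<le> 1 / \<eta>" using S(3) \<eta>(1) by (simp add: field_simps)
    then have "card S \<le> nat \<lfloor>1 / \<eta>\<rfloor>" by (simp add: le_nat_floor)
    then have few: "real (card (cliques (dist_in S) X (Suc r))) \<le> \<eta>2 * real (card X) ^ Suc r"
      using n1 X(1) n(2) S(1) by blast
    have turan: "real (r choose k) * (n / real r) ^ k = T * n ^ k"
      by (simp add: T_def power_divide)
    have "T * n ^ k * (1 - real k * real r / n) \<le> real (max_simplex_count TYPE('a) k (card X))"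
      using max_simplex_count_lower[where 'a = 'a, of r "card X" k] DIM r n(4)
      unfolding n_def[symmetric] turan by simp
    then have "T * n ^ k * (1 - real k * real r / n) - \<delta> * n ^ k - \<delta> * n ^ k
        \<le> (\<Sum>s\<in>S. real (card (cliques (same_dist s) X k)))"
      using S(4) count unfolding \<eta>(2) n_def[symmetric] by linarith
    moreover have "(1 - d) * (T * n ^ k) \<le> T * n ^ k * (1 - real k * real r / n) - \<delta> * n ^ k - \<delta> * n ^ k"
    proof -
      have "real k * real r / n \<le> d / 3" using n(1,3) d by (simp add: field_simps)
      then have "T * n ^ k * (real k * real r / n) \<le> T * n ^ k * (d / 3)"
        using T n by (intro mult_left_mono) auto
      then show ?thesis by (simp add: \<delta>_def algebra_simps)
    qed
    ultimately have many: "(1 - d) * (real (r choose k) * (real (card X) / real r) ^ k)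
        \<le> (\<Sum>s\<in>S. real (card (cliques (same_dist s) X k)))"
      unfolding n_def[symmetric] turan by linarith
    have \<tau>': "real r ^ (2 * r) * (d + (real r + 1) * (real r ^ 2 * real r ^ r * \<eta>2)) = \<tau>"
      by (simp add: \<tau>_def R_def q_def mult.assoc)
    have d0: "0 \<le> d" using d by simp
    obtain s Q where sQ: "s \<in> S" "Q \<in> cliques (same_dist s) X r"
      "irregularity (same_dist s) X r (\<theta> * n) Q \<le> (2 + real r / \<theta>) * (\<tau> + 3 * real r ^ 2 * \<eta>2) * (4 * real r ^ r) * n"
      using regular_clique_exists[OF X(1) n(5) S(1,2) k few many d0 \<eta>2 pos(1), unfolded \<tau>', OF half]
      unfolding n_def by blast
    have "(2 + real r / \<theta>) * (\<tau> + 3 * real r ^ 2 * \<eta>2) * (4 * real r ^ r) * n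
        = b * (\<tau> + 3 * real r ^ 2 * \<eta>2) * n" by (simp add: b_def mult_ac)
    also have "\<dots> \<le> \<omega> * n" using small n by (intro mult_right_mono) auto
    finally have "irregularity (same_dist s) X r (\<theta> * n) Q \<le> \<omega> * n" using sQ(3) by simp
    moreover have "s \<noteq> 0" using sQ(1) S(2) by metis
    ultimately show "\<exists>s Q. s \<noteq> 0 \<and> Q \<in> cliques (same_dist s) X r \<and>
      irregularity (same_dist s) X r (\<theta> * real (card X)) Q \<le> \<omega> * real (card X)"
      using sQ(2) unfolding n_def by (intro exI[of _ s] exI[of _ Q] conjI)
  qed
qed

text \<open>The loss per class is \<open>sqrt \<omega> + \<omega>\<close> for forming it and
  \<open>8 * r * \<theta>\<close> for moving it onto a sphere. The bounds on \<kappa> and on the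
  number of points leave at least \<open>n / (2 * r)\<close> \<ge> 3 points to spare, as the choice
  of triples demands.\<close>

lemma regular_clique_lenz_spheres:
  fixes X :: "'a::euclidean_space set" and \<theta> \<omega> \<kappa> :: real
  assumes r: "3 \<le> r" and DIM: "DIM('a) = 2 * r + 1" and X: "finite X" and s: "s \<noteq> 0"
    and Q: "Q \<in> cliques (same_dist s) X r"
    and irr: "irregularity (same_dist s) X r (\<theta> * real (card X)) Q \<le> \<omega> * real (card X)"
    and \<theta>: "0 \<le> \<theta>" and \<kappa>: "sqrt \<omega> + \<omega> + 8 * real r * \<theta> \<le> \<kappa>" "\<kappa> \<le> 1 / (2 * real r)"
    and big: "6 * real r \<le> real (card X)"
  shows "\<exists>M. (\<forall>i\<in>{1..r}. M i \<subseteq> X \<and> real (card X) / real r - \<kappa> * real (card X) \<le> real (card (M i))) \<and>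
    disjoint_family_on M {1..r} \<and> lenz_spheres {1..r} s M"
proof -
  define n where "n = real (card X)"
  have n: "0 < n" using big r by (simp add: n_def)
  obtain t where t: "r = Suc t" "1 \<le> t" using r by (cases r) auto
  interpret fin_graph X "same_dist s" by (rule fin_graph_same_dist[OF X s])
  obtain A' where A': "(\<forall>q\<in>Q. A' q \<subseteq> X \<and> n / real r - (sqrt \<omega> + \<omega>) * n \<le> real (card (A' q))) \<and>
    (\<forall>q\<in>Q. \<forall>q'\<in>Q. q \<noteq> q' \<longrightarrow> A' q \<inter> A' q' = {}) \<and>
    (\<forall>q\<in>Q. \<forall>q'\<in>Q. q \<noteq> q' \<longrightarrow> (\<forall>x\<in>A' q. real (card {y \<in> A' q'. dist x y \<noteq> s}) \<le> \<theta> * n))"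
    using multipartite_structure[OF Q[unfolded t(1)] t(2) _ irr[unfolded t(1)]] n
    unfolding n_def t(1) by auto
  have "finite Q" "card Q = r" using Q by (auto simp: cliques_def)
  then obtain h where h: "bij_betw h {1..r} Q"
    using ex_bij_betw_finite_nat[of Q] by (metis bij_betw_iff_card card_atLeastAtMost diff_Suc_1 finite_atLeastAtMost)
  define A where "A i = A' (h i)" for i
  have hQ: "h i \<in> Q" if "i \<in> {1..r}" for i using h that by (rule bij_betwE[rule_format])
  have hne: "h i \<noteq> h j" if "i \<in> {1..r}" "j \<in> {1..r}" "i \<noteq> j" for i j
    using inj_on_eq_iff[OF bij_betw_imp_inj_on[OF h] that(1,2)] that(3) by simp
  have AX: "A i \<subseteq> X" and Asize: "n / real r - (sqrt \<omega> + \<omega>) * n \<le> real (card (A i))" if "i \<in> {1..r}" for i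
    using A' hQ[OF that] by (auto simp: A_def)
  have Adisj: "A i \<inter> A j = {}" if "i \<in> {1..r}" "j \<in> {1..r}" "i \<noteq> j" for i j
    using A' hQ[OF that(1)] hQ[OF that(2)] hne[OF that] by (simp add: A_def)
  interpret NT: near_turan "{1..r}" A s "\<theta> * n"
  proof
    show "finite (A i)" if "i \<in> {1..r}" for i using AX[OF that] X finite_subset by blast
    show "real (card {y \<in> A j. dist x y \<noteq> s}) \<le> \<theta> * n"
      if "i \<in> {1..r}" "j \<in> {1..r}" "i \<noteq> j" "x \<in> A i" for i j x
      using A' hQ[OF that(1)] hQ[OF that(2)] hne[OF that(1-3)] that(4) by (simp add: A_def)
  qed (use r \<theta> n in auto)
  have "\<kappa> * n \<le> 1 / (2 * real r) * n" using \<kappa>(2) n by (intro mult_right_mono) auto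
  then have \<kappa>n: "\<kappa> * n \<le> n / real r / 2" by simp
  have n3: "3 \<le> n / real r / 2" using big r by (simp add: n_def field_simps)
  have \<kappa>1: "(sqrt \<omega> + \<omega>) * n + 8 * real r * (\<theta> * n) \<le> \<kappa> * n"
    using mult_right_mono[OF \<kappa>(1), of n] n by (simp add: algebra_simps)
  have "3 + 8 * real (card {1..r}) * (\<theta> * n) \<le> real (card (A i))" if "i \<in> {1..r}" for i
    using Asize[OF that] \<kappa>n n3 \<kappa>1 by simp
  from NT.lenz_spheres_exist[OF _ this] DIM
  obtain M where M: "\<forall>i\<in>{1..r}. M i \<subseteq> A i \<and> real (card (A i - M i)) \<le> 8 * real r * (\<theta> * n)"
    "lenz_spheres {1..r} s M" by auto
  have "n / real r - \<kappa> * n \<le> real (card (M i))" if i: "i \<in> {1..r}" for i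
  proof -
    have "finite (M i)" using M(1) i NT.fin_A finite_subset by blast
    then have "card (A i - M i) = card (A i) - card (M i)" using M(1) i by (intro card_Diff_subset) auto
    then have "real (card (A i)) \<le> real (card (M i)) + real (card (A i - M i))" by simp
    also have "\<dots> \<le> real (card (M i)) + 8 * real r * (\<theta> * n)" using M(1) i by simp
    finally show ?thesis using Asize[OF i] \<kappa>1 by linarith
  qed
  moreover have "M i \<subseteq> X" if "i \<in> {1..r}" for i using M(1) AX that by blast
  moreover have "disjoint_family_on M {1..r}"
    unfolding disjoint_family_on_def using M(1) Adisj by blast
  ultimately show ?thesis using M(2) unfolding n_def by blast
qed

theorem theorem3:
  fixes r k :: nat and \<epsilon> :: real
  assumes "3 \<le> k" "k \<le> r" and "CARD('n::finite) = 2 * r + 1" and "\<epsilon> > 0"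
  shows "\<exists>\<delta>>0. \<exists>n\<^sub>0>0. \<forall>n\<ge>n\<^sub>0. \<forall>X :: (real ^ 'n) set.
    finite X \<longrightarrow> card X = n \<longrightarrow>
    real (simplex_count k X) \<ge> real (max_simplex_count TYPE(real ^ 'n) k n) - \<delta> * real n ^ k \<longrightarrow>
    (\<exists>(A :: nat \<Rightarrow> (real ^ 'n) set) (C :: nat \<Rightarrow> (real ^ 'n) set)
       (c :: nat \<Rightarrow> real ^ 'n) (\<gamma> :: nat \<Rightarrow> real).
       X = (\<Union>i\<in>{0..r}. A i) \<and> disjoint_family_on A {0..r} \<and>
       real (card (A 0)) < \<epsilon> * real n \<and>
       (\<forall>i\<in>{1..r}. real (card (A i)) > real n / real r - \<epsilon> * real n) \<and>
       (\<forall>i\<in>{1..r}. is_sphere (C i) (c i) (\<gamma> i) \<and> A i \<subseteq> C i) \<and>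
       pairwise (\<lambda>i j. spheres_orthogonal (C i) (C j)) {1..r} \<and>
       (let same_center =
              (\<forall>i\<in>{1..r-1}. sphere_dim (C i) = 1) \<and> sphere_dim (C r) = 2 \<and>
              (\<forall>i\<in>{1..r}. \<forall>j\<in>{1..r}. c i = c j \<and> \<gamma> i = \<gamma> j);
            distinct_centers =
              (\<forall>i\<in>{1..3}. sphere_dim (C i) = 1) \<and>
              pairwise (\<lambda>i j. c i \<noteq> c j) {1..3} \<and>
              (\<exists>b. \<forall>i\<in>{1..3}. \<forall>j\<in>{1..3}. i \<noteq> j \<longrightarrow>
                 (\<forall>x\<in>C i. \<forall>y\<in>C j. norm (x - y) = b))
        in (r \<ge> 4 \<longrightarrow> same_center) \<and> (r = 3 \<longrightarrow> same_center \<or> distinct_centers)))"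
proof -
  have r: "3 \<le> r" using assms by simp
  have DIM: "DIM(real ^ 'n) = 2 * r + 1" using assms(3) by simp
  \<comment> \<open>\<open>\<kappa>\<close> is the relative loss per class; all classes together
    lose at most \<open>\<epsilon> / 2\<close>, which bounds the remainder \<open>A 0\<close>. It is
    spent as \<open>\<kappa> / 4\<close> for each of \<open>sqrt \<omega>\<close> and \<omega>, and
    \<open>\<kappa> / 2\<close> for \<open>8 * r * \<theta>\<close>.\<close>
  define \<kappa> where "\<kappa> = min (\<epsilon> / (2 * real r)) (1 / (2 * real r))"
  define \<theta> where "\<theta> = \<kappa> / (16 * real r)"
  define \<omega> where "\<omega> = (\<kappa> / 4)\<^sup>2"
  have \<kappa>: "0 < \<kappa>" "\<kappa> \<le> 1 / (2 * real r)" "\<kappa> \<le> \<epsilon> / (2 * real r)" using assms(4) r by (auto simp: \<kappa>_def)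
  have "1 / (2 * real r) \<le> 1" using r by simp
  then have \<kappa>1: "\<kappa> \<le> 1" using \<kappa>(2) by linarith
  have pos: "0 < \<theta>" "0 < \<omega>" using \<kappa> r by (simp_all add: \<theta>_def \<omega>_def)
  have "\<omega> \<le> \<kappa> / 4" using \<kappa> \<kappa>1 by (simp add: \<omega>_def power2_eq_square mult_le_one)
  moreover have "sqrt \<omega> = \<kappa> / 4" using \<kappa> by (simp add: \<omega>_def)
  moreover have "8 * real r * \<theta> = \<kappa> / 2" using r by (simp add: \<theta>_def)
  ultimately have sum: "sqrt \<omega> + \<omega> + 8 * real r * \<theta> \<le> \<kappa>" by simp
  have r\<kappa>: "real r * \<kappa> < \<epsilon>"
  proof -
    have "real r * \<kappa> \<le> real r * (\<epsilon> / (2 * real r))" using \<kappa>(3) by (intro mult_left_mono) auto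
    then show ?thesis using r assms(4) by simp
  qed
  have "\<kappa> \<le> real r * \<kappa>" using r \<kappa>(1) by simp
  with r\<kappa> have \<kappa>\<epsilon>: "\<kappa> < \<epsilon>" by linarith
  obtain \<delta> n0 where \<delta>: "0 < \<delta>" and n0: "0 < n0" "\<forall>X :: (real ^ 'n) set. finite X \<longrightarrow> card X \<ge> n0 \<longrightarrow>
    real (simplex_count k X) \<ge> real (max_simplex_count TYPE(real ^ 'n) k (card X)) - \<delta> * real (card X) ^ k \<longrightarrow>
    (\<exists>s Q. s \<noteq> 0 \<and> Q \<in> cliques (same_dist s) X r \<and>
      irregularity (same_dist s) X r (\<theta> * real (card X)) Q \<le> \<omega> * real (card X))"
    using near_extremal_clique[OF assms(1,2) DIM pos] by blast
  show ?thesis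
  proof (intro exI[of _ \<delta>] exI[of _ "max n0 (6 * r)"] conjI allI impI)
    show "0 < \<delta>" "0 < max n0 (6 * r)" using \<delta> n0(1) by auto
    fix n :: nat and X :: "(real ^ 'n) set"
    assume n: "max n0 (6 * r) \<le> n" and X: "finite X" "card X = n"
      and count: "real (max_simplex_count TYPE(real ^ 'n) k n) - \<delta> * real n ^ k \<le> real (simplex_count k X)"
    have npos: "0 < real n" using n r by simp
    obtain s Q where s: "s \<noteq> 0" and Q: "Q \<in> cliques (same_dist s) X r"
      and irr: "irregularity (same_dist s) X r (\<theta> * real (card X)) Q \<le> \<omega> * real (card X)"
      using n0(2) X n count by force
    have \<theta>0: "0 \<le> \<theta>" using pos by simp
    have big: "6 * real r \<le> real (card X)" using n X(2) by simp
    obtain M where M: "\<forall>i\<in>{1..r}. M i \<subseteq> X \<and> real n / real r - \<kappa> * real n \<le> real (card (M i))"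
      "disjoint_family_on M {1..r}" "lenz_spheres {1..r} s M"
      using regular_clique_lenz_spheres[OF r DIM X(1) s Q irr \<theta>0 sum \<kappa>(2) big] X(2) by blast
    obtain c U \<gamma> where sph: "\<forall>i\<in>{1..r}. subspace (U i) \<and> \<gamma> i > 0 \<and> M i \<subseteq> sphere_in (c i) (U i) (\<gamma> i)"
      and orth: "\<forall>i\<in>{1..r}. \<forall>j\<in>{1..r}. i \<noteq> j \<longrightarrow> (\<forall>u\<in>U i. \<forall>v\<in>U j. u \<bullet> v = 0)"
      and alt: "(\<exists>i0\<in>{1..r}. dim (U i0) = 3 \<and> (\<forall>i\<in>{1..r} - {i0}. dim (U i) = 2) \<and>
          (\<forall>i\<in>{1..r}. \<forall>j\<in>{1..r}. c i = c j \<and> \<gamma> i = \<gamma> j)) \<or>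
        (card {1..r} = 3 \<and> (\<forall>i\<in>{1..r}. dim (U i) = 2) \<and>
          (\<forall>i\<in>{1..r}. \<forall>j\<in>{1..r}. i \<noteq> j \<longrightarrow> c i \<noteq> c j \<and>
            (\<forall>x\<in>sphere_in (c i) (U i) (\<gamma> i). \<forall>y\<in>sphere_in (c j) (U j) (\<gamma> j). norm (x - y) = s)))"
      using M(3) unfolding lenz_spheres_def by (elim exE conjE)
    have dim1: "1 \<le> dim (U i)" if "i \<in> {1..r}" for i
    proof -
      have "dim (U i) = 2 \<or> dim (U i) = 3" using alt that by blast
      then show ?thesis by linarith
    qed
    let ?C = "\<lambda>i. sphere_in (c i) (U i) (\<gamma> i)"
    have sdim: "sphere_dim (?C i) = int (dim (U i)) - 1" if "i \<in> {1..r}" for i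
      using sph dim1[OF that] that by (intro sphere_dim_sphere_in) auto
    \<comment> \<open>Everything but the final clause is shared by the two alternatives, so that
      clause is abstracted as \<open>P\<close>; the renumbering \<sigma> allows the 2-sphere to be
      put last.\<close>
    have conclusion: "\<exists>A C c \<gamma>. X = (\<Union>i\<in>{0..r}. A i) \<and> disjoint_family_on A {0..r} \<and>
       real (card (A 0)) < \<epsilon> * real n \<and>
       (\<forall>i\<in>{1..r}. real (card (A i)) > real n / real r - \<epsilon> * real n) \<and>
       (\<forall>i\<in>{1..r}. is_sphere (C i) (c i) (\<gamma> i) \<and> A i \<subseteq> C i) \<and>
       pairwise (\<lambda>i j. spheres_orthogonal (C i) (C j)) {1..r} \<and> P C c \<gamma>"
      if \<sigma>: "bij_betw \<sigma> {1..r} {1..r}" and P: "P (?C \<circ> \<sigma>) (c \<circ> \<sigma>) (\<gamma> \<circ> \<sigma>)" for \<sigma> P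
    proof -
      have \<sigma>I: "\<sigma> i \<in> {1..r}" if "i \<in> {1..r}" for i using bij_betwE[OF \<sigma>] that by blast
      have \<sigma>ne: "\<sigma> i \<noteq> \<sigma> j" if "i \<in> {1..r}" "j \<in> {1..r}" "i \<noteq> j" for i j
        using inj_on_eq_iff[OF bij_betw_imp_inj_on[OF \<sigma>] that(1,2)] that(3) by simp
      define M0 where "M0 = (\<Union>i\<in>{1..r}. M i)"
      define A where "A i = (if i = 0 then X - M0 else M (\<sigma> i))" for i
      have M0X: "M0 \<subseteq> X" using M(1) by (auto simp: M0_def)
      have finM: "finite (M i)" if "i \<in> {1..r}" for i using M(1) that X(1) finite_subset by blast
      have UA: "(\<Union>i\<in>{1..r}. A i) = M0"
      proof -
        have "(\<Union>i\<in>{1..r}. A i) = (\<Union>i\<in>{1..r}. M (\<sigma> i))" by (rule SUP_cong) (auto simp: A_def)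
        also have "\<dots> = (\<Union>i\<in>\<sigma> ` {1..r}. M i)" by blast
        finally show ?thesis unfolding bij_betw_imp_surj_on[OF \<sigma>] M0_def .
      qed
      have ins: "{0..r} = insert 0 {1..r}" by auto
      have XA: "X = (\<Union>i\<in>{0..r}. A i)"
        unfolding ins UN_insert UA using M0X by (auto simp: A_def)
      have disj: "disjoint_family_on A {0..r}"
      proof (unfold disjoint_family_on_def, intro ballI impI)
        fix i j assume ij: "i \<in> {0..r}" "j \<in> {0..r}" "i \<noteq> j"
        have sub: "A l \<subseteq> M0" if "l \<in> {0..r}" "l \<noteq> 0" for l unfolding UA[symmetric] using that by (intro UN_upper) auto
        have A0: "A 0 = X - M0" by (simp add: A_def)
        consider "i = 0" | "j = 0" | "i \<noteq> 0" "j \<noteq> 0" by blast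
        then show "A i \<inter> A j = {}"
        proof cases
          case 1 then show ?thesis using sub[of j] ij A0 by auto
        next
          case 2 then show ?thesis using sub[of i] ij A0 by auto
        next
          case 3
          then have "i \<in> {1..r}" "j \<in> {1..r}" using ij by auto
          then show ?thesis using M(2) \<sigma>I \<sigma>ne ij(3) 3 by (simp add: A_def disjoint_family_on_def)
        qed
      qed
      have "real n - real r * \<kappa> * real n = (\<Sum>i\<in>{1..r}. real n / real r - \<kappa> * real n)"
        using r by (simp add: algebra_simps)
      also have "\<dots> \<le> (\<Sum>i\<in>{1..r}. real (card (M i)))" using M(1) by (intro sum_mono) auto
      also have "\<dots> = real (card M0)"
        unfolding M0_def using M(2) finM
        by (subst card_UN_disjoint) (auto simp: disjoint_family_on_def)
      finally have cM0: "real n - real r * \<kappa> * real n \<le> real (card M0)" .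
      have "card (A 0) = n - card M0"
        using X M0X by (simp add: A_def card_Diff_subset finite_subset)
      moreover have "card M0 \<le> n" using card_mono[OF X(1) M0X] X(2) by simp
      ultimately have "real (card (A 0)) \<le> real r * \<kappa> * real n" using cM0 by simp
      also have "\<dots> < \<epsilon> * real n" using r\<kappa> npos by simp
      finally have c0: "real (card (A 0)) < \<epsilon> * real n" .
      have ci: "real n / real r - \<epsilon> * real n < real (card (A i))" if i: "i \<in> {1..r}" for i
      proof -
        have "real n / real r - \<kappa> * real n \<le> real (card (A i))"
          using M(1) \<sigma>I[OF i] i by (simp add: A_def)
        moreover have "\<kappa> * real n < \<epsilon> * real n" using \<kappa>\<epsilon> npos by simp
        ultimately show ?thesis by linarith
      qed
      have is_sph: "is_sphere ((?C \<circ> \<sigma>) i) ((c \<circ> \<sigma>) i) ((\<gamma> \<circ> \<sigma>) i) \<and> A i \<subseteq> (?C \<circ> \<sigma>) i"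
        if i: "i \<in> {1..r}" for i
      proof
        have h: "subspace (U (\<sigma> i))" "0 < \<gamma> (\<sigma> i)" "M (\<sigma> i) \<subseteq> ?C (\<sigma> i)"
          using sph \<sigma>I[OF i] by blast+
        show "is_sphere ((?C \<circ> \<sigma>) i) ((c \<circ> \<sigma>) i) ((\<gamma> \<circ> \<sigma>) i)"
          using is_sphere_sphere_in[OF h(1) dim1[OF \<sigma>I[OF i]] h(2)] by simp
        show "A i \<subseteq> (?C \<circ> \<sigma>) i" using h(3) i by (simp add: A_def)
      qed
      have orths: "pairwise (\<lambda>i j. spheres_orthogonal ((?C \<circ> \<sigma>) i) ((?C \<circ> \<sigma>) j)) {1..r}"
      proof (unfold pairwise_def, intro ballI impI)
        fix i j assume ij: "i \<in> {1..r}" "j \<in> {1..r}" "i \<noteq> j"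
        show "spheres_orthogonal ((?C \<circ> \<sigma>) i) ((?C \<circ> \<sigma>) j)"
          unfolding comp_def
        proof (rule spheres_orthogonal_sphere_in)
          show "u \<bullet> v = 0" if "u \<in> U (\<sigma> i)" "v \<in> U (\<sigma> j)" for u v
            using orth \<sigma>I[OF ij(1)] \<sigma>I[OF ij(2)] \<sigma>ne[OF ij] that by blast
        qed (use sph dim1 \<sigma>I[OF ij(1)] \<sigma>I[OF ij(2)] in blast)+
      qed
      show ?thesis
        by (rule exI[of _ A], rule exI[of _ "?C \<circ> \<sigma>"], rule exI[of _ "c \<circ> \<sigma>"], rule exI[of _ "\<gamma> \<circ> \<sigma>"])
          (intro conjI ballI XA disj c0 ci is_sph[THEN conjunct1] is_sph[THEN conjunct2] orths P)
    qed
    show "\<exists>A C c \<gamma>. X = (\<Union>i\<in>{0..r}. A i) \<and> disjoint_family_on A {0..r} \<and>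
       real (card (A 0)) < \<epsilon> * real n \<and>
       (\<forall>i\<in>{1..r}. real (card (A i)) > real n / real r - \<epsilon> * real n) \<and>
       (\<forall>i\<in>{1..r}. is_sphere (C i) (c i) (\<gamma> i) \<and> A i \<subseteq> C i) \<and>
       pairwise (\<lambda>i j. spheres_orthogonal (C i) (C j)) {1..r} \<and>
       (let same_center =
              (\<forall>i\<in>{1..r-1}. sphere_dim (C i) = 1) \<and> sphere_dim (C r) = 2 \<and>
              (\<forall>i\<in>{1..r}. \<forall>j\<in>{1..r}. c i = c j \<and> \<gamma> i = \<gamma> j);
            distinct_centers =
              (\<forall>i\<in>{1..3}. sphere_dim (C i) = 1) \<and>
              pairwise (\<lambda>i j. c i \<noteq> c j) {1..3} \<and>
              (\<exists>b. \<forall>i\<in>{1..3}. \<forall>j\<in>{1..3}. i \<noteq> j \<longrightarrow>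
                 (\<forall>x\<in>C i. \<forall>y\<in>C j. norm (x - y) = b))
        in (r \<ge> 4 \<longrightarrow> same_center) \<and> (r = 3 \<longrightarrow> same_center \<or> distinct_centers))"
      using alt
    proof (elim disjE bexE conjE)
      fix i0 assume i0: "i0 \<in> {1..r}" "dim (U i0) = 3" "\<forall>i\<in>{1..r} - {i0}. dim (U i) = 2"
        "\<forall>i\<in>{1..r}. \<forall>j\<in>{1..r}. c i = c j \<and> \<gamma> i = \<gamma> j"
      \<comment> \<open>The transposition gives the index \<open>r\<close> to the class with the
        three-dimensional direction space.\<close>
      define \<sigma> where "\<sigma> = Transposition.transpose i0 r"
      have \<sigma>: "bij_betw \<sigma> {1..r} {1..r}"
        unfolding \<sigma>_def using i0(1) r by (intro bij_betw_transpose_iff) auto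
      have \<sigma>I: "\<sigma> i \<in> {1..r}" if "i \<in> {1..r}" for i using bij_betwE[OF \<sigma>] that by blast
      have \<sigma>r: "\<sigma> r = i0" by (simp add: \<sigma>_def)
      have \<sigma>i: "\<sigma> i \<noteq> i0" if "i \<in> {1..r-1}" for i
        using that r by (auto simp: \<sigma>_def Transposition.transpose_def)
      have same: "(\<forall>i\<in>{1..r-1}. sphere_dim ((?C \<circ> \<sigma>) i) = 1) \<and> sphere_dim ((?C \<circ> \<sigma>) r) = 2 \<and>
          (\<forall>i\<in>{1..r}. \<forall>j\<in>{1..r}. (c \<circ> \<sigma>) i = (c \<circ> \<sigma>) j \<and> (\<gamma> \<circ> \<sigma>) i = (\<gamma> \<circ> \<sigma>) j)"
      proof (intro conjI ballI)
        show "sphere_dim ((?C \<circ> \<sigma>) i) = 1" if i: "i \<in> {1..r-1}" for i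
        proof -
          have "\<sigma> i \<in> {1..r}" using \<sigma>I i by auto
          then show ?thesis using sdim \<sigma>i[OF i] i0(3) by simp
        qed
        show "sphere_dim ((?C \<circ> \<sigma>) r) = 2" using sdim[OF i0(1)] i0(2) by (simp add: \<sigma>r)
        fix i j assume ij: "i \<in> {1..r}" "j \<in> {1..r}"
        have "c (\<sigma> i) = c (\<sigma> j) \<and> \<gamma> (\<sigma> i) = \<gamma> (\<sigma> j)"
          using i0(4) \<sigma>I[OF ij(1)] \<sigma>I[OF ij(2)] by blast
        then show "(c \<circ> \<sigma>) i = (c \<circ> \<sigma>) j" "(\<gamma> \<circ> \<sigma>) i = (\<gamma> \<circ> \<sigma>) j" by simp_all
      qed
      show ?thesis
        by (rule conclusion[OF \<sigma>]) (unfold Let_def, intro conjI impI disjI1 same)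
    next
      assume a: "card {1..r} = 3" "\<forall>i\<in>{1..r}. dim (U i) = 2"
        "\<forall>i\<in>{1..r}. \<forall>j\<in>{1..r}. i \<noteq> j \<longrightarrow> c i \<noteq> c j \<and>
            (\<forall>x\<in>?C i. \<forall>y\<in>?C j. norm (x - y) = s)"
      then have r3: "r = 3" by simp
      have distinct: "(\<forall>i\<in>{1..3}. sphere_dim ((?C \<circ> id) i) = 1) \<and>
          pairwise (\<lambda>i j. (c \<circ> id) i \<noteq> (c \<circ> id) j) {1..3} \<and>
          (\<exists>b. \<forall>i\<in>{1..3}. \<forall>j\<in>{1..3}. i \<noteq> j \<longrightarrow>
             (\<forall>x\<in>(?C \<circ> id) i. \<forall>y\<in>(?C \<circ> id) j. norm (x - y) = b))"
        using a(2,3) sdim unfolding r3 pairwise_def by (intro conjI exI[of _ s]) simp_all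
      show ?thesis
        by (rule conclusion[OF bij_betw_id]) (unfold Let_def, rule conjI, use r3 in simp, intro impI, rule disjI2, rule distinct)
    qed
  qed
qed

end
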